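(* Let $k\ge1$. Let $P$ denote the set of primitive elements of $\mathbf{F}_k$ and let $\widehat{P}$ denote the set of primitive elements of the profinite completion $\widehat{\mathbf{F}}_k$. Then $$P=\widehat{P}\cap\mathbf{F}_k.$$
   Context: $\mathbf{F}_k$ is the free group of rank $k$, regarded as embedded in its profinite completion $\widehat{\mathbf{F}}_k$ via the canonical (injective) map. An element of $\mathbf{F}_k$ is primitive if it belongs to some basis (free generating set) of $\mathbf{F}_k$. A basis of $\widehat{\mathbf{F}}_k$ is a set $S\subset\widehat{\mathbf{F}}_k$ such that every map from $S$ to a profinite group $G$ admits a unique extension to a continuous homomorphism $\widehat{\mathbf{F}}_k\to G$. An element of $\widehat{\mathbf{F}}_k$ is primitive if it belongs to a basis of $\widehat{\mathbf{F}}_k$. *)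

theory Defs
  imports
    "HOL-Algebra.Product_Groups"
    "HOL-Analysis.Abstract_Topological_Spaces"
    "HOL-Analysis.Function_Topology"
begin

section \<open>Free groups\<close>

text \<open>A letter \<open>(x, True)\<close> stands for \<open>x\<close> and \<open>(x, False)\<close> for its inverse.\<close>

definition reduced_word :: "('a \<times> bool) list \<Rightarrow> bool" where
  "reduced_word = successively (\<lambda>(x, b) (y, c). \<not> (x = y \<and> b \<noteq> c))"

fun word_value :: "('a, 'm) monoid_scheme \<Rightarrow> ('a \<times> bool) list \<Rightarrow> 'a" where
  "word_value G [] = \<one>\<^bsub>G\<^esub>"
| "word_value G ((x, b) # w) = (if b then x else inv\<^bsub>G\<^esub> x) \<otimes>\<^bsub>G\<^esub> word_value G w"

definition free_basis :: "('a, 'm) monoid_scheme \<Rightarrow> 'a set \<Rightarrow> bool" where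
  "free_basis G B \<longleftrightarrow> B \<subseteq> carrier G \<and>
     bij_betw (word_value G) {w \<in> lists (B \<times> UNIV). reduced_word w} (carrier G)"

definition free_group_of_rank :: "('a, 'm) monoid_scheme \<Rightarrow> nat \<Rightarrow> bool" where
  "free_group_of_rank G k \<longleftrightarrow> group G \<and> (\<exists>B. free_basis G B \<and> finite B \<and> card B = k)"

definition primitive_elements :: "('a, 'm) monoid_scheme \<Rightarrow> 'a set" where
  "primitive_elements G = {x. \<exists>B. free_basis G B \<and> x \<in> B}"


section \<open>Profinite groups\<close>

definition topological_group :: "('a, 'm) monoid_scheme \<Rightarrow> 'a topology \<Rightarrow> bool" where
  "topological_group G T \<longleftrightarrow> group G \<and> topspace T = carrier G \<and>
     continuous_map (prod_topology T T) T (\<lambda>(x, y). x \<otimes>\<^bsub>G\<^esub> y) \<and>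
     continuous_map T T (\<lambda>x. inv\<^bsub>G\<^esub> x)"

definition profinite_group :: "('a, 'm) monoid_scheme \<Rightarrow> 'a topology \<Rightarrow> bool" where
  "profinite_group G T \<longleftrightarrow> topological_group G T \<and> compact_space T \<and> Hausdorff_space T \<and>
     (\<forall>x \<in> topspace T. connected_component_of_set T x = {x})"

text \<open>
  Maps out of \<open>H\<close> are taken to be extensional, since otherwise no map would be unique.
  HOL cannot quantify over all types inside a definition, so the test groups \<open>G\<close> are those
  whose elements are of the same type as those of \<open>H\<close>. By \<open>profinite_basis_universal\<close> below,
  as soon as this type is infinite, the universal property then holds for profinite groups of
  every type; \<open>profinite_basis_completion_universal\<close> is the case of free groups.
\<close>

definition profinite_basis :: "('h, 'm) monoid_scheme \<Rightarrow> 'h topology \<Rightarrow> 'h set \<Rightarrow> bool" where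
  "profinite_basis H T S \<longleftrightarrow> S \<subseteq> carrier H \<and>
     (\<forall>(G :: 'h monoid) U f. profinite_group G U \<and> f \<in> S \<rightarrow> carrier G \<longrightarrow>
        (\<exists>!\<phi>. \<phi> \<in> hom H G \<inter> extensional (carrier H) \<and> continuous_map T U \<phi> \<and>
              (\<forall>s\<in>S. \<phi> s = f s)))"

definition profinite_primitive_elements :: "('h, 'm) monoid_scheme \<Rightarrow> 'h topology \<Rightarrow> 'h set" where
  "profinite_primitive_elements H T = {x. \<exists>S. profinite_basis H T S \<and> x \<in> S}"


section \<open>The profinite completion\<close>

definition finite_index_normal :: "('a, 'm) monoid_scheme \<Rightarrow> 'a set set" where
  "finite_index_normal G = {N. N \<lhd> G \<and> finite (rcosets\<^bsub>G\<^esub> N)}"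

text \<open>
  The inverse limit of the finite quotients \<open>G Mod N\<close>: for \<open>N \<subseteq> M\<close> the natural map
  \<open>G Mod N \<rightarrow> G Mod M\<close> sends a coset of \<open>N\<close> to the unique coset of \<open>M\<close> that contains it.
\<close>

definition profinite_completion :: "('a, 'm) monoid_scheme \<Rightarrow> ('a set \<Rightarrow> 'a set) monoid" where
  "profinite_completion G =
     (product_group (finite_index_normal G) (\<lambda>N. G Mod N))
       \<lparr>carrier := {x \<in> (\<Pi>\<^sub>E N\<in>finite_index_normal G. rcosets\<^bsub>G\<^esub> N).
          \<forall>N\<in>finite_index_normal G. \<forall>M\<in>finite_index_normal G. N \<subseteq> M \<longrightarrow> x N \<subseteq> x M}\<rparr>"

definition completion_topology :: "('a, 'm) monoid_scheme \<Rightarrow> ('a set \<Rightarrow> 'a set) topology" where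
  "completion_topology G =
     subtopology
       (product_topology (\<lambda>N. discrete_topology (rcosets\<^bsub>G\<^esub> N)) (finite_index_normal G))
       (carrier (profinite_completion G))"

definition completion_map :: "('a, 'm) monoid_scheme \<Rightarrow> 'a \<Rightarrow> 'a set \<Rightarrow> 'a set" where
  "completion_map G x = (\<lambda>N\<in>finite_index_normal G. N #>\<^bsub>G\<^esub> x)"


section \<open>Profinite bases are independent of the type of the test groups\<close>

lemma profinite_openin_normal:
  fixes G (structure)
  assumes G: "profinite_group G U" and W: "openin U W" "\<one> \<in> W"
  obtains N where "N \<lhd> G" "openin U N" "N \<subseteq> W"
proof -
  interpret group G using G by (simp add: profinite_group_def topological_group_def)
  have top: "topspace U = carrier G"
    and mult: "continuous_map (prod_topology U U) U (\<lambda>(x, y). x \<otimes>\<^bsub>G\<^esub> y)"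
    and comp: "compact_space U" and haus: "Hausdorff_space U"
    and td: "\<And>x. x \<in> carrier G \<Longrightarrow> connected_component_of_set U x = {x}"
    using G by (auto simp: profinite_group_def topological_group_def)
  have "quasi_component_of_set U \<one> = {\<one>}"
    using td[OF one_closed] comp haus
    by (simp add: quasi_eq_connected_component_of)
  then have "{\<one>} \<in> quasi_components_of U"
    by (metis one_closed quasi_component_in_quasi_components_of top)
  moreover have "compactin U (topspace U - W)"
    using comp W(1) by (simp add: closedin_compact_space openin_closedin_eq)
  moreover have "disjnt {\<one>} (topspace U - W)" using W(2) by simp
  ultimately have "separated_between U {\<one>} (topspace U - W)"
    by (simp add: separated_between_quasi_component_compact)
  then obtain K where K: "closedin U K" "openin U K" "\<one> \<in> K" "K \<subseteq> W"
    unfolding separated_between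
    by (smt (verit) Diff_iff empty_subsetI insert_subset openin_subset subset_iff)
  define N where "N = {g \<in> carrier G. \<forall>a\<in>carrier G. \<forall>b\<in>carrier G. a \<otimes> g \<otimes> b \<in> K \<longleftrightarrow> a \<otimes> b \<in> K}"
  have ND: "a \<otimes> g \<otimes> b \<in> K \<longleftrightarrow> a \<otimes> b \<in> K"
    if "g \<in> N" "a \<in> carrier G" "b \<in> carrier G" for a b g
    using that by (auto simp: N_def)
  have NC: "g \<in> carrier G" if "g \<in> N" for g using that by (auto simp: N_def)
  have sub: "subgroup N G"
  proof (rule subgroupI)
    show "N \<subseteq> carrier G" "N \<noteq> {}" by (auto simp: N_def intro: exI[of _ \<one>])
    show "inv g \<in> N" if "g \<in> N" for g
      unfolding N_def
    proof (intro CollectI conjI ballI)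
      show "inv g \<in> carrier G" using NC that by simp
      fix a b assume ab: "a \<in> carrier G" "b \<in> carrier G"
      show "a \<otimes> inv g \<otimes> b \<in> K \<longleftrightarrow> a \<otimes> b \<in> K"
        using ND[OF that, of "a \<otimes> inv g" b] ab NC[OF that] by (simp add: m_assoc)
    qed
    show "g \<otimes> h \<in> N" if "g \<in> N" "h \<in> N" for g h
      unfolding N_def
    proof (intro CollectI conjI ballI)
      show "g \<otimes> h \<in> carrier G" using NC that by simp
      fix a b assume ab: "a \<in> carrier G" "b \<in> carrier G"
      show "a \<otimes> (g \<otimes> h) \<otimes> b \<in> K \<longleftrightarrow> a \<otimes> b \<in> K"
        using ND[OF that(1), of a "h \<otimes> b"] ND[OF that(2) ab] ab NC that by (simp add: m_assoc)
    qed
  qed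
  have nor: "N \<lhd> G"
    unfolding normal_inv_iff
  proof (intro conjI sub ballI)
    fix x g assume x: "x \<in> carrier G" and g: "g \<in> N"
    show "x \<otimes> g \<otimes> inv x \<in> N"
      unfolding N_def
    proof (intro CollectI conjI ballI)
      show "x \<otimes> g \<otimes> inv x \<in> carrier G" using NC x g by simp
      fix a b assume ab: "a \<in> carrier G" "b \<in> carrier G"
      show "a \<otimes> (x \<otimes> g \<otimes> inv x) \<otimes> b \<in> K \<longleftrightarrow> a \<otimes> b \<in> K"
        using ND[OF g, of "a \<otimes> x" "inv x \<otimes> b"] ab NC[OF g] x
        by (simp add: m_assoc) (simp add: m_assoc[symmetric])
    qed
  qed
  have "N \<subseteq> K"
  proof
    fix g assume "g \<in> N" then show "g \<in> K" using ND[of g \<one> \<one>] NC K(3) by simp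
  qed
  let ?P = "prod_topology (prod_topology U U) U"
  define A where "A = {p \<in> topspace ?P. (case p of ((a, b), g) \<Rightarrow> a \<otimes> g \<otimes> b) \<in> K}"
  define B where "B = {p \<in> topspace ?P. (case p of ((a, b), g) \<Rightarrow> a \<otimes> b) \<in> K}"
  have m: "continuous_map ?P U (\<lambda>p. f p \<otimes> h p)"
    if "continuous_map ?P U f" "continuous_map ?P U h" for f h
    using continuous_map_compose[OF continuous_map_pairedI[OF that] mult] by (simp add: o_def)
  have p: "continuous_map ?P U (\<lambda>p. fst (fst p))" "continuous_map ?P U (\<lambda>p. snd (fst p))"
    "continuous_map ?P U snd"
    using continuous_map_compose[OF continuous_map_fst continuous_map_fst, of U U U]
      continuous_map_compose[OF continuous_map_fst continuous_map_snd, of U U U]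
    by (simp_all add: o_def continuous_map_snd)
  have "continuous_map ?P U (\<lambda>p. case p of ((a, b), g) \<Rightarrow> a \<otimes> g \<otimes> b)"
    "continuous_map ?P U (\<lambda>p. case p of ((a, b), g) \<Rightarrow> a \<otimes> b)"
    using m[OF m[OF p(1,3)] p(2)] m[OF p(1,2)] by (simp_all add: case_prod_unfold)
  from openin_continuous_map_preimage[OF this(1) K(2)] openin_continuous_map_preimage[OF this(2) K(2)]
    closedin_continuous_map_preimage[OF this(1) K(1)] closedin_continuous_map_preimage[OF this(2) K(1)]
  have "openin ?P A" "closedin ?P A" "openin ?P B" "closedin ?P B"
    by (simp_all only: A_def B_def)
  then have "closedin ?P ((A - B) \<union> (B - A))"
    by (intro closedin_Un closedin_diff)
  moreover have "closed_map ?P U snd"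
    using comp by (intro closed_map_snd) (simp add: compact_space_prod_topology)
  ultimately have "closedin U (snd ` ((A - B) \<union> (B - A)))"
    by (simp add: closed_map_def)
  moreover have "N = topspace U - snd ` ((A - B) \<union> (B - A))"
  proof -
    have "g \<in> snd ` ((A - B) \<union> (B - A)) \<longleftrightarrow> g \<in> carrier G \<and>
        (\<exists>a\<in>carrier G. \<exists>b\<in>carrier G. (a \<otimes> g \<otimes> b \<in> K) \<noteq> (a \<otimes> b \<in> K))" for g
      unfolding A_def B_def image_iff by (simp add: top Bex_def) blast
    then show ?thesis by (auto simp: N_def top)
  qed
  ultimately have "openin U N" by blast
  with nor \<open>N \<subseteq> K\<close> \<open>K \<subseteq> W\<close> that show thesis by blast
qed

lemma finite_discrete_profinite:
  assumes "group Q" "finite (carrier Q)"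
  shows "profinite_group Q (discrete_topology (carrier Q))"
proof -
  interpret group Q by fact
  have "y = x" if "connected_component_of (discrete_topology (carrier Q)) x y" for x y
    using that unfolding connected_component_of_def connectedin_discrete_topology by blast
  then have "connected_component_of_set (discrete_topology (carrier Q)) x = {x}" if "x \<in> carrier Q" for x
    using that by (auto simp: connected_component_of_refl)
  then show ?thesis
    using assms
    by (auto simp: profinite_group_def topological_group_def compact_space_discrete_topology
        simp flip: prod_topology_discrete_topology)
qed

lemma profinite_basis_finite:
  fixes H :: "('h, 'm) monoid_scheme" and Q :: "('q, 'n) monoid_scheme"
  assumes inf: "infinite (UNIV :: 'h set)" and H: "topological_group H T"
    and S: "profinite_basis H T S" and Q: "group Q" "finite (carrier Q)" and f: "f \<in> S \<rightarrow> carrier Q"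
  shows "\<exists>!\<phi>. \<phi> \<in> hom H Q \<inter> extensional (carrier H) \<and>
           continuous_map T (discrete_topology (carrier Q)) \<phi> \<and> (\<forall>s\<in>S. \<phi> s = f s)"
    (is "\<exists>!\<phi>. ?P \<phi>")
proof -
  interpret Q: group Q by fact
  interpret H: group H using H by (simp add: topological_group_def)
  have top: "topspace T = carrier H" using H by (simp add: topological_group_def)
  obtain B :: "'h set" where "finite B" "card B = card (carrier Q)"
    using infinite_arbitrarily_large[OF inf] by blast
  then obtain e :: "'q \<Rightarrow> 'h" where e: "inj_on e (carrier Q)"
    using card_le_inj[OF Q(2), of B] by auto
  define d where "d = inv_into (carrier Q) e"
  have de [simp]: "d (e x) = x" if "x \<in> carrier Q" for x using e that by (simp add: d_def)
  define R :: "'h monoid" where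
    "R = \<lparr>carrier = e ` carrier Q, mult = (\<lambda>x y. e (d x \<otimes>\<^bsub>Q\<^esub> d y)), one = e \<one>\<^bsub>Q\<^esub>\<rparr>"
  have R: "group R"
  proof (rule groupI)
    fix x assume "x \<in> carrier R"
    then obtain u where "u \<in> carrier Q" "x = e u" by (auto simp: R_def)
    then show "\<exists>y\<in>carrier R. y \<otimes>\<^bsub>R\<^esub> x = \<one>\<^bsub>R\<^esub>"
      by (intro bexI[of _ "e (inv\<^bsub>Q\<^esub> u)"]) (auto simp: R_def)
  qed (auto simp: R_def Q.m_assoc)
  have SH: "S \<subseteq> carrier H" using S by (simp add: profinite_basis_def)
  let ?R = "\<lambda>\<psi>. \<psi> \<in> hom H R \<inter> extensional (carrier H) \<and>
           continuous_map T (discrete_topology (carrier R)) \<psi> \<and> (\<forall>s\<in>S. \<psi> s = e (f s))"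
  have "profinite_group R (discrete_topology (carrier R))"
    using R Q(2) by (intro finite_discrete_profinite) (auto simp: R_def)
  moreover have "(\<lambda>s. e (f s)) \<in> S \<rightarrow> carrier R" using f by (auto simp: R_def)
  ultimately have ex1: "\<exists>!\<psi>. ?R \<psi>"
    using S unfolding profinite_basis_def by blast
  then obtain \<psi> where \<psi>: "?R \<psi>" by blast
  have dR: "d x \<in> carrier Q" if "x \<in> carrier R" for x using that by (auto simp: R_def)
  have ex: "?P (\<lambda>x\<in>carrier H. d (\<psi> x))"
  proof (intro conjI IntI ballI)
    have "d (\<psi> (x \<otimes>\<^bsub>H\<^esub> y)) = d (\<psi> x) \<otimes>\<^bsub>Q\<^esub> d (\<psi> y)" if "x \<in> carrier H" "y \<in> carrier H" for x y
    proof -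
      have "\<psi> (x \<otimes>\<^bsub>H\<^esub> y) = e (d (\<psi> x) \<otimes>\<^bsub>Q\<^esub> d (\<psi> y))"
        using \<psi> that by (auto simp: hom_def R_def)
      moreover have "d (\<psi> x) \<in> carrier Q" "d (\<psi> y) \<in> carrier Q"
        using \<psi> that by (auto simp: hom_def intro: dR)
      ultimately show ?thesis by simp
    qed
    then show "(\<lambda>x\<in>carrier H. d (\<psi> x)) \<in> hom H Q"
      using \<psi> by (auto simp: hom_def intro: dR)
    have "continuous_map T (discrete_topology (carrier Q)) (d \<circ> \<psi>)"
      using \<psi> dR by (intro continuous_map_compose[of T "discrete_topology (carrier R)"]) auto
    then show "continuous_map T (discrete_topology (carrier Q)) (\<lambda>x\<in>carrier H. d (\<psi> x))"
      by (rule continuous_map_eq) (simp add: top)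
    show "(\<lambda>x\<in>carrier H. d (\<psi> x)) s = f s" if "s \<in> S" for s
    proof -
      have "f s \<in> carrier Q" "s \<in> carrier H" using that SH f by auto
      then show ?thesis using \<psi> that by simp
    qed
  qed simp
  have uniq: "\<phi> = \<phi>'" if P: "?P \<phi>" "?P \<phi>'" for \<phi> \<phi>'
  proof -
    have "?R (\<lambda>x\<in>carrier H. e (\<phi> x))" if "?P \<phi>" for \<phi>
    proof (intro conjI IntI ballI)
      show "(\<lambda>x\<in>carrier H. e (\<phi> x)) \<in> hom H R"
        using that by (auto simp: hom_def R_def Pi_iff)
      have "continuous_map T (discrete_topology (carrier R)) (e \<circ> \<phi>)"
        using that by (intro continuous_map_compose[of T "discrete_topology (carrier Q)"])
          (auto simp: R_def)
      then show "continuous_map T (discrete_topology (carrier R)) (\<lambda>x\<in>carrier H. e (\<phi> x))"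
        by (rule continuous_map_eq) (simp add: top)
      show "(\<lambda>x\<in>carrier H. e (\<phi> x)) s = e (f s)" if "s \<in> S" for s
        using \<open>?P \<phi>\<close> that SH by auto
    qed simp
    then have "(\<lambda>x\<in>carrier H. e (\<phi> x)) = (\<lambda>x\<in>carrier H. e (\<phi>' x))"
      using ex1 P by blast
    then have "e (\<phi> x) = e (\<phi>' x)" if "x \<in> carrier H" for x
      using that by (metis restrict_apply')
    then have "\<phi> x = \<phi>' x" if "x \<in> carrier H" for x
    proof (rule inj_onD[OF e])
      show "\<phi> x \<in> carrier Q" "\<phi>' x \<in> carrier Q" using P that by (auto simp: hom_def)
    qed (use that in blast)
    moreover have "\<phi> \<in> extensional (carrier H)" "\<phi>' \<in> extensional (carrier H)" using P by blast+
    ultimately show ?thesis by (meson extensionalityI)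
  qed
  show ?thesis
    by (rule ex1I[where P = ?P, OF ex]) (rule uniq[OF _ ex])
qed

lemma profinite_openin_rcos:
  fixes G (structure)
  assumes G: "profinite_group G U" and N: "N \<lhd> G" "openin U N" and x: "x \<in> carrier G"
  shows "openin U (N #> x)"
proof -
  interpret normal N G by fact
  have top: "topspace U = carrier G"
    and mult: "continuous_map (prod_topology U U) U (\<lambda>(x, y). x \<otimes> y)"
    using G by (auto simp: profinite_group_def topological_group_def)
  have "continuous_map U U (\<lambda>y. y \<otimes> inv x)"
    using continuous_map_compose[OF continuous_map_pairedI mult, of U "\<lambda>y. y" "\<lambda>y. inv x"] x
    by (simp add: o_def top)
  then have "openin U {y \<in> topspace U. y \<otimes> inv x \<in> N}"
    using N(2) by (rule openin_continuous_map_preimage)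
  also have "{y \<in> topspace U. y \<otimes> inv x \<in> N} = N #> x"
    using x rcos_module r_coset_subset_G[OF subset x] by (auto simp: top)
  finally show ?thesis .
qed

lemma profinite_finite_rcosets:
  fixes G (structure)
  assumes G: "profinite_group G U" and N: "N \<lhd> G" "openin U N"
  shows "finite (rcosets N)"
proof -
  interpret normal N G by fact
  have top: "topspace U = carrier G" and comp: "compact_space U"
    using G by (auto simp: profinite_group_def topological_group_def)
  have un: "\<Union>(rcosets N) = carrier G" by (rule rcosets_part_G) (rule subgroup_axioms)
  have "\<exists>\<F>. finite \<F> \<and> \<F> \<subseteq> rcosets N \<and> topspace U \<subseteq> \<Union>\<F>"
    using comp unfolding compact_space_alt
    by (rule allE[of _ "rcosets N"]) (use profinite_openin_rcos[OF G N] un top in \<open>auto simp: RCOSETS_def\<close>)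
  then obtain \<F> where F: "finite \<F>" "\<F> \<subseteq> rcosets N" "carrier G \<subseteq> \<Union>\<F>" by (auto simp: top)
  have "rcosets N \<subseteq> \<F>"
  proof
    fix C assume C: "C \<in> rcosets N"
    then obtain x where x: "x \<in> C" "x \<in> carrier G"
      using rcosets_non_empty rcosets_carrier by (metis ex_in_conv is_group subsetD)
    then obtain D where D: "D \<in> \<F>" "x \<in> D" using F by blast
    have "C = D"
      using rcos_disjoint[OF subgroup_axioms] C D F(2) x(1) by (auto simp: pairwise_def disjnt_iff)
    then show "C \<in> \<F>" using D by simp
  qed
  then show ?thesis using F(1) finite_subset by blast
qed

theorem profinite_basis_universal:
  fixes H :: "('h, 'm) monoid_scheme" and G :: "('g, 'n) monoid_scheme"
  assumes inf: "infinite (UNIV :: 'h set)" and H: "topological_group H T"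
    and S: "profinite_basis H T S" and G: "profinite_group G U" and f: "f \<in> S \<rightarrow> carrier G"
  shows "\<exists>!\<phi>. \<phi> \<in> hom H G \<inter> extensional (carrier H) \<and> continuous_map T U \<phi> \<and>
           (\<forall>s\<in>S. \<phi> s = f s)"
    (is "\<exists>!\<phi>. ?P \<phi>")
proof -
  interpret G: group G using G by (simp add: profinite_group_def topological_group_def)
  interpret H: group H using H by (simp add: topological_group_def)
  have topT: "topspace T = carrier H" using H by (simp add: topological_group_def)
  have topU: "topspace U = carrier G" and comp: "compact_space U" and haus: "Hausdorff_space U"
    using G by (auto simp: profinite_group_def topological_group_def)
  have SH: "S \<subseteq> carrier H" using S by (simp add: profinite_basis_def)
  define NN where "NN = {N. N \<lhd> G \<and> openin U N}"
  have NN: "N \<lhd> G" "openin U N" "subgroup N G" if "N \<in> NN" for N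
    using that by (auto simp: NN_def normal_imp_subgroup)
  have NN_Int: "N \<inter> M \<in> NN" if "N \<in> NN" "M \<in> NN" for N M
    using that by (auto simp: NN_def G.normal_inv_iff intro: G.subgroups_Inter_pair)
  define R where "R N \<psi> \<longleftrightarrow> \<psi> \<in> hom H (G Mod N) \<inter> extensional (carrier H) \<and>
      continuous_map T (discrete_topology (carrier (G Mod N))) \<psi> \<and> (\<forall>s\<in>S. \<psi> s = N #>\<^bsub>G\<^esub> f s)" for N \<psi>
  have ex1: "\<exists>!\<psi>. R N \<psi>" if "N \<in> NN" for N
    unfolding R_def
  proof (rule profinite_basis_finite[OF inf H S])
    show "group (G Mod N)" using NN[OF that] by (simp add: normal.factorgroup_is_group)
    show "finite (carrier (G Mod N))"
      using profinite_finite_rcosets[OF G] NN[OF that] by (simp add: FactGroup_def)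
    show "(\<lambda>s. N #>\<^bsub>G\<^esub> f s) \<in> S \<rightarrow> carrier (G Mod N)"
      using f by (auto simp: carrier_FactGroup)
  qed
  have R_unique: "\<psi> = \<psi>'" if "N \<in> NN" "R N \<psi>" "R N \<psi>'" for N \<psi> \<psi>'
    using ex1[OF that(1)] that(2,3) by blast
  have coset_cont: "continuous_map U (discrete_topology (carrier (G Mod N))) (\<lambda>g. N #>\<^bsub>G\<^esub> g)"
    if "N \<in> NN" for N
  proof -
    have "openin U {g \<in> topspace U. N #>\<^bsub>G\<^esub> g \<in> V}" for V
    proof (subst openin_subopen, intro ballI)
      fix g assume g: "g \<in> {g \<in> topspace U. N #>\<^bsub>G\<^esub> g \<in> V}"
      show "\<exists>W. openin U W \<and> g \<in> W \<and> W \<subseteq> {g \<in> topspace U. N #>\<^bsub>G\<^esub> g \<in> V}"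
      proof (intro exI conjI)
        show op: "openin U (N #>\<^bsub>G\<^esub> g)"
          using profinite_openin_rcos[OF G NN(1,2)[OF that]] g by (simp add: topU)
        show "g \<in> N #>\<^bsub>G\<^esub> g" using g NN(3)[OF that] by (simp add: topU G.rcos_self)
        have "N #>\<^bsub>G\<^esub> h = N #>\<^bsub>G\<^esub> g" if "h \<in> N #>\<^bsub>G\<^esub> g" for h
          using G.repr_independence[OF that] g NN(3)[OF \<open>N \<in> NN\<close>] by (simp add: topU)
        then show "N #>\<^bsub>G\<^esub> g \<subseteq> {g \<in> topspace U. N #>\<^bsub>G\<^esub> g \<in> V}"
          using g openin_subset[OF op] by auto
      qed
    qed
    then show ?thesis by (simp add: continuous_map topU carrier_FactGroup image_subset_iff)
  qed
  have proj: "R N (\<lambda>x\<in>carrier H. N #>\<^bsub>G\<^esub> \<phi> x)" if "N \<in> NN" "?P \<phi>" for N \<phi>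
    unfolding R_def
  proof (intro conjI IntI ballI)
    interpret N: normal N G using NN that by blast
    have \<phi>: "\<phi> x \<in> carrier G" if "x \<in> carrier H" for x using that \<open>?P \<phi>\<close> by (auto simp: hom_def)
    show "(\<lambda>x\<in>carrier H. N #>\<^bsub>G\<^esub> \<phi> x) \<in> hom H (G Mod N)"
      using \<open>?P \<phi>\<close> \<phi> by (auto simp: hom_def carrier_FactGroup N.rcos_sum)
    show "continuous_map T (discrete_topology (carrier (G Mod N))) (\<lambda>x\<in>carrier H. N #>\<^bsub>G\<^esub> \<phi> x)"
      by (rule continuous_map_eq[OF continuous_map_compose[OF _ coset_cont[OF \<open>N \<in> NN\<close>], of T \<phi>]])
        (use \<open>?P \<phi>\<close> in \<open>auto simp: topT\<close>)
    show "(\<lambda>x\<in>carrier H. N #>\<^bsub>G\<^esub> \<phi> x) s = N #>\<^bsub>G\<^esub> f s" if "s \<in> S" for s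
      using \<open>?P \<phi>\<close> that SH by auto
  qed simp
  have sep: "x = y" if "x \<in> carrier G" "y \<in> carrier G" "\<And>N. N \<in> NN \<Longrightarrow> N #>\<^bsub>G\<^esub> x = N #>\<^bsub>G\<^esub> y" for x y
  proof (rule ccontr)
    assume "x \<noteq> y"
    let ?d = "x \<otimes>\<^bsub>G\<^esub> inv\<^bsub>G\<^esub> y"
    have "\<one>\<^bsub>G\<^esub> \<noteq> ?d" using \<open>x \<noteq> y\<close> that(1,2) by (metis G.inv_equality G.inv_closed G.inv_inv)
    moreover have "openin U (topspace U - {?d})"
      using that(1,2) haus
      by (intro openin_diff openin_topspace closedin_Hausdorff_singleton) (auto simp: topU)
    ultimately obtain N where N: "N \<lhd> G" "openin U N" "N \<subseteq> topspace U - {?d}"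
      using profinite_openin_normal[OF G, of "topspace U - {?d}"] by (auto simp: topU)
    then have "N \<in> NN" by (simp add: NN_def)
    then have "x \<in> N #>\<^bsub>G\<^esub> y" using that G.rcos_self NN(3) by metis
    then have "?d \<in> N"
      using subgroup.rcos_module_imp[OF NN(3)[OF \<open>N \<in> NN\<close>] G.is_group that(2)] by blast
    then show False using N by blast
  qed
  define \<psi> where "\<psi> N = (THE \<psi>. R N \<psi>)" for N
  have \<psi>: "R N (\<psi> N)" if "N \<in> NN" for N
    unfolding \<psi>_def using ex1[OF that] by (rule theI')
  have \<psi>_cos: "\<exists>g\<in>carrier G. \<psi> N x = N #>\<^bsub>G\<^esub> g" if "N \<in> NN" "x \<in> carrier H" for N x
  proof -
    have "\<psi> N x \<in> carrier (G Mod N)" using \<psi>[OF that(1)] that(2) by (auto simp: R_def hom_def)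
    then show ?thesis by (auto simp: carrier_FactGroup)
  qed
  have mono: "\<psi> N x \<subseteq> \<psi> M x" if "N \<in> NN" "M \<in> NN" "N \<subseteq> M" "x \<in> carrier H" for N M x
  proof -
    interpret N: normal N G using NN that by blast
    interpret M: normal M G using NN that by blast
    define q where "q X = M #>\<^bsub>G\<^esub> (SOME g. g \<in> X)" for X
    have coset_mono: "N #>\<^bsub>G\<^esub> g \<subseteq> M #>\<^bsub>G\<^esub> g" for g using \<open>N \<subseteq> M\<close> by (auto simp: r_coset_def)
    have q: "q (N #>\<^bsub>G\<^esub> g) = M #>\<^bsub>G\<^esub> g" if "g \<in> carrier G" for g
    proof -
      have "(SOME h. h \<in> N #>\<^bsub>G\<^esub> g) \<in> N #>\<^bsub>G\<^esub> g"
        using G.rcos_self[OF that NN(3)[OF \<open>N \<in> NN\<close>]] by (rule someI)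
      then have "(SOME h. h \<in> N #>\<^bsub>G\<^esub> g) \<in> M #>\<^bsub>G\<^esub> g" using coset_mono by blast
      then show ?thesis
        unfolding q_def using G.repr_independence that NN(3)[OF \<open>M \<in> NN\<close>] by metis
    qed
    have "R M (\<lambda>x\<in>carrier H. q (\<psi> N x))"
      unfolding R_def
    proof (intro conjI IntI ballI)
      have "q (\<psi> N x) \<in> carrier (G Mod M)" if "x \<in> carrier H" for x
        using \<psi>_cos[OF \<open>N \<in> NN\<close> that] by (auto simp: q carrier_FactGroup)
      moreover have "q (\<psi> N (x \<otimes>\<^bsub>H\<^esub> y)) = q (\<psi> N x) <#>\<^bsub>G\<^esub> q (\<psi> N y)"
        if xy: "x \<in> carrier H" "y \<in> carrier H" for x y
      proof -
        obtain g h where gh: "g \<in> carrier G" "\<psi> N x = N #>\<^bsub>G\<^esub> g" "h \<in> carrier G" "\<psi> N y = N #>\<^bsub>G\<^esub> h"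
          using \<psi>_cos[OF \<open>N \<in> NN\<close>] xy by metis
        have "\<psi> N (x \<otimes>\<^bsub>H\<^esub> y) = N #>\<^bsub>G\<^esub> (g \<otimes>\<^bsub>G\<^esub> h)"
          using \<psi>[OF \<open>N \<in> NN\<close>] xy gh by (auto simp: R_def hom_def N.rcos_sum)
        then show ?thesis using gh by (simp add: q M.rcos_sum)
      qed
      ultimately show "(\<lambda>x\<in>carrier H. q (\<psi> N x)) \<in> hom H (G Mod M)"
        by (auto simp: hom_def)
      have "continuous_map (discrete_topology (carrier (G Mod N))) (discrete_topology (carrier (G Mod M))) q"
        by (auto simp: carrier_FactGroup q)
      with \<psi>[OF \<open>N \<in> NN\<close>]
      have "continuous_map T (discrete_topology (carrier (G Mod M))) (q \<circ> \<psi> N)"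
        unfolding R_def by (blast intro: continuous_map_compose)
      then show "continuous_map T (discrete_topology (carrier (G Mod M))) (\<lambda>x\<in>carrier H. q (\<psi> N x))"
        by (rule continuous_map_eq) (simp add: topT)
      show "(\<lambda>x\<in>carrier H. q (\<psi> N x)) s = M #>\<^bsub>G\<^esub> f s" if "s \<in> S" for s
      proof -
        have "f s \<in> carrier G" "s \<in> carrier H" using that f SH by auto
        then show ?thesis using \<psi>[OF \<open>N \<in> NN\<close>] that by (simp add: R_def q)
      qed
    qed simp
    then have eq: "\<psi> M = (\<lambda>x\<in>carrier H. q (\<psi> N x))"
      by (rule R_unique[OF \<open>M \<in> NN\<close> \<psi>[OF \<open>M \<in> NN\<close>]])
    obtain g where g: "g \<in> carrier G" "\<psi> N x = N #>\<^bsub>G\<^esub> g"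
      using \<psi>_cos[OF \<open>N \<in> NN\<close> \<open>x \<in> carrier H\<close>] by blast
    have "\<psi> M x = M #>\<^bsub>G\<^esub> g" using eq g \<open>x \<in> carrier H\<close> q by simp
    then show ?thesis using coset_mono g by simp
  qed
  have "\<exists>g\<in>carrier G. \<forall>N\<in>NN. \<psi> N x = N #>\<^bsub>G\<^esub> g" if x: "x \<in> carrier H" for x
  proof -
    obtain N0 where N0: "N0 \<in> NN"
      using profinite_openin_normal[OF G openin_topspace] by (auto simp: NN_def topU)
    have low: "\<exists>K\<in>NN. \<forall>N\<in>F. \<psi> K x \<subseteq> \<psi> N x" if "finite F" "F \<subseteq> NN" for F
      using that
    proof (induction F)
      case empty
      then show ?case using N0 by blast
    next
      case (insert M F)
      then obtain K where K: "K \<in> NN" "\<forall>N\<in>F. \<psi> K x \<subseteq> \<psi> N x" by auto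
      have "\<psi> (K \<inter> M) x \<subseteq> \<psi> K x" "\<psi> (K \<inter> M) x \<subseteq> \<psi> M x"
        using mono[OF NN_Int] K insert.prems x by auto
      then show ?case using K insert.prems NN_Int[of K M] by (intro bexI[of _ "K \<inter> M"]) auto
    qed
    have ne: "\<psi> N x \<noteq> {}" if "N \<in> NN" for N
      using \<psi>_cos[OF that x] G.rcos_self NN(3)[OF that] by blast
    have clo: "closedin U (\<psi> N x)" if "N \<in> NN" for N
    proof -
      obtain g where g: "g \<in> carrier G" "\<psi> N x = N #>\<^bsub>G\<^esub> g"
        using \<psi>_cos[OF \<open>N \<in> NN\<close> x] by blast
      have "closedin U {h \<in> topspace U. N #>\<^bsub>G\<^esub> h \<in> {N #>\<^bsub>G\<^esub> g}}"
        by (rule closedin_continuous_map_preimage[OF coset_cont[OF that]])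
          (use g in \<open>auto simp: carrier_FactGroup\<close>)
      also have "{h \<in> topspace U. N #>\<^bsub>G\<^esub> h \<in> {N #>\<^bsub>G\<^esub> g}} = N #>\<^bsub>G\<^esub> g"
      proof (intro equalityI subsetI)
        fix h assume h: "h \<in> N #>\<^bsub>G\<^esub> g"
        have "h \<in> carrier G" using h g G.r_coset_subset_G subgroup.subset NN(3)[OF that] by blast
        then show "h \<in> {h \<in> topspace U. N #>\<^bsub>G\<^esub> h \<in> {N #>\<^bsub>G\<^esub> g}}"
          using G.repr_independence[OF h g(1) NN(3)[OF that]] by (simp add: topU)
      next
        fix h assume "h \<in> {h \<in> topspace U. N #>\<^bsub>G\<^esub> h \<in> {N #>\<^bsub>G\<^esub> g}}"
        then show "h \<in> N #>\<^bsub>G\<^esub> g" using G.rcos_self[OF _ NN(3)[OF that], of h] by (simp add: topU)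
      qed
      finally show ?thesis using g by simp
    qed
    have "\<Inter>((\<lambda>N. \<psi> N x) ` NN) \<noteq> {}"
    proof -
      have "\<Inter>\<F> \<noteq> {}" if fin: "finite \<F>" "\<F> \<subseteq> (\<lambda>N. \<psi> N x) ` NN" for \<F>
      proof -
        obtain F where F: "F \<subseteq> NN" "finite F" "\<F> = (\<lambda>N. \<psi> N x) ` F"
          using finite_subset_image[OF fin] by blast
        obtain K where "K \<in> NN" "\<forall>N\<in>F. \<psi> K x \<subseteq> \<psi> N x" using low[OF F(2,1)] by blast
        then show ?thesis using ne[of K] F by blast
      qed
      moreover have "\<forall>C\<in>(\<lambda>N. \<psi> N x) ` NN. closedin U C" using clo by simp
      ultimately show ?thesis
        using comp[unfolded compact_space_fip, THEN spec, of "(\<lambda>N. \<psi> N x) ` NN"] by simp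
    qed
    then obtain g where g: "\<And>N. N \<in> NN \<Longrightarrow> g \<in> \<psi> N x" by blast
    have "g \<in> carrier G" using g[OF N0] closedin_subset[OF clo[OF N0]] by (auto simp: topU)
    moreover have "\<psi> N x = N #>\<^bsub>G\<^esub> g" if "N \<in> NN" for N
      using \<psi>_cos[OF that x] g[OF that] G.repr_independence NN(3)[OF that] by metis
    ultimately show ?thesis by blast
  qed
  then obtain \<phi> where \<phi>: "\<And>x. x \<in> carrier H \<Longrightarrow> \<phi> x \<in> carrier G"
      "\<And>x N. x \<in> carrier H \<Longrightarrow> N \<in> NN \<Longrightarrow> \<psi> N x = N #>\<^bsub>G\<^esub> \<phi> x"
    by metis
  have ex: "?P (restrict \<phi> (carrier H))"
  proof (intro conjI IntI ballI)
    have "\<phi> (x \<otimes>\<^bsub>H\<^esub> y) = \<phi> x \<otimes>\<^bsub>G\<^esub> \<phi> y" if xy: "x \<in> carrier H" "y \<in> carrier H" for x y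
    proof (rule sep)
      fix N assume N: "N \<in> NN"
      then interpret N: normal N G using NN by blast
      have "\<psi> N (x \<otimes>\<^bsub>H\<^esub> y) = \<psi> N x <#>\<^bsub>G\<^esub> \<psi> N y"
        using \<psi>[OF N] xy by (auto simp: R_def hom_def)
      then show "N #>\<^bsub>G\<^esub> \<phi> (x \<otimes>\<^bsub>H\<^esub> y) = N #>\<^bsub>G\<^esub> (\<phi> x \<otimes>\<^bsub>G\<^esub> \<phi> y)"
        using xy \<phi> N by (simp add: N.rcos_sum)
    qed (use xy \<phi> in auto)
    then show "restrict \<phi> (carrier H) \<in> hom H G" using \<phi>(1) by (auto simp: hom_def)
    show "restrict \<phi> (carrier H) s = f s" if "s \<in> S" for s
    proof -
      have s: "s \<in> carrier H" using SH that by blast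
      have "\<phi> s = f s"
      proof (rule sep)
        fix N assume N: "N \<in> NN"
        show "N #>\<^bsub>G\<^esub> \<phi> s = N #>\<^bsub>G\<^esub> f s"
          using \<psi>[OF N] \<phi>(2)[OF s N] that by (simp add: R_def)
      qed (use s \<phi> f that in auto)
      then show ?thesis using s by simp
    qed
    have "openin T {x \<in> topspace T. \<phi> x \<in> W}" if W: "openin U W" for W
    proof (subst openin_subopen, intro ballI)
      fix x assume x: "x \<in> {x \<in> topspace T. \<phi> x \<in> W}"
      then have xH: "x \<in> carrier H" by (simp add: topT)
      have "continuous_map U U (\<lambda>g. g \<otimes>\<^bsub>G\<^esub> \<phi> x)"
        using G continuous_map_compose[OF continuous_map_pairedI, of U U "\<lambda>g. g" U "\<lambda>g. \<phi> x" U
            "\<lambda>(x, y). x \<otimes>\<^bsub>G\<^esub> y"] \<phi>(1)[OF xH]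
        by (simp add: o_def topU profinite_group_def topological_group_def)
      then have "openin U {g \<in> topspace U. g \<otimes>\<^bsub>G\<^esub> \<phi> x \<in> W}"
        using W by (rule openin_continuous_map_preimage)
      then obtain N where N: "N \<lhd> G" "openin U N" "N \<subseteq> {g \<in> topspace U. g \<otimes>\<^bsub>G\<^esub> \<phi> x \<in> W}"
        using profinite_openin_normal[OF G] x xH \<phi>(1) by (force simp: topU)
      then have NN': "N \<in> NN" by (simp add: NN_def)
      have NW: "N #>\<^bsub>G\<^esub> \<phi> x \<subseteq> W" using N(3) by (auto simp: r_coset_def)
      show "\<exists>V. openin T V \<and> x \<in> V \<and> V \<subseteq> {x \<in> topspace T. \<phi> x \<in> W}"
      proof (intro exI conjI)
        show "openin T {y \<in> topspace T. \<psi> N y \<in> {\<psi> N x}}"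
          by (rule openin_continuous_map_preimage[of T "discrete_topology (carrier (G Mod N))"])
            (use \<psi>[OF NN'] \<psi>_cos[OF NN' xH] in \<open>auto simp: R_def carrier_FactGroup\<close>)
        show "x \<in> {y \<in> topspace T. \<psi> N y \<in> {\<psi> N x}}" using x by simp
        have "\<phi> y \<in> W" if "y \<in> carrier H" "\<psi> N y = \<psi> N x" for y
        proof -
          have "\<phi> y \<in> N #>\<^bsub>G\<^esub> \<phi> y" using G.rcos_self[OF \<phi>(1)[OF that(1)] NN(3)[OF NN']] .
          also have "N #>\<^bsub>G\<^esub> \<phi> y = N #>\<^bsub>G\<^esub> \<phi> x" using \<phi>(2) that xH NN' by metis
          finally show ?thesis using NW by blast
        qed
        then show "{y \<in> topspace T. \<psi> N y \<in> {\<psi> N x}} \<subseteq> {x \<in> topspace T. \<phi> x \<in> W}"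
          by (auto simp: topT)
      qed
    qed
    then have "continuous_map T U \<phi>" using \<phi>(1) by (auto simp: continuous_map topT topU)
    then show "continuous_map T U (restrict \<phi> (carrier H))"
      by (rule continuous_map_eq) (simp add: topT)
  qed simp
  have uniq: "\<phi> = \<phi>'" if "?P \<phi>" "?P \<phi>'" for \<phi> \<phi>'
  proof (rule extensionalityI)
    fix x assume x: "x \<in> carrier H"
    show "\<phi> x = \<phi>' x"
    proof (rule sep)
      fix N assume "N \<in> NN"
      then have "(\<lambda>x\<in>carrier H. N #>\<^bsub>G\<^esub> \<phi> x) = (\<lambda>x\<in>carrier H. N #>\<^bsub>G\<^esub> \<phi>' x)"
        using R_unique proj that by meson
      then show "N #>\<^bsub>G\<^esub> \<phi> x = N #>\<^bsub>G\<^esub> \<phi>' x" using x by (metis restrict_apply')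
    qed (use that x in \<open>auto simp: hom_def\<close>)
  qed (use that in auto)
  show ?thesis
    by (rule ex1I[where P = ?P, OF ex]) (rule uniq[OF _ ex])
qed

lemma topological_group_profinite_completion:
  assumes "group G"
  shows "topological_group (profinite_completion G) (completion_topology G)"
proof -
  interpret G: group G by fact
  define I where "I = finite_index_normal G"
  define P where "P = product_group I (\<lambda>N. G Mod N)"
  define C where "C = carrier (profinite_completion G)"
  have nor: "N \<lhd> G" if "N \<in> I" for N using that by (simp add: I_def finite_index_normal_def)
  have grp: "group (G Mod N)" if "N \<in> I" for N using nor[OF that] by (rule normal.factorgroup_is_group)
  interpret P: group P unfolding P_def using grp by (rule product_group)
  have comp: "profinite_completion G = P\<lparr>carrier := C\<rparr>"
    by (simp add: profinite_completion_def P_def C_def I_def)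
  have C_iff: "x \<in> C \<longleftrightarrow> x \<in> carrier P \<and> (\<forall>N\<in>I. \<forall>M\<in>I. N \<subseteq> M \<longrightarrow> x N \<subseteq> x M)" for x
    by (auto simp: C_def P_def I_def profinite_completion_def FactGroup_def)
  have inv: "inv\<^bsub>P\<^esub> x = (\<lambda>N\<in>I. set_inv\<^bsub>G\<^esub> (x N))" if "x \<in> C" for x
  proof -
    have x: "x \<in> (\<Pi>\<^sub>E N\<in>I. carrier (G Mod N))" using that by (simp add: C_iff P_def)
    then have "inv\<^bsub>P\<^esub> x = (\<lambda>N\<in>I. inv\<^bsub>G Mod N\<^esub> (x N))"
      unfolding P_def using grp by (intro inv_product_group) auto
    also have "\<dots> = (\<lambda>N\<in>I. set_inv\<^bsub>G\<^esub> (x N))"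
      using x nor by (intro restrict_ext normal.inv_FactGroup) auto
    finally show ?thesis .
  qed
  have sub: "subgroup C P"
  proof (rule P.subgroupI)
    show "C \<subseteq> carrier P" by (auto simp: C_iff)
    have "\<one>\<^bsub>P\<^esub> \<in> C" using P.one_closed unfolding C_iff by (simp add: P_def)
    then show "C \<noteq> {}" by blast
    show "inv\<^bsub>P\<^esub> x \<in> C" if "x \<in> C" for x
      using that P.inv_closed[of x] inv[OF that] unfolding C_iff
      by (fastforce simp: SET_INV_def)
    show "x \<otimes>\<^bsub>P\<^esub> y \<in> C" if "x \<in> C" "y \<in> C" for x y
      using that P.m_closed[of x y] unfolding C_iff by (auto simp: P_def set_mult_def) blast
  qed
  let ?T = "completion_topology G"
  have top: "topspace ?T = C"
    using sub[THEN subgroup.subset]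
    by (auto simp: completion_topology_def C_def[symmetric] P_def I_def[symmetric] FactGroup_def)
  have proj: "continuous_map ?T (discrete_topology (rcosets\<^bsub>G\<^esub> N)) (\<lambda>x. x N)" if "N \<in> I" for N
    using that unfolding completion_topology_def I_def
    by (intro continuous_map_from_subtopology continuous_map_product_projection)
  have into: "continuous_map X ?T h"
    if "\<And>N. N \<in> I \<Longrightarrow> continuous_map X (discrete_topology (rcosets\<^bsub>G\<^esub> N)) (\<lambda>x. h x N)"
      "h ` topspace X \<subseteq> C" for X :: "'x topology" and h
    unfolding completion_topology_def C_def[symmetric] I_def[symmetric]
  proof (rule continuous_map_into_subtopology)
    have "h ` topspace X \<subseteq> extensional I" using that(2) by (auto simp: C_iff P_def PiE_iff)
    with that(1) show "continuous_map X (product_topology (\<lambda>N. discrete_topology (rcosets\<^bsub>G\<^esub> N)) I) h"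
      by (auto simp: continuous_map_componentwise)
  qed (use that(2) in auto)
  have "continuous_map (prod_topology ?T ?T) ?T (\<lambda>(x, y). x \<otimes>\<^bsub>P\<^esub> y)"
  proof (rule into)
    fix N assume N: "N \<in> I"
    let ?D = "discrete_topology (rcosets\<^bsub>G\<^esub> N)"
    have "continuous_map (prod_topology ?T ?T) (prod_topology ?D ?D) (\<lambda>p. (fst p N, snd p N))"
      using continuous_map_compose[OF continuous_map_fst proj[OF N], of ?T]
        continuous_map_compose[OF continuous_map_snd proj[OF N], of ?T]
      by (intro continuous_map_pairedI) (simp_all add: o_def)
    moreover have "continuous_map (prod_topology ?D ?D) ?D (\<lambda>(X, Y). X <#>\<^bsub>G\<^esub> Y)"
      using group.is_monoid[OF grp[OF N]] monoid.m_closed[of "G Mod N"]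
      by (auto simp flip: prod_topology_discrete_topology simp: FactGroup_def)
    ultimately have "continuous_map (prod_topology ?T ?T) ?D
        ((\<lambda>(X, Y). X <#>\<^bsub>G\<^esub> Y) \<circ> (\<lambda>p. (fst p N, snd p N)))"
      by (rule continuous_map_compose)
    then show "continuous_map (prod_topology ?T ?T) ?D (\<lambda>p. (case p of (x, y) \<Rightarrow> x \<otimes>\<^bsub>P\<^esub> y) N)"
      by (rule continuous_map_eq) (use N in \<open>auto simp: P_def\<close>)
  qed (use sub in \<open>auto simp: top intro: subgroup.m_closed\<close>)
  moreover have "continuous_map ?T ?T (\<lambda>x. inv\<^bsub>P\<^esub> x)"
  proof (rule into)
    fix N assume N: "N \<in> I"
    let ?D = "discrete_topology (rcosets\<^bsub>G\<^esub> N)"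
    have "continuous_map ?D ?D (\<lambda>X. set_inv\<^bsub>G\<^esub> X)"
      using group.inv_closed[OF grp[OF N]] normal.inv_FactGroup[OF nor[OF N]]
      by (auto simp: FactGroup_def)
    from continuous_map_compose[OF proj[OF N] this]
    show "continuous_map ?T ?D (\<lambda>x. (inv\<^bsub>P\<^esub> x) N)"
      by (rule continuous_map_eq) (use N in \<open>auto simp: top inv\<close>)
  qed (use sub in \<open>auto simp: top intro: subgroup.m_inv_closed\<close>)
  then have "continuous_map ?T ?T (\<lambda>x. inv\<^bsub>P\<lparr>carrier := C\<rparr>\<^esub> x)"
    by (rule continuous_map_eq) (simp add: top P.m_inv_consistent[OF sub])
  ultimately show ?thesis
    using subgroup.subgroup_is_group[OF sub P.is_group] top
    by (simp add: topological_group_def comp)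
qed

lemma infinite_free_group:
  assumes "free_group_of_rank F k" "1 \<le> k"
  shows "infinite (carrier F)"
proof -
  obtain B where B: "free_basis F B" "card B = k"
    using assms(1) by (auto simp: free_group_of_rank_def)
  with assms(2) obtain b where b: "b \<in> B" by fastforce
  let ?W = "{w \<in> lists (B \<times> UNIV). reduced_word w}"
  have "reduced_word (replicate n (b, True))" for n
    by (induction n) (auto simp: reduced_word_def successively_Cons)
  then have "range (\<lambda>n. replicate n (b, True)) \<subseteq> ?W" using b by auto
  moreover have "infinite (range (\<lambda>n. replicate n (b, True)))"
    by (rule range_inj_infinite) (auto intro: injI dest: arg_cong[of _ _ length])
  ultimately have "infinite ?W" using finite_subset by blast
  moreover have "bij_betw (word_value F) ?W (carrier F)" using B(1) by (simp add: free_basis_def)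
  ultimately show ?thesis using bij_betw_finite by blast
qed

corollary profinite_basis_completion_universal:
  fixes F :: "('a, 'm) monoid_scheme" and G :: "('g, 'n) monoid_scheme"
  assumes F: "free_group_of_rank F k" "1 \<le> k"
    and S: "profinite_basis (profinite_completion F) (completion_topology F) S"
    and G: "profinite_group G U" and f: "f \<in> S \<rightarrow> carrier G"
  shows "\<exists>!\<phi>. \<phi> \<in> hom (profinite_completion F) G \<inter> extensional (carrier (profinite_completion F)) \<and>
           continuous_map (completion_topology F) U \<phi> \<and> (\<forall>s\<in>S. \<phi> s = f s)"
proof (rule profinite_basis_universal[OF _ _ S G f])
  have "infinite (UNIV :: 'a set)"
    using infinite_free_group[OF F] by (rule contrapos_nn) (rule finite_subset[OF subset_UNIV])
  then have "infinite (UNIV :: 'a set set)" by (simp add: Finite_Set.finite_set)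
  then show "infinite (UNIV :: ('a set \<Rightarrow> 'a set) set)"
    using finite_fun_UNIVD2 by blast
  show "topological_group (profinite_completion F) (completion_topology F)"
    using F(1) by (intro topological_group_profinite_completion) (simp add: free_group_of_rank_def)
qed

end

theory Submission
  imports Defs "HOL-Library.Z2" "HOL-Library.Function_Algebras" "HOL-Combinatorics.Permutations"
begin

text \<open>
  A basis of \<open>F\<close> is mapped to a basis of the completion, because every homomorphism from \<open>F\<close> to a
  profinite group extends to the completion (\<open>completion_extend_hom\<close>), and in only one way since \<open>F\<close>
  is dense. Hence primitive elements of \<open>F\<close> are primitive in the completion.

  Conversely, let \<open>x\<close> be an element of \<open>F\<close> that is primitive in the completion. Colour the vertices
  of the Cayley tree of \<open>F\<close> with two colours such that only finitely many edges are bicoloured, and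
  consider the lines \<open>\<dots>, g \<otimes> inv x, g, g \<otimes> x, g \<otimes> x \<otimes> x, \<dots>\<close>. The proof goes through the property
  \<open>separating_cut\<close> of \<open>x\<close>: there is such a colouring for which the line through \<open>\<one>\<close> changes its colour
  exactly once, from \<open>\<one>\<close> to \<open>x\<close>, while every other line is of one colour.

  \<^item> Such a colouring exists. In terms of the group algebra of \<open>F\<close> over the field with two elements,
    it amounts to a derivation from \<open>F\<close> to the group algebra that sends \<open>x\<close> to \<open>1\<close>, or to the fact
    that the one-sided ideal of the Fox derivatives of \<open>x\<close> contains \<open>1\<close>. Suppose that it does not. Then
    (\<open>separating_cut_or_functional\<close>) some linear functional \<open>l\<close> with \<open>l \<one> = 1\<close> vanishes on the
    ideal. The restrictions to a finite set of all functionals that vanish on the ideal form a finite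
    vector space \<open>Y\<close>, on which the generators of \<open>F\<close> can be made to act by permutations that extend
    the partially defined translations (\<open>finite_model\<close>). For every homomorphism that lifts this
    action to the semidirect product of the functions on \<open>Y\<close> with the permutations of \<open>Y\<close>, the
    image of \<open>x\<close> satisfies a fixed non-trivial linear relation (\<open>weighted_sum_hom_wreath\<close>). But the
    image of an element of a profinite basis in this finite group can be prescribed
    (\<open>profinite_primitive_no_functional\<close>).

  \<^item> If \<open>x\<close> has such a colouring, then it is primitive (\<open>primitive_if_separating_cut\<close>). This is
    Whitehead's algorithm. Let \<open>w\<close> be a cyclically reduced word for a conjugate of \<open>x\<close>. At a deepest
    vertex of the tree beyond which the colour is not eventually constant, the colours of the
    branches divide the Whitehead graph of \<open>w\<close>: either that vertex is the root, and just one edge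
    of the graph joins the two parts, or the direction to the root is a cut vertex
    (\<open>bicoloured_turn\<close>, \<open>coloured_directions\<close>). In both cases some Whitehead automorphism makes \<open>w\<close>
    shorter, unless some generator occurs exactly once in \<open>w\<close>, which makes \<open>x\<close> primitive
    (\<open>primitive_or_reducible\<close>). As the property is invariant under automorphisms, induction applies.
\<close>

section \<open>Words and free groups\<close>

text \<open>The inverse of a letter, and the formal inverse of a word.\<close>

fun inv_letter :: "'a \<times> bool \<Rightarrow> 'a \<times> bool" where
  "inv_letter (x, s) = (x, \<not> s)"

definition inv_word :: "('a \<times> bool) list \<Rightarrow> ('a \<times> bool) list" where
  "inv_word w = rev (map inv_letter w)"

text \<open>The value in \<open>G\<close> of a word after the substitution \<open>f\<close> of its letters.\<close>

definition word_eval :: "('b, 'n) monoid_scheme \<Rightarrow> ('a \<Rightarrow> 'b) \<Rightarrow> ('a \<times> bool) list \<Rightarrow> 'b" where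
  "word_eval G f w = word_value G (map (\<lambda>(x, s). (f x, s)) w)"

text \<open>Free reduction, by insertion of the letters one by one from the right.\<close>

fun push_letter :: "'a \<times> bool \<Rightarrow> ('a \<times> bool) list \<Rightarrow> ('a \<times> bool) list" where
  "push_letter l [] = [l]"
| "push_letter l (m # w) = (if m = inv_letter l then w else l # m # w)"

definition reduce :: "('a \<times> bool) list \<Rightarrow> ('a \<times> bool) list" where
  "reduce w = foldr push_letter w []"

lemma inv_letter_inv_letter [simp]: "inv_letter (inv_letter l) = l"
  by (cases l) simp

lemma fst_inv_letter [simp]: "fst (inv_letter l) = fst l"
  by (cases l) simp

lemma inv_letter_neq [simp]: "inv_letter l \<noteq> l" "l \<noteq> inv_letter l"
  by (cases l; simp)+

lemma inv_letter_eq_iff [simp]: "inv_letter l = inv_letter m \<longleftrightarrow> l = m"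
  by (metis inv_letter_inv_letter)

lemma fst_eq_iff_letter: "fst l = fst m \<longleftrightarrow> l = m \<or> l = inv_letter m"
  by (cases l; cases m) auto

lemma inv_word_Nil [simp]: "inv_word [] = []"
  by (simp add: inv_word_def)

lemma inv_word_append: "inv_word (u @ v) = inv_word v @ inv_word u"
  by (simp add: inv_word_def)

lemma inv_word_eq_Nil_iff [simp]: "inv_word w = [] \<longleftrightarrow> w = []"
  by (simp add: inv_word_def)

lemma length_inv_word [simp]: "length (inv_word w) = length w"
  by (simp add: inv_word_def)

lemma fst_set_inv_word [simp]: "fst ` set (inv_word w) = fst ` set w"
  by (simp add: inv_word_def image_image)

lemma last_inv_word: "w \<noteq> [] \<Longrightarrow> last (inv_word w) = inv_letter (hd w)"
  by (simp add: inv_word_def last_rev hd_map)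

lemma hd_inv_word: "w \<noteq> [] \<Longrightarrow> hd (inv_word w) = inv_letter (last w)"
  by (simp add: inv_word_def hd_rev last_map)

lemma words_iff: "w \<in> lists (B \<times> UNIV) \<longleftrightarrow> fst ` set w \<subseteq> B"
  by (auto simp: lists_eq_set image_subset_iff)

lemma reduced_word_successively: "reduced_word w \<longleftrightarrow> successively (\<lambda>l m. m \<noteq> inv_letter l) w"
proof -
  have "(\<lambda>(x, b) (y, c). \<not> (x = y \<and> b \<noteq> c)) = (\<lambda>l m. m \<noteq> inv_letter (l :: 'a \<times> bool))"
    by (auto simp: fun_eq_iff)
  then show ?thesis by (simp only: reduced_word_def)
qed

lemma reduced_word_Nil [simp]: "reduced_word []"
  by (simp add: reduced_word_def)

lemma reduced_word_Cons:
  "reduced_word (l # w) \<longleftrightarrow> reduced_word w \<and> (w \<noteq> [] \<longrightarrow> hd w \<noteq> inv_letter l)"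
  by (auto simp: reduced_word_successively successively_Cons)

lemma reduced_word_single [simp]: "reduced_word [l]"
  by (simp add: reduced_word_Cons)

lemma reduced_word_append:
  "reduced_word (u @ v) \<longleftrightarrow> reduced_word u \<and> reduced_word v \<and>
     (u \<noteq> [] \<longrightarrow> v \<noteq> [] \<longrightarrow> hd v \<noteq> inv_letter (last u))"
  by (auto simp: reduced_word_successively successively_append_iff)

lemma reduced_word_inv_word [simp]: "reduced_word (inv_word w) \<longleftrightarrow> reduced_word w"
proof (induction w)
  case (Cons l w)
  have "inv_word (l # w) = inv_word w @ [inv_letter l]" by (simp add: inv_word_def)
  then show ?case using Cons
    by (auto simp: reduced_word_append reduced_word_Cons last_inv_word)
qed simp

lemma reduced_push_letter: "reduced_word w \<Longrightarrow> reduced_word (push_letter l w)"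
  by (cases w) (auto simp: reduced_word_Cons)

lemma reduced_reduce: "reduced_word (reduce w)"
  by (induction w) (auto simp: reduce_def reduced_push_letter)

lemma reduce_reduced: "reduced_word w \<Longrightarrow> reduce w = w"
proof (induction w)
  case (Cons l w)
  then have "reduce w = w" "w \<noteq> [] \<longrightarrow> hd w \<noteq> inv_letter l" by (auto simp: reduced_word_Cons)
  then show ?case by (cases w) (auto simp: reduce_def)
qed (simp add: reduce_def)

lemma length_push_letter: "length (push_letter l w) \<le> Suc (length w)"
  by (cases w) auto

lemma length_reduce_less: "\<not> reduced_word w \<Longrightarrow> length (reduce w) < length w"
proof (induction w)
  case (Cons l w)
  have step: "reduce (l # w) = push_letter l (reduce w)" by (simp add: reduce_def)
  show ?case
  proof (cases "reduced_word w")
    case True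
    then have "reduce w = w" by (rule reduce_reduced)
    with step Cons.prems True show ?thesis by (cases w) (auto simp: reduced_word_Cons)
  next
    case False
    then show ?thesis using Cons.IH step length_push_letter[of l "reduce w"] by simp
  qed
qed simp

lemma fst_set_push_letter: "fst ` set (push_letter l w) \<subseteq> insert (fst l) (fst ` set w)"
  by (cases w) auto

lemma fst_set_reduce: "fst ` set (reduce w) \<subseteq> fst ` set w"
proof (induction w)
  case (Cons l w)
  have "fst ` set (reduce (l # w)) \<subseteq> insert (fst l) (fst ` set (reduce w))"
    using fst_set_push_letter[of l "reduce w"] by (simp add: reduce_def)
  also have "\<dots> \<subseteq> fst ` set (l # w)" using Cons by auto
  finally show ?case .
qed (simp add: reduce_def)

context group
begin

lemma word_eval_Nil [simp]: "word_eval G f [] = \<one>"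
  by (simp add: word_eval_def)

lemma word_eval_Cons:
  "word_eval G f (l # w) = (if snd l then f (fst l) else inv (f (fst l))) \<otimes> word_eval G f w"
  by (cases l) (simp add: word_eval_def)

lemma word_eval_closed [simp, intro]:
  "(\<And>x. x \<in> fst ` set w \<Longrightarrow> f x \<in> carrier G) \<Longrightarrow> word_eval G f w \<in> carrier G"
  by (induction w) (auto simp: word_eval_Cons)

lemma word_eval_append:
  "(\<And>x. x \<in> fst ` set u \<union> fst ` set v \<Longrightarrow> f x \<in> carrier G) \<Longrightarrow>
    word_eval G f (u @ v) = word_eval G f u \<otimes> word_eval G f v"
  by (induction u) (auto simp: word_eval_Cons m_assoc)

lemma word_eval_inv_word:
  "(\<And>x. x \<in> fst ` set w \<Longrightarrow> f x \<in> carrier G) \<Longrightarrow> word_eval G f (inv_word w) = inv (word_eval G f w)"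
proof (induction w)
  case (Cons l w)
  have "inv_word (l # w) = inv_word w @ [inv_letter l]" by (simp add: inv_word_def)
  moreover have "word_eval G f (inv_word w @ [inv_letter l]) =
      word_eval G f (inv_word w) \<otimes> word_eval G f [inv_letter l]"
    using Cons.prems by (intro word_eval_append) auto
  ultimately show ?case using Cons
    by (cases l) (auto simp: word_eval_Cons inv_mult_group)
qed simp

lemma word_eval_push_letter:
  assumes "\<And>x. x \<in> insert (fst l) (fst ` set w) \<Longrightarrow> f x \<in> carrier G"
  shows "word_eval G f (push_letter l w) = word_eval G f (l # w)"
proof (cases w)
  case (Cons m v)
  have c: "f (fst l) \<in> carrier G" "word_eval G f v \<in> carrier G" using assms Cons by auto
  then show ?thesis using Cons
    by (cases l) (auto simp: word_eval_Cons m_assoc[symmetric])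
qed simp

lemma word_eval_reduce:
  "(\<And>x. x \<in> fst ` set w \<Longrightarrow> f x \<in> carrier G) \<Longrightarrow> word_eval G f (reduce w) = word_eval G f w"
proof (induction w)
  case (Cons l w)
  have "word_eval G f (reduce (l # w)) = word_eval G f (l # reduce w)"
    using Cons.prems fst_set_reduce[of w]
    by (subst word_eval_push_letter[symmetric]) (auto simp: reduce_def)
  then show ?case using Cons by (simp add: word_eval_Cons)
qed (simp add: reduce_def)

end

lemma word_value_eq_word_eval: "word_value G w = word_eval G (\<lambda>x. x) w"
  by (simp add: word_eval_def case_prod_eta)

lemma word_eval_cong: "(\<And>x. x \<in> fst ` set w \<Longrightarrow> f x = g x) \<Longrightarrow> word_eval G f w = word_eval G g w"
  unfolding word_eval_def by (intro arg_cong[of _ _ "word_value G"]) force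

lemma word_eval_hom:
  assumes G: "group G" and H: "group H" and h: "h \<in> hom G H"
    and f: "\<And>x. x \<in> fst ` set w \<Longrightarrow> f x \<in> carrier G"
  shows "h (word_eval G f w) = word_eval H (\<lambda>x. h (f x)) w"
proof -
  interpret group_hom G H h using assms by (simp add: group_hom_def group_hom_axioms_def)
  show ?thesis using f
    by (induction w) (auto simp: G.word_eval_Cons H.word_eval_Cons)
qed

text \<open>A group \<open>F\<close> together with a free basis \<open>B\<close>, which need not be finite.\<close>

locale free_group = group F for F (structure) +
  fixes B
  assumes basis: "free_basis F B"
begin

lemma B_carrier: "b \<in> B \<Longrightarrow> b \<in> carrier F"
  using basis by (auto simp: free_basis_def)

lemma word_value_closed [simp, intro]: "fst ` set w \<subseteq> B \<Longrightarrow> word_value F w \<in> carrier F"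
  using B_carrier by (auto simp: word_value_eq_word_eval)

lemma word_value_append:
  "fst ` set u \<subseteq> B \<Longrightarrow> fst ` set v \<subseteq> B \<Longrightarrow> word_value F (u @ v) = word_value F u \<otimes> word_value F v"
  using B_carrier by (auto simp: word_value_eq_word_eval intro!: word_eval_append)

lemma word_value_inv_word:
  "fst ` set w \<subseteq> B \<Longrightarrow> word_value F (inv_word w) = inv (word_value F w)"
  using B_carrier by (auto simp: word_value_eq_word_eval intro!: word_eval_inv_word)

lemma word_value_reduce: "fst ` set w \<subseteq> B \<Longrightarrow> word_value F (reduce w) = word_value F w"
  using B_carrier by (auto simp: word_value_eq_word_eval intro!: word_eval_reduce)

lemma bij_word_value:
  "bij_betw (word_value F) {w. fst ` set w \<subseteq> B \<and> reduced_word w} (carrier F)"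
  using basis by (simp add: free_basis_def words_iff)

text \<open>The reduced word of an element.\<close>

definition red :: "'a \<Rightarrow> ('a \<times> bool) list" where
  "red = inv_into {w. fst ` set w \<subseteq> B \<and> reduced_word w} (word_value F)"

lemma
  assumes "g \<in> carrier F"
  shows red_letters: "fst ` set (red g) \<subseteq> B" and reduced_red: "reduced_word (red g)"
    and word_value_red [simp]: "word_value F (red g) = g"
proof -
  have "g \<in> word_value F ` {w. fst ` set w \<subseteq> B \<and> reduced_word w}"
    using bij_word_value assms by (simp add: bij_betw_def)
  then show "fst ` set (red g) \<subseteq> B" "reduced_word (red g)" "word_value F (red g) = g"
    using inv_into_into[of g "word_value F" "{w. fst ` set w \<subseteq> B \<and> reduced_word w}"]
      f_inv_into_f[of g "word_value F" "{w. fst ` set w \<subseteq> B \<and> reduced_word w}"]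
    by (auto simp: red_def)
qed

lemma red_unique:
  assumes "fst ` set w \<subseteq> B" "reduced_word w"
  shows "red (word_value F w) = w"
  using bij_word_value assms by (auto simp: red_def bij_betw_def intro!: inv_into_f_f)

lemma red_word_value: "fst ` set w \<subseteq> B \<Longrightarrow> red (word_value F w) = reduce w"
  using red_unique[of "reduce w"] fst_set_reduce[of w] reduced_reduce[of w] word_value_reduce[of w]
  by auto

lemma word_value_inject:
  assumes "fst ` set u \<subseteq> B" "reduced_word u" "fst ` set v \<subseteq> B" "reduced_word v"
    "word_value F u = word_value F v"
  shows "u = v"
  using assms red_unique by metis

text \<open>The homomorphism that extends a map on the basis.\<close>

definition extend_hom :: "('g, 'n) monoid_scheme \<Rightarrow> ('a \<Rightarrow> 'g) \<Rightarrow> 'a \<Rightarrow> 'g" where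
  "extend_hom G f g = word_eval G f (red g)"

lemma extend_hom_word:
  assumes "group G" "f \<in> B \<rightarrow> carrier G" "fst ` set w \<subseteq> B"
  shows "extend_hom G f (word_value F w) = word_eval G f w"
  using assms unfolding extend_hom_def
  by (subst red_word_value) (auto intro!: group.word_eval_reduce)

lemma extend_hom_basis:
  assumes "group G" "f \<in> B \<rightarrow> carrier G" "b \<in> B"
  shows "extend_hom G f b = f b"
  using extend_hom_word[of G f "[(b, True)]"] assms B_carrier
  by (auto simp: group.word_eval_Cons group.word_eval_Nil group.is_monoid Pi_iff)

lemma extend_hom:
  assumes "group G" "f \<in> B \<rightarrow> carrier G"
  shows "extend_hom G f \<in> hom F G"
proof (rule homI)
  show "extend_hom G f g \<in> carrier G" if "g \<in> carrier F" for g
    using assms red_letters[OF that] by (auto simp: extend_hom_def intro!: group.word_eval_closed)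
  fix g h assume gh: "g \<in> carrier F" "h \<in> carrier F"
  have "extend_hom G f (word_value F (red g @ red h)) = word_eval G f (red g @ red h)"
    using red_letters gh by (intro extend_hom_word assms) auto
  also have "\<dots> = extend_hom G f g \<otimes>\<^bsub>G\<^esub> extend_hom G f h"
    using assms red_letters[of g] red_letters[of h] gh unfolding extend_hom_def
    by (intro group.word_eval_append) auto
  finally show "extend_hom G f (g \<otimes> h) = extend_hom G f g \<otimes>\<^bsub>G\<^esub> extend_hom G f h"
    using gh red_letters by (simp add: word_value_append)
qed

lemma hom_eq_on_basis:
  assumes "group G" "h \<in> hom F G" "h' \<in> hom F G" "\<And>b. b \<in> B \<Longrightarrow> h b = h' b" "g \<in> carrier F"
  shows "h g = h' g"
proof -
  have *: "k g = word_eval G k (red g)" if "k \<in> hom F G" for k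
    using word_eval_hom[OF is_group assms(1) that, of "red g" "\<lambda>x. x"] red_letters[OF assms(5)] B_carrier
      word_value_red[OF assms(5)] by (auto simp: word_value_eq_word_eval)
  show ?thesis
    using *[OF assms(2)] *[OF assms(3)] word_eval_cong[of "red g" h h' G]
      red_letters[OF assms(5)] assms(4) by auto
qed

lemma free_basis_iso:
  assumes "\<phi> \<in> iso F F"
  shows "free_basis F (\<phi> ` B)"
proof -
  have hom: "\<phi> \<in> hom F F" and bij: "bij_betw \<phi> (carrier F) (carrier F)"
    using assms by (auto simp: iso_def)
  have inj: "inj_on \<phi> B"
    using bij B_carrier by (auto simp: bij_betw_def inj_on_def)
  let ?m = "map (\<lambda>(x, s). (\<phi> x, s))"
  let ?R = "\<lambda>B. {w. fst ` set w \<subseteq> B \<and> reduced_word w}"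
  have red: "reduced_word (?m w) \<longleftrightarrow> reduced_word w" if "fst ` set w \<subseteq> B" for w
    using that
  proof (induction w)
    case (Cons l w)
    then have "(\<lambda>(x, s). (\<phi> x, s)) m = inv_letter ((\<lambda>(x, s). (\<phi> x, s)) l) \<longleftrightarrow> m = inv_letter l"
      if "m \<in> set w" for m
      using that inj by (cases l; cases m) (force simp: inj_on_def)
    then show ?case using Cons by (auto simp: reduced_word_Cons hd_map)
  qed simp
  have bij_m: "bij_betw ?m (?R B) (?R (\<phi> ` B))"
  proof (rule bij_betw_byWitness[where f' = "map (\<lambda>(x, s). (inv_into B \<phi> x, s))"])
    show "\<forall>w\<in>?R B. map (\<lambda>(x, s). (inv_into B \<phi> x, s)) (?m w) = w"
      using inj by (auto intro!: map_idI)
    show "\<forall>w\<in>?R (\<phi> ` B). ?m (map (\<lambda>(x, s). (inv_into B \<phi> x, s)) w) = w"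
      by (auto intro!: map_idI) (metis f_inv_into_f fst_conv image_subset_iff)
    show "?m ` ?R B \<subseteq> ?R (\<phi> ` B)"
      using red by (auto simp: image_image case_prod_unfold image_subset_iff)
    show "map (\<lambda>(x, s). (inv_into B \<phi> x, s)) ` ?R (\<phi> ` B) \<subseteq> ?R B"
    proof (rule image_subsetI)
      fix w assume "w \<in> ?R (\<phi> ` B)"
      then have w: "fst ` set w \<subseteq> \<phi> ` B" "reduced_word w" by auto
      let ?w = "map (\<lambda>(x, s). (inv_into B \<phi> x, s)) w"
      have in_B: "fst ` set ?w \<subseteq> B" using w(1) by (force intro: inv_into_into)
      have "?m ?w = w" using w(1) by (auto intro!: map_idI) (metis f_inv_into_f fst_conv image_subset_iff)
      then show "?w \<in> ?R B" using red[OF in_B] in_B w(2) by simp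
    qed
  qed
  have "bij_betw (\<phi> \<circ> word_value F) (?R B) (carrier F)"
    using bij_word_value bij by (rule bij_betw_trans)
  moreover have "(\<phi> \<circ> word_value F) w = (word_value F \<circ> ?m) w" if "w \<in> ?R B" for w
  proof -
    have "\<phi> (word_value F w) = word_eval F \<phi> w"
      unfolding word_value_eq_word_eval
      using that B_carrier by (intro word_eval_hom[OF is_group is_group hom]) auto
    then show ?thesis by (simp add: word_eval_def)
  qed
  ultimately have "bij_betw (word_value F \<circ> ?m) (?R B) (carrier F)"
    by (subst bij_betw_cong[symmetric]) auto
  then have "bij_betw (word_value F) (?R (\<phi> ` B)) (carrier F)"
    using bij_m bij_betw_comp_iff by blast
  moreover have "\<phi> ` B \<subseteq> carrier F" using hom B_carrier by (auto simp: hom_def)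
  ultimately show ?thesis by (simp add: free_basis_def words_iff)
qed

end

section \<open>Dense image and universal property of the profinite completion\<close>

lemma mem_profinite_completion:
  "z \<in> carrier (profinite_completion G) \<longleftrightarrow>
    z \<in> (\<Pi>\<^sub>E N\<in>finite_index_normal G. rcosets\<^bsub>G\<^esub> N) \<and>
    (\<forall>N\<in>finite_index_normal G. \<forall>M\<in>finite_index_normal G. N \<subseteq> M \<longrightarrow> z N \<subseteq> z M)"
  by (simp add: profinite_completion_def)

lemma mult_profinite_completion:
  "N \<in> finite_index_normal G \<Longrightarrow> (z \<otimes>\<^bsub>profinite_completion G\<^esub> z') N = z N <#>\<^bsub>G\<^esub> z' N"
  by (simp add: profinite_completion_def)

lemma topspace_completion:
  "group G \<Longrightarrow> topspace (completion_topology G) = carrier (profinite_completion G)"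
  using topological_group_profinite_completion by (auto simp: topological_group_def)

lemma group_profinite_completion: "group G \<Longrightarrow> group (profinite_completion G)"
  using topological_group_profinite_completion by (auto simp: topological_group_def)

context group
begin

lemma completion_map_hom: "completion_map G \<in> hom G (profinite_completion G)"
proof (rule homI)
  show "completion_map G x \<in> carrier (profinite_completion G)" if "x \<in> carrier G" for x
    using that
    by (auto simp: mem_profinite_completion completion_map_def finite_index_normal_def r_coset_def RCOSETS_def)
  show "completion_map G (x \<otimes> y) = completion_map G x \<otimes>\<^bsub>profinite_completion G\<^esub> completion_map G y"
    if "x \<in> carrier G" "y \<in> carrier G" for x y
    using that
    by (auto simp: completion_map_def profinite_completion_def finite_index_normal_def normal.rcos_sum
        intro!: restrict_ext)
qed

lemma finite_index_normal_preimage: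
  assumes H: "group H" and \<phi>: "\<phi> \<in> hom G H" and N: "N \<lhd> H" "finite (rcosets\<^bsub>H\<^esub> N)"
  shows "{g \<in> carrier G. \<phi> g \<in> N} \<in> finite_index_normal G"
proof -
  interpret H: group H by fact
  interpret N: normal N H by fact
  interpret group_hom G H \<phi> using \<phi> by unfold_locales
  define K where "K = {g \<in> carrier G. \<phi> g \<in> N}"
  have sub: "subgroup K G"
    by (rule subgroupI) (auto simp: K_def intro!: exI[of _ \<one>])
  have K: "K \<lhd> G"
    unfolding normal_inv_iff using sub N.inv_op_closed2 by (auto simp: K_def)
  have "K #> g = {h \<in> carrier G. \<phi> h \<in> N #>\<^bsub>H\<^esub> \<phi> g}" if g: "g \<in> carrier G" for g
  proof -
    have "h \<in> K #> g \<longleftrightarrow> h \<otimes> inv g \<in> K" if "h \<in> carrier G" for h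
      using subgroup.rcos_module[OF sub is_group g that] .
    moreover have "\<phi> h \<in> N #>\<^bsub>H\<^esub> \<phi> g \<longleftrightarrow> \<phi> h \<otimes>\<^bsub>H\<^esub> inv\<^bsub>H\<^esub> \<phi> g \<in> N" if "h \<in> carrier G" for h
      using subgroup.rcos_module[OF N.subgroup_axioms H.is_group] g that by auto
    moreover have "K #> g \<subseteq> carrier G" using r_coset_subset_G[OF subgroup.subset[OF sub] g] .
    ultimately show ?thesis using g by (auto simp: K_def)
  qed
  moreover have "N #>\<^bsub>H\<^esub> \<phi> g \<in> rcosets\<^bsub>H\<^esub> N" if "g \<in> carrier G" for g
    using that N.subset by (intro H.rcosetsI) auto
  ultimately have "rcosets K \<subseteq> (\<lambda>C. {h \<in> carrier G. \<phi> h \<in> C}) ` (rcosets\<^bsub>H\<^esub> N)"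
    unfolding RCOSETS_def[of G] by blast
  then have "finite (rcosets K)" using N(2) by (meson finite_imageI finite_subset)
  with K show ?thesis by (simp add: finite_index_normal_def K_def)
qed

lemma finite_index_normal_Int:
  assumes "N \<in> finite_index_normal G" "M \<in> finite_index_normal G"
  shows "N \<inter> M \<in> finite_index_normal G"
proof -
  have N: "N \<lhd> G" "finite (rcosets N)" and M: "M \<lhd> G" "finite (rcosets M)"
    using assms by (auto simp: finite_index_normal_def)
  interpret N: normal N G by fact
  interpret M: normal M G by fact
  have sub: "subgroup (N \<inter> M) G"
    by (rule subgroups_Inter_pair) (fact N.subgroup_axioms M.subgroup_axioms)+
  have NM: "N \<inter> M \<lhd> G"
    using N(1) M(1) sub by (auto simp: normal_inv_iff)
  have "(N \<inter> M) #> g = (N #> g) \<inter> (M #> g)" if g: "g \<in> carrier G" for g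
  proof -
    have "h \<in> (N \<inter> M) #> g \<longleftrightarrow> h \<in> (N #> g) \<inter> (M #> g)" if "h \<in> carrier G" for h
      using subgroup.rcos_module[OF sub is_group g that] N.rcos_module[OF is_group g that]
        M.rcos_module[OF is_group g that] by simp
    moreover have "N #> g \<subseteq> carrier G" "(N \<inter> M) #> g \<subseteq> carrier G"
      using r_coset_subset_G[OF N.subset g] r_coset_subset_G[OF subgroup.subset[OF sub] g] by auto
    ultimately show ?thesis by blast
  qed
  then have "rcosets (N \<inter> M) \<subseteq> (\<lambda>(A, B). A \<inter> B) ` ((rcosets N) \<times> (rcosets M))"
    by (auto simp: RCOSETS_def)
  then have "finite (rcosets (N \<inter> M))" using N(2) M(2) by (meson finite_SigmaI finite_imageI finite_subset)
  with NM show ?thesis by (simp add: finite_index_normal_def)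
qed

lemma carrier_finite_index_normal: "carrier G \<in> finite_index_normal G"
proof -
  have "rcosets (carrier G) \<subseteq> {carrier G}"
    using coset_join2[OF _ subgroup_self] by (auto simp: RCOSETS_def)
  then show ?thesis
    using normal_invI[OF subgroup_self] by (auto simp: finite_index_normal_def intro: finite_subset)
qed

lemma completion_coset:
  assumes z: "z \<in> carrier (profinite_completion G)" and N: "N \<in> finite_index_normal G" "g \<in> z N"
  shows "g \<in> carrier G" "z N = N #> g"
proof -
  have sub: "subgroup N G" using N by (simp add: finite_index_normal_def normal_imp_subgroup)
  obtain h where h: "h \<in> carrier G" "z N = N #> h"
    using z N(1) by (auto simp: mem_profinite_completion RCOSETS_def PiE_iff)
  show "g \<in> carrier G" using h N(2) r_coset_subset_G[OF subgroup.subset[OF sub]] by blast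
  show "z N = N #> g" using repr_independence[OF _ h(1) sub, of g] h N(2) by simp
qed

lemma completion_coset_nonempty:
  assumes z: "z \<in> carrier (profinite_completion G)" and N: "N \<in> finite_index_normal G"
  shows "\<exists>g. g \<in> z N"
proof -
  obtain h where "h \<in> carrier G" "z N = N #> h"
    using z N by (auto simp: mem_profinite_completion RCOSETS_def PiE_iff)
  then show ?thesis
    using rcos_self[of h N] N by (auto simp: finite_index_normal_def normal_imp_subgroup)
qed

text \<open>An element of the completion agrees with an element of \<open>G\<close> on any finitely many quotients,
  because these factor through a common one.\<close>

lemma completion_approx:
  assumes z: "z \<in> carrier (profinite_completion G)" and K: "finite K" "K \<subseteq> finite_index_normal G"
  obtains g where "g \<in> carrier G" "\<And>N. N \<in> K \<Longrightarrow> z N = N #> g"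
proof -
  have "\<exists>M\<in>finite_index_normal G. \<forall>N\<in>K. M \<subseteq> N"
    using K
  proof (induction K)
    case empty
    then show ?case using carrier_finite_index_normal by blast
  next
    case (insert N K)
    then obtain M where "M \<in> finite_index_normal G" "\<forall>N\<in>K. M \<subseteq> N" by auto
    then show ?case using insert.prems finite_index_normal_Int[of M N]
      by (intro bexI[of _ "M \<inter> N"]) auto
  qed
  then obtain M where M: "M \<in> finite_index_normal G" "\<forall>N\<in>K. M \<subseteq> N" by blast
  obtain g where g: "g \<in> z M" using completion_coset_nonempty[OF z M(1)] by blast
  then have gG: "g \<in> carrier G" using completion_coset[OF z M(1)] by simp
  from g have "g \<in> z N" if "N \<in> K" for N
    using z M K(2) that unfolding mem_profinite_completion by blast
  then show thesis using completion_coset[OF z] K(2) that gG by blast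
qed

lemma completion_map_dense:
  assumes V: "openin (completion_topology G) V" and z: "z \<in> V"
  obtains g where "g \<in> carrier G" "completion_map G g \<in> V"
proof -
  let ?I = "finite_index_normal G"
  let ?X = "\<lambda>N. discrete_topology (rcosets N)"
  have zc: "z \<in> carrier (profinite_completion G)"
    using openin_subset[OF V] z topspace_completion[OF is_group] by auto
  obtain V' where V': "openin (product_topology ?X ?I) V'" "V = V' \<inter> carrier (profinite_completion G)"
    using V by (auto simp: completion_topology_def openin_subtopology)
  then obtain U where U: "finite {N \<in> ?I. U N \<noteq> topspace (?X N)}" "z \<in> Pi\<^sub>E ?I U" "Pi\<^sub>E ?I U \<subseteq> V'"
    using z unfolding openin_product_topology_alt by auto
  obtain g where g: "g \<in> carrier G" "\<And>N. N \<in> {N \<in> ?I. U N \<noteq> topspace (?X N)} \<Longrightarrow> z N = N #> g"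
    using completion_approx[OF zc U(1)] by blast
  have "completion_map G g \<in> Pi\<^sub>E ?I U"
  proof (rule PiE_I)
    fix N assume N: "N \<in> ?I"
    show "completion_map G g N \<in> U N"
    proof (cases "U N = topspace (?X N)")
      case True
      then show ?thesis using N g(1) by (auto simp: completion_map_def RCOSETS_def)
    next
      case False
      then have "completion_map G g N = z N" using N g(2) by (simp add: completion_map_def)
      then show ?thesis using U(2) N by (auto simp: PiE_iff)
    qed
  qed (simp add: completion_map_def)
  then have "completion_map G g \<in> V"
    using U(3) V'(2) completion_map_hom g(1) by (auto simp: hom_def)
  then show thesis using that g(1) by blast
qed

lemma completion_map_eqI:
  assumes U: "Hausdorff_space U" and h: "continuous_map (completion_topology G) U h"
    "continuous_map (completion_topology G) U h'"
    and eq: "\<And>g. g \<in> carrier G \<Longrightarrow> h (completion_map G g) = h' (completion_map G g)"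
    and z: "z \<in> carrier (profinite_completion G)"
  shows "h z = h' z"
proof (rule ccontr)
  assume neq: "h z \<noteq> h' z"
  let ?T = "completion_topology G"
  have zT: "z \<in> topspace ?T" using z topspace_completion[OF is_group] by simp
  then have "h z \<in> topspace U" "h' z \<in> topspace U"
    using h by (auto simp: continuous_map_def)
  then obtain A B where AB: "openin U A" "openin U B" "h z \<in> A" "h' z \<in> B" "disjnt A B"
    using U neq unfolding Hausdorff_space_def by meson
  have "openin ?T ({y \<in> topspace ?T. h y \<in> A} \<inter> {y \<in> topspace ?T. h' y \<in> B})"
    using openin_continuous_map_preimage h AB by blast
  then obtain g where "g \<in> carrier G" "h (completion_map G g) \<in> A" "h' (completion_map G g) \<in> B"
    by (rule completion_map_dense[where z = z]) (use zT AB in auto)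
  then show False using eq AB(5) by (auto simp: disjnt_iff)
qed

end

lemma profinite_closedin_rcos:
  fixes G (structure)
  assumes G: "profinite_group G U" and N: "N \<lhd> G" "openin U N" and x: "x \<in> carrier G"
  shows "closedin U (N #> x)"
proof -
  interpret normal N G by fact
  have top: "topspace U = carrier G" using G by (auto simp: profinite_group_def topological_group_def)
  have "topspace U - (N #> x) = \<Union>(rcosets N - {N #> x})"
  proof -
    have disj: "\<Union>R - X = \<Union>(R - {X})" if "pairwise disjnt R" "X \<in> R" for R and X :: "'a set"
    proof -
      have "C \<inter> X = {}" if "C \<in> R - {X}" for C
        using that \<open>pairwise disjnt R\<close> \<open>X \<in> R\<close> by (simp add: pairwise_def disjnt_def)
      then show ?thesis by blast
    qed
    show ?thesis
      unfolding top rcosets_part_G[OF subgroup_axioms, symmetric]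
      by (rule disj[OF rcos_disjoint[OF subgroup_axioms] rcosetsI[OF subset x]])
  qed
  moreover have "openin U (\<Union>(rcosets N - {N #> x}))"
    using profinite_openin_rcos[OF G N] by (intro openin_Union) (auto simp: RCOSETS_def)
  ultimately show ?thesis
    using r_coset_subset_G[OF subset x] by (simp add: closedin_def top)
qed

lemma profinite_eq_if_rcos_eq:
  fixes G (structure)
  assumes G: "profinite_group G U" and xy: "x \<in> carrier G" "y \<in> carrier G"
    and eq: "\<And>N. N \<lhd> G \<Longrightarrow> openin U N \<Longrightarrow> x \<in> N #> y"
  shows "x = y"
proof (rule ccontr)
  assume "x \<noteq> y"
  interpret group G using G by (simp add: profinite_group_def topological_group_def)
  have top: "topspace U = carrier G" and haus: "Hausdorff_space U"
    using G by (auto simp: profinite_group_def topological_group_def)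
  let ?d = "x \<otimes> inv y"
  have "\<one> \<noteq> ?d" using \<open>x \<noteq> y\<close> xy by (metis inv_equality inv_closed inv_inv)
  moreover have "openin U (topspace U - {?d})"
    using xy haus by (intro openin_diff openin_topspace closedin_Hausdorff_singleton) (auto simp: top)
  ultimately obtain N where N: "N \<lhd> G" "openin U N" "N \<subseteq> topspace U - {?d}"
    using profinite_openin_normal[OF G, of "topspace U - {?d}"] by (auto simp: top)
  then have "?d \<in> N"
    using subgroup.rcos_module_imp[OF normal_imp_subgroup[OF N(1)] is_group xy(2)] eq by blast
  then show False using N by blast
qed

text \<open>A homomorphism to a profinite group sends the cosets \<open>z K\<close> that make up an element \<open>z\<close> of
  the completion into a family of closed cosets with the finite intersection property; the image
  of \<open>z\<close> is their only common element.\<close>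

lemma completion_extend_hom:
  fixes F :: "('a, 'm) monoid_scheme" and G :: "('g, 'n) monoid_scheme"
  assumes F: "group F" and G: "profinite_group G U" and \<phi>: "\<phi> \<in> hom F G"
  obtains \<psi> where "\<psi> \<in> hom (profinite_completion F) G"
    "continuous_map (completion_topology F) U \<psi>"
    "\<And>g. g \<in> carrier F \<Longrightarrow> \<psi> (completion_map F g) = \<phi> g"
proof -
  interpret F: group F by fact
  interpret G: group G using G by (simp add: profinite_group_def topological_group_def)
  interpret group_hom F G \<phi> using \<phi> by unfold_locales
  let ?H = "profinite_completion F" and ?T = "completion_topology F"
  interpret H: group ?H using F by (rule group_profinite_completion)
  have topU: "topspace U = carrier G" and comp: "compact_space U" and haus: "Hausdorff_space U"
    using G by (auto simp: profinite_group_def topological_group_def)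
  define NN where "NN = {N. N \<lhd> G \<and> openin U N}"
  have NN: "N \<lhd> G" "openin U N" "subgroup N G" if "N \<in> NN" for N
    using that by (auto simp: NN_def normal_imp_subgroup)
  define K where "K N = {g \<in> carrier F. \<phi> g \<in> N}" for N
  have K: "K N \<in> finite_index_normal F" if "N \<in> NN" for N
    unfolding K_def
    using F.finite_index_normal_preimage[OF G.is_group \<phi>] profinite_finite_rcosets[OF G] NN[OF that]
    by blast
  have Ksub: "subgroup (K N) F" if "N \<in> NN" for N
    using K[OF that] by (simp add: finite_index_normal_def normal_imp_subgroup)
  have \<phi>_coset: "\<phi> g \<in> N #>\<^bsub>G\<^esub> \<phi> h" if "N \<in> NN" "g \<in> K N #>\<^bsub>F\<^esub> h" "h \<in> carrier F" for N g h
    using that(2,3) by (auto simp: K_def r_coset_def)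
  have coset_trans: "x \<in> N #>\<^bsub>G\<^esub> b" if "N \<in> NN" "x \<in> N #>\<^bsub>G\<^esub> a" "a \<in> N #>\<^bsub>G\<^esub> b" "b \<in> carrier G" for N x a b
    using G.repr_independence[OF that(3,4) NN(3)[OF that(1)]] that(2) by simp
  \<comment> \<open>\<open>Q z p\<close> says that \<open>p\<close> is the image of \<open>z\<close>: in every quotient of \<open>G\<close> by an open normal
    subgroup \<open>N\<close> it has the image of the elements of the coset \<open>z (K N)\<close>.\<close>
  define Q where "Q z p \<longleftrightarrow> p \<in> carrier G \<and> (\<forall>N\<in>NN. \<forall>g\<in>z (K N). p \<in> N #>\<^bsub>G\<^esub> \<phi> g)" for z p
  have ex: "\<exists>p. Q z p" if z: "z \<in> carrier ?H" for z
  proof -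
    have "\<exists>g. g \<in> z (K N)" if "N \<in> NN" for N
      using F.completion_coset_nonempty[OF z K[OF that]] .
    then obtain g where g: "\<And>N. N \<in> NN \<Longrightarrow> g N \<in> z (K N)" by metis
    have gF: "g N \<in> carrier F" "z (K N) = K N #>\<^bsub>F\<^esub> g N" if "N \<in> NN" for N
      using F.completion_coset[OF z K[OF that] g[OF that]] by auto
    let ?C = "\<lambda>N. N #>\<^bsub>G\<^esub> \<phi> (g N)"
    have "\<Inter>(?C ` NN) \<noteq> {}"
    proof -
      have "\<Inter>\<F> \<noteq> {}" if fin: "finite \<F>" "\<F> \<subseteq> ?C ` NN" for \<F>
      proof -
        obtain D where D: "D \<subseteq> NN" "finite D" "\<F> = ?C ` D"
          using finite_subset_image[OF fin] by blast
        obtain h where h: "h \<in> carrier F" "\<And>M. M \<in> K ` D \<Longrightarrow> z M = M #>\<^bsub>F\<^esub> h"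
          using F.completion_approx[OF z, of "K ` D"] D K by blast
        have "\<phi> h \<in> ?C N" if "N \<in> D" for N
        proof (rule \<phi>_coset)
          have "h \<in> K N #>\<^bsub>F\<^esub> h" using F.rcos_self[OF h(1) Ksub] that D(1) by blast
          then show "h \<in> K N #>\<^bsub>F\<^esub> g N" using h(2)[of "K N"] gF(2)[of N] that D(1) by auto
        qed (use that D(1) gF in auto)
        then show ?thesis using D(3) by blast
      qed
      moreover have "\<forall>C\<in>?C ` NN. closedin U C" using profinite_closedin_rcos[OF G] NN gF by auto
      ultimately show ?thesis
        using comp[unfolded compact_space_fip, THEN spec, of "?C ` NN"] by simp
    qed
    then obtain p where p: "\<And>N. N \<in> NN \<Longrightarrow> p \<in> ?C N" by blast
    obtain N0 where N0: "N0 \<in> NN"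
      using profinite_openin_normal[OF G openin_topspace] by (auto simp: NN_def topU)
    have "p \<in> carrier G"
      using p[OF N0] G.r_coset_subset_G[OF subgroup.subset[OF NN(3)[OF N0]], of "\<phi> (g N0)"] gF[OF N0] by auto
    moreover have "p \<in> N #>\<^bsub>G\<^esub> \<phi> h" if N: "N \<in> NN" and h: "h \<in> z (K N)" for N h
    proof (rule coset_trans[OF N p[OF N]])
      have h': "h \<in> carrier F" "z (K N) = K N #>\<^bsub>F\<^esub> h" using F.completion_coset[OF z K[OF N] h] by auto
      then show "\<phi> (g N) \<in> N #>\<^bsub>G\<^esub> \<phi> h" "\<phi> h \<in> carrier G"
        using \<phi>_coset[OF N _ h'(1)] g[OF N] by auto
    qed
    ultimately show ?thesis by (auto simp: Q_def)
  qed
  have uniq: "p = q" if z: "z \<in> carrier ?H" and "Q z p" and q: "q \<in> carrier G"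
    "\<And>N. N \<in> NN \<Longrightarrow> \<exists>g\<in>z (K N). q \<in> N #>\<^bsub>G\<^esub> \<phi> g" for z p q
  proof (rule profinite_eq_if_rcos_eq[OF G])
    show "p \<in> carrier G" using that by (simp add: Q_def)
    fix N assume "N \<lhd> G" "openin U N"
    then have N: "N \<in> NN" by (simp add: NN_def)
    then obtain g where g: "g \<in> z (K N)" "q \<in> N #>\<^bsub>G\<^esub> \<phi> g" using q by blast
    then have "p \<in> N #>\<^bsub>G\<^esub> \<phi> g" using \<open>Q z p\<close> N by (simp add: Q_def)
    moreover have "\<phi> g \<in> carrier G" using F.completion_coset[OF z K[OF N] g(1)] by simp
    ultimately show "p \<in> N #>\<^bsub>G\<^esub> q"
      using G.repr_independence[OF g(2) _ NN(3)[OF N]] by simp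
  qed fact
  obtain \<psi> where \<psi>: "\<And>z. z \<in> carrier ?H \<Longrightarrow> Q z (\<psi> z)" using ex by metis
  have \<psi>_closed: "\<psi> z \<in> carrier G" if "z \<in> carrier ?H" for z using \<psi>[OF that] by (simp add: Q_def)
  have ne: "\<exists>g. g \<in> z (K N) \<and> g \<in> carrier F" if "z \<in> carrier ?H" "N \<in> NN" for z N
    using F.completion_coset_nonempty F.completion_coset(1) K that by metis
  show thesis
  proof (rule that)
    show "\<psi> \<in> hom ?H G"
    proof (rule homI)
      fix z z' assume z: "z \<in> carrier ?H" "z' \<in> carrier ?H"
      show "\<psi> (z \<otimes>\<^bsub>?H\<^esub> z') = \<psi> z \<otimes>\<^bsub>G\<^esub> \<psi> z'"
      proof (rule uniq[OF _ \<psi>])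
        fix N assume N: "N \<in> NN"
        interpret N: normal N G using NN(1)[OF N] .
        obtain g g' where g: "g \<in> z (K N)" "g \<in> carrier F" "g' \<in> z' (K N)" "g' \<in> carrier F"
          using ne[OF _ N] z by blast
        show "\<exists>g\<in>(z \<otimes>\<^bsub>?H\<^esub> z') (K N). \<psi> z \<otimes>\<^bsub>G\<^esub> \<psi> z' \<in> N #>\<^bsub>G\<^esub> \<phi> g"
        proof
          show "g \<otimes>\<^bsub>F\<^esub> g' \<in> (z \<otimes>\<^bsub>?H\<^esub> z') (K N)"
            using g mult_profinite_completion[OF K[OF N]] by (auto simp: set_mult_def)
          have "\<psi> z \<in> N #>\<^bsub>G\<^esub> \<phi> g" "\<psi> z' \<in> N #>\<^bsub>G\<^esub> \<phi> g'"
            using \<psi> z g N by (auto simp: Q_def)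
          then have "\<psi> z \<otimes>\<^bsub>G\<^esub> \<psi> z' \<in> (N #>\<^bsub>G\<^esub> \<phi> g) <#>\<^bsub>G\<^esub> (N #>\<^bsub>G\<^esub> \<phi> g')"
            by (auto simp: set_mult_def)
          then show "\<psi> z \<otimes>\<^bsub>G\<^esub> \<psi> z' \<in> N #>\<^bsub>G\<^esub> \<phi> (g \<otimes>\<^bsub>F\<^esub> g')"
            using g by (simp add: N.rcos_sum)
        qed
      qed (use z \<psi>_closed in auto)
    qed (use \<psi>_closed in auto)
    show "\<psi> (completion_map F g) = \<phi> g" if g: "g \<in> carrier F" for g
    proof (rule uniq[OF _ \<psi>])
      show cg: "completion_map F g \<in> carrier ?H" "completion_map F g \<in> carrier ?H"
        using F.completion_map_hom g by (auto simp: hom_def)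
      fix N assume N: "N \<in> NN"
      have "g \<in> completion_map F g (K N)"
        using F.rcos_self[OF g Ksub[OF N]] K[OF N] by (simp add: completion_map_def)
      moreover have "\<phi> g \<in> N #>\<^bsub>G\<^esub> \<phi> g"
        using G.rcos_self[OF _ NN(3)[OF N]] g by simp
      ultimately show "\<exists>h\<in>completion_map F g (K N). \<phi> g \<in> N #>\<^bsub>G\<^esub> \<phi> h" ..
    qed (use g in auto)
    show "continuous_map ?T U \<psi>"
      unfolding continuous_map
    proof (intro conjI allI impI)
      show "\<psi> ` topspace ?T \<subseteq> topspace U"
        using \<psi>_closed topspace_completion[OF F] by (auto simp: topU)
      fix W assume W: "openin U W"
      show "openin ?T {z \<in> topspace ?T. \<psi> z \<in> W}"
      proof (subst openin_subopen, intro ballI)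
        fix z assume z: "z \<in> {z \<in> topspace ?T. \<psi> z \<in> W}"
        then have zH: "z \<in> carrier ?H" using topspace_completion[OF F] by simp
        have "continuous_map U U (\<lambda>g. g \<otimes>\<^bsub>G\<^esub> \<psi> z)"
          using G continuous_map_compose[OF continuous_map_pairedI, of U U "\<lambda>g. g" U "\<lambda>g. \<psi> z" U
              "\<lambda>(x, y). x \<otimes>\<^bsub>G\<^esub> y"] \<psi>_closed[OF zH]
          by (simp add: o_def topU profinite_group_def topological_group_def)
        then have "openin U {g \<in> topspace U. g \<otimes>\<^bsub>G\<^esub> \<psi> z \<in> W}"
          using W by (rule openin_continuous_map_preimage)
        then obtain N where N: "N \<lhd> G" "openin U N" "N \<subseteq> {g \<in> topspace U. g \<otimes>\<^bsub>G\<^esub> \<psi> z \<in> W}"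
          using profinite_openin_normal[OF G] z zH \<psi>_closed by (force simp: topU)
        then have NN': "N \<in> NN" by (simp add: NN_def)
        have NW: "N #>\<^bsub>G\<^esub> \<psi> z \<subseteq> W" using N(3) by (auto simp: r_coset_def)
        let ?V = "{y \<in> topspace ?T. y (K N) \<in> {z (K N)}}"
        show "\<exists>V. openin ?T V \<and> z \<in> V \<and> V \<subseteq> {z \<in> topspace ?T. \<psi> z \<in> W}"
        proof (intro exI conjI)
          have "continuous_map ?T (discrete_topology (rcosets\<^bsub>F\<^esub> (K N))) (\<lambda>y. y (K N))"
            unfolding completion_topology_def using K[OF NN']
            by (intro continuous_map_from_subtopology continuous_map_product_projection)
          then show "openin ?T ?V"
            by (rule openin_continuous_map_preimage)
              (use zH K[OF NN'] in \<open>auto simp: mem_profinite_completion\<close>)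
          show "z \<in> ?V" using z by simp
          have "\<psi> y \<in> W" if y: "y \<in> carrier ?H" "y (K N) = z (K N)" for y
          proof -
            obtain g where g: "g \<in> z (K N)" "g \<in> carrier F" using ne[OF zH NN'] by blast
            then have "\<psi> z \<in> N #>\<^bsub>G\<^esub> \<phi> g" "\<psi> y \<in> N #>\<^bsub>G\<^esub> \<phi> g"
              using \<psi>[OF zH] \<psi>[OF y(1)] y(2) NN' by (auto simp: Q_def)
            then have "\<psi> y \<in> N #>\<^bsub>G\<^esub> \<psi> z"
              using G.repr_independence[of "\<psi> z" N "\<phi> g"] NN(3)[OF NN'] g(2) by simp
            then show ?thesis using NW by blast
          qed
          then show "?V \<subseteq> {z \<in> topspace ?T. \<psi> z \<in> W}" using topspace_completion[OF F] by auto
        qed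
      qed
    qed
  qed
qed

lemma (in free_group) profinite_basis_completion_map:
  "profinite_basis (profinite_completion F) (completion_topology F) (completion_map F ` B)"
  unfolding profinite_basis_def
proof (intro conjI allI impI)
  let ?H = "profinite_completion F" and ?T = "completion_topology F" and ?c = "completion_map F"
  interpret H: group ?H using is_group by (rule group_profinite_completion)
  have c: "?c \<in> hom F ?H" by (rule completion_map_hom)
  show "?c ` B \<subseteq> carrier ?H" using c B_carrier by (auto simp: hom_def)
  fix G :: "('a set \<Rightarrow> 'a set) monoid" and U f
  assume Gf: "profinite_group G U \<and> f \<in> ?c ` B \<rightarrow> carrier G"
  then interpret G: group G by (simp add: profinite_group_def topological_group_def)
  have f: "(\<lambda>b. f (?c b)) \<in> B \<rightarrow> carrier G" using Gf by auto
  let ?\<phi> = "extend_hom G (\<lambda>b. f (?c b))"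
  obtain \<psi> where \<psi>: "\<psi> \<in> hom ?H G" "continuous_map ?T U \<psi>" "\<And>g. g \<in> carrier F \<Longrightarrow> \<psi> (?c g) = ?\<phi> g"
    using completion_extend_hom[OF is_group _ extend_hom[OF G.is_group f]] Gf by blast
  show "\<exists>!\<phi>. \<phi> \<in> hom ?H G \<inter> extensional (carrier ?H) \<and> continuous_map ?T U \<phi> \<and> (\<forall>s\<in>?c ` B. \<phi> s = f s)"
  proof (rule ex1I[of _ "restrict \<psi> (carrier ?H)"], intro conjI IntI ballI)
    show "restrict \<psi> (carrier ?H) \<in> hom ?H G" using \<psi>(1) by (auto simp: hom_def)
    show "continuous_map ?T U (restrict \<psi> (carrier ?H))"
      by (rule continuous_map_eq[OF \<psi>(2)]) (simp add: topspace_completion[OF is_group])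
    show "restrict \<psi> (carrier ?H) s = f s" if "s \<in> ?c ` B" for s
      using that c B_carrier extend_hom_basis[OF G.is_group f] \<psi>(3) by (auto simp: hom_def Pi_iff)
  next
    fix \<phi>
    assume \<phi>: "\<phi> \<in> hom ?H G \<inter> extensional (carrier ?H) \<and> continuous_map ?T U \<phi> \<and> (\<forall>s\<in>?c ` B. \<phi> s = f s)"
    have homs: "\<phi> \<circ> ?c \<in> hom F G" "\<psi> \<circ> ?c \<in> hom F G"
      using Group.hom_compose[OF c, of \<phi> G] Group.hom_compose[OF c \<psi>(1)] \<phi> by auto
    have "(\<phi> \<circ> ?c) b = (\<psi> \<circ> ?c) b" if "b \<in> B" for b
      using \<phi> \<psi>(3)[OF B_carrier[OF that]] extend_hom_basis[OF G.is_group f that] that by simp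
    then have "(\<phi> \<circ> ?c) g = (\<psi> \<circ> ?c) g" if "g \<in> carrier F" for g
      using hom_eq_on_basis[OF G.is_group homs _ that] by blast
    then have eq: "\<phi> (?c g) = \<psi> (?c g)" if "g \<in> carrier F" for g
      using that by simp
    have "Hausdorff_space U" using Gf by (simp add: profinite_group_def)
    then have "\<phi> z = \<psi> z" if "z \<in> carrier ?H" for z
      using completion_map_eqI[OF _ _ \<psi>(2) eq that] \<phi> by blast
    then show "\<phi> = restrict \<psi> (carrier ?H)"
      using \<phi> by (intro extensionalityI[of _ "carrier ?H"]) auto
  qed simp
qed

section \<open>Functions on a set extended by its permutations\<close>

text \<open>The semidirect product of the functions \<open>Y \<Rightarrow> bit\<close> and the permutations of \<open>Y\<close>; the
  permutations are composed from left to right.\<close>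

definition wreath :: "'y set \<Rightarrow> (('y \<Rightarrow> bit) \<times> ('y \<Rightarrow> 'y)) monoid" where
  "wreath Y = \<lparr>carrier = {f. \<forall>y. y \<notin> Y \<longrightarrow> f y = 0} \<times> {s. s permutes Y},
     monoid.mult = (\<lambda>p q. (\<lambda>y. fst p y + fst q (snd p y), snd q \<circ> snd p)), one = (\<lambda>_. 0, id)\<rparr>"

lemma carrier_wreath: "p \<in> carrier (wreath Y) \<longleftrightarrow> (\<forall>y. y \<notin> Y \<longrightarrow> fst p y = 0) \<and> snd p permutes Y"
  by (cases p) (simp add: wreath_def)

lemma mult_wreath: "p \<otimes>\<^bsub>wreath Y\<^esub> q = (\<lambda>y. fst p y + fst q (snd p y), snd q \<circ> snd p)"
  by (simp add: wreath_def)

lemma one_wreath: "\<one>\<^bsub>wreath Y\<^esub> = (\<lambda>_. 0, id)"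
  by (simp add: wreath_def)

lemma finite_UNIV_bit: "finite (UNIV :: bit set)"
proof -
  have "(UNIV :: bit set) = {0, 1}" using bit.exhaust by auto
  then show "finite (UNIV :: bit set)" by (metis finite.emptyI finite_insert)
qed

lemma bit_add_self [simp]: "a + a = (0 :: bit)"
  by (cases a) simp_all

lemma bit_add_eq_0_iff: "a + b = (0 :: bit) \<longleftrightarrow> a = b"
  by (cases a; cases b) simp_all

lemma group_wreath: "group (wreath Y)"
proof (rule groupI)
  show "x \<otimes>\<^bsub>wreath Y\<^esub> y \<in> carrier (wreath Y)"
    if "x \<in> carrier (wreath Y)" "y \<in> carrier (wreath Y)" for x y
    using that by (auto simp: carrier_wreath mult_wreath permutes_not_in intro: permutes_compose)
  show "\<one>\<^bsub>wreath Y\<^esub> \<in> carrier (wreath Y)" by (simp add: carrier_wreath one_wreath permutes_id)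
  show "x \<otimes>\<^bsub>wreath Y\<^esub> y \<otimes>\<^bsub>wreath Y\<^esub> z = x \<otimes>\<^bsub>wreath Y\<^esub> (y \<otimes>\<^bsub>wreath Y\<^esub> z)" for x y z
    by (simp only: mult_wreath fst_conv snd_conv add.assoc o_assoc o_apply)
  show "\<one>\<^bsub>wreath Y\<^esub> \<otimes>\<^bsub>wreath Y\<^esub> x = x" for x
    by (simp only: mult_wreath one_wreath fst_conv snd_conv add_0 id_apply o_id prod.collapse)
  show "\<exists>y\<in>carrier (wreath Y). y \<otimes>\<^bsub>wreath Y\<^esub> x = \<one>\<^bsub>wreath Y\<^esub>" if x: "x \<in> carrier (wreath Y)" for x
  proof (rule bexI[of _ "(\<lambda>y. fst x (inv_into UNIV (snd x) y), inv_into UNIV (snd x))"])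
    have s: "snd x permutes Y" using x by (simp add: carrier_wreath)
    then show "(\<lambda>y. fst x (inv_into UNIV (snd x) y), inv_into UNIV (snd x)) \<otimes>\<^bsub>wreath Y\<^esub> x = \<one>\<^bsub>wreath Y\<^esub>"
      by (simp add: mult_wreath one_wreath permutes_inv_o)
    show "(\<lambda>y. fst x (inv_into UNIV (snd x) y), inv_into UNIV (snd x)) \<in> carrier (wreath Y)"
      using x permutes_inv[OF s] by (simp add: carrier_wreath permutes_not_in)
  qed
qed

lemma finite_wreath:
  assumes "finite Y" shows "finite (carrier (wreath Y))"
proof -
  have "finite {f :: 'a \<Rightarrow> bit. \<forall>y. (y \<in> Y \<longrightarrow> f y \<in> UNIV) \<and> (y \<notin> Y \<longrightarrow> f y = 0)}"
    using assms by (intro finite_set_of_finite_funs finite_UNIV_bit)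
  then show ?thesis using finite_permutations[OF assms] by (simp add: wreath_def)
qed

lemma wreath_projection_hom: "(\<lambda>p. (\<lambda>_. 0, snd p)) \<in> hom (wreath Y) (wreath Y)"
  by (rule homI) (auto simp: carrier_wreath mult_wreath)

text \<open>For a word \<open>w\<close> the list of the pairs \<open>(b, c)\<close> such that the edge
  from \<open>inv c\<close> to \<open>inv c \<otimes> b\<close> is traversed, in either direction, by the path that reads
  \<open>w\<close> from \<open>inv h\<close>. For \<open>h = \<one>\<close> the elements \<open>inv c\<close> that occur with \<open>b\<close> are, up to sign, the
  terms of the Fox derivative of \<open>w\<close> with respect to \<open>b\<close>.\<close>

fun path_edges :: "('a, 'm) monoid_scheme \<Rightarrow> 'a \<Rightarrow> ('a \<times> bool) list \<Rightarrow> ('a \<times> 'a) list" where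
  "path_edges G h [] = []"
| "path_edges G h ((b, s) # w) =
     (if s then (b, h) # path_edges G (inv\<^bsub>G\<^esub> b \<otimes>\<^bsub>G\<^esub> h) w
      else (b, b \<otimes>\<^bsub>G\<^esub> h) # path_edges G (b \<otimes>\<^bsub>G\<^esub> h) w)"

text \<open>The inverses of the vertices of this path.\<close>

fun path_points :: "('a, 'm) monoid_scheme \<Rightarrow> 'a \<Rightarrow> ('a \<times> bool) list \<Rightarrow> 'a set" where
  "path_points G h [] = {h}"
| "path_points G h ((b, s) # w) =
     insert h (path_points G (if s then inv\<^bsub>G\<^esub> b \<otimes>\<^bsub>G\<^esub> h else b \<otimes>\<^bsub>G\<^esub> h) w)"

lemma finite_path_points [simp]: "finite (path_points G h w)"
  by (induction G h w rule: path_points.induct) auto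

lemma start_path_points [simp]: "h \<in> path_points G h w"
  by (cases w) auto

lemma path_edges_points: "(b, c) \<in> set (path_edges G h w) \<Longrightarrow> c \<in> path_points G h w"
  by (induction G h w rule: path_edges.induct) (auto split: if_splits)

lemma path_edges_letters: "(b, c) \<in> set (path_edges G h w) \<Longrightarrow> b \<in> fst ` set w"
  by (induction G h w rule: path_edges.induct) (auto split: if_splits)

context free_group
begin

lemma path_points_carrier:
  "fst ` set w \<subseteq> B \<Longrightarrow> h \<in> carrier F \<Longrightarrow> path_points F h w \<subseteq> carrier F"
proof (induction w arbitrary: h)
  case (Cons l w)
  then have "fst l \<in> carrier F" using B_carrier by simp
  then show ?case using Cons by (cases l) auto
qed simp

text \<open>The first component of a homomorphism to \<open>wreath Y\<close> is a derivation; this is the chain rule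
  that computes it from its values on the basis.\<close>

lemma fst_hom_wreath:
  assumes \<Phi>: "\<Phi> \<in> hom F (wreath Y)" and w: "fst ` set w \<subseteq> B" and h: "h \<in> carrier F"
  shows "fst (\<Phi> (word_value F w)) (snd (\<Phi> (inv h)) y) =
    (\<Sum>(b, c)\<leftarrow>path_edges F h w. fst (\<Phi> b) (snd (\<Phi> (inv c)) y))"
  using w h
proof (induction w arbitrary: h)
  interpret W: group "wreath Y" by (rule group_wreath)
  interpret group_hom F "wreath Y" \<Phi> using \<Phi> by unfold_locales
  case Nil
  then show ?case by (simp add: one_wreath)
next
  interpret W: group "wreath Y" by (rule group_wreath)
  interpret group_hom F "wreath Y" \<Phi> using \<Phi> by unfold_locales
  have mult: "\<Phi> (g \<otimes> k) = (\<lambda>y. fst (\<Phi> g) y + fst (\<Phi> k) (snd (\<Phi> g) y), snd (\<Phi> k) \<circ> snd (\<Phi> g))"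
    if "g \<in> carrier F" "k \<in> carrier F" for g k
    using that by (simp add: mult_wreath)
  case (Cons l w)
  obtain b s where l: "l = (b, s)" by (cases l)
  have b: "b \<in> carrier F" and w: "word_value F w \<in> carrier F"
    using Cons.prems l B_carrier by auto
  show ?case
  proof (cases s)
    case True
    have "snd (\<Phi> b) (snd (\<Phi> (inv h)) y) = snd (\<Phi> (inv (inv b \<otimes> h))) y"
      using b Cons.prems by (simp add: inv_mult_group mult del: hom_mult)
    then show ?thesis
      using Cons.IH[of "inv b \<otimes> h"] Cons.prems b w l True by (simp add: mult del: hom_mult)
  next
    case False
    have z: "snd (\<Phi> (inv b)) (snd (\<Phi> (inv h)) y) = snd (\<Phi> (inv (b \<otimes> h))) y"
      using b Cons.prems by (simp add: inv_mult_group mult del: hom_mult hom_inv)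
    have "\<Phi> (b \<otimes> inv b) = \<Phi> \<one>" using b by simp
    then have "\<Phi> (inv b \<otimes> b) = (\<lambda>_. 0, id)" using b by (simp add: one_wreath)
    then have "fst (\<Phi> (inv b) \<otimes>\<^bsub>wreath Y\<^esub> \<Phi> b) u = 0" for u
      using b by simp
    then have "fst (\<Phi> (inv b)) u = fst (\<Phi> b) (snd (\<Phi> (inv b)) u)" for u
      by (simp only: mult_wreath fst_conv bit_add_eq_0_iff)
    then show ?thesis
      using Cons.IH[of "b \<otimes> h"] Cons.prems b w l False z by (simp add: mult del: hom_mult hom_inv)
  qed
qed

end

section \<open>Additive maps with equal images\<close>

text \<open>The fibres of \<open>p\<close> and \<open>q\<close> over a point of their common image have the same size, namely the
  size of \<open>Y\<close> divided by that of the image, so they can be matched by a permutation of \<open>Y\<close>.\<close>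

lemma fibre_matching:
  fixes Y :: "'y :: ab_group_add set" and p q :: "'y \<Rightarrow> 'z :: ab_group_add"
  assumes fin: "finite Y" and ne: "Y \<noteq> {}" and diff: "\<And>x y. x \<in> Y \<Longrightarrow> y \<in> Y \<Longrightarrow> x - y \<in> Y"
    and p: "\<And>x y. x \<in> Y \<Longrightarrow> y \<in> Y \<Longrightarrow> p (x - y) = p x - p y"
    and q: "\<And>x y. x \<in> Y \<Longrightarrow> y \<in> Y \<Longrightarrow> q (x - y) = q x - q y"
    and im: "p ` Y = q ` Y"
  shows "\<exists>s. s permutes Y \<and> (\<forall>y\<in>Y. q (s y) = p y)"
proof -
  have zero: "0 \<in> Y" using ne diff by (metis diff_self ex_in_conv)
  have add: "x + y \<in> Y" if "x \<in> Y" "y \<in> Y" for x y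
    using diff[OF that(1) diff[OF zero that(2)]] by simp
  have fib: "card {y \<in> Y. r y = a} = card {y \<in> Y. r y = 0}"
    if r: "\<And>x y. x \<in> Y \<Longrightarrow> y \<in> Y \<Longrightarrow> r (x - y) = r x - r y" and a: "a \<in> r ` Y"
    for r :: "'y \<Rightarrow> 'z" and a
  proof -
    obtain y0 where y0: "y0 \<in> Y" "a = r y0" using a by blast
    have "r (y + y0) = r y + a" if "y \<in> Y" for y
      using r[OF add[OF that y0(1)] y0(1)] y0 by simp
    then have "bij_betw (\<lambda>y. y - y0) {y \<in> Y. r y = a} {y \<in> Y. r y = 0}"
      by (intro bij_betw_byWitness[where f' = "\<lambda>y. y + y0"]) (use y0 add diff r in auto)
    then show ?thesis by (rule bij_betw_same_card)
  qed
  have tot: "card Y = card (r ` Y) * card {y \<in> Y. r y = 0}"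
    if r: "\<And>x y. x \<in> Y \<Longrightarrow> y \<in> Y \<Longrightarrow> r (x - y) = r x - r y" for r :: "'y \<Rightarrow> 'z"
  proof -
    have "card Y = (\<Sum>a\<in>r ` Y. card {y \<in> Y. r y = a})"
      using fin by (subst card_eq_sum, subst sum.image_gen[of Y _ r]) auto
    also have "\<dots> = (\<Sum>a\<in>r ` Y. card {y \<in> Y. r y = 0})"
      using fib[OF r] by (intro sum.cong) auto
    finally show ?thesis by simp
  qed
  have "card (p ` Y) > 0" using fin ne by (simp add: card_gt_0_iff)
  then have ker: "card {y \<in> Y. p y = 0} = card {y \<in> Y. q y = 0}"
    using tot[OF p] tot[OF q] im by auto
  have "\<exists>g. bij_betw g {y \<in> Y. p y = a} {y \<in> Y. q y = a}" if "a \<in> p ` Y" for a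
  proof (rule finite_same_card_bij)
    show "card {y \<in> Y. p y = a} = card {y \<in> Y. q y = a}"
      using fib[OF p that] fib[OF q, of a] that im ker by simp
  qed (use fin in simp_all)
  then obtain g where g: "\<And>a. a \<in> p ` Y \<Longrightarrow> bij_betw (g a) {y \<in> Y. p y = a} {y \<in> Y. q y = a}"
    by metis
  define s where "s y = (if y \<in> Y then g (p y) y else y)" for y
  have s: "s y \<in> Y \<and> q (s y) = p y" if "y \<in> Y" for y
    using bij_betwE[OF g[of "p y"]] that by (auto simp: s_def)
  have "inj_on s Y"
  proof (rule inj_onI)
    fix x y assume xy: "x \<in> Y" "y \<in> Y" "s x = s y"
    then have "p x = p y" using s by metis
    then show "x = y"
      using g[of "p x"] xy by (auto simp: bij_betw_def inj_on_def s_def)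
  qed
  then have "bij_betw s Y Y"
    using s fin by (simp add: bij_betw_def endo_inj_surj image_subset_iff)
  then have "s permutes Y" by (rule bij_imp_permutes) (simp add: s_def)
  then show ?thesis using s by blast
qed

text \<open>Additive functionals with values in \<open>bit\<close> separate a vector from a subspace. The functional is
  the characteristic function of the complement of a maximal subspace that avoids the vector;
  over the field with two elements such a subspace has index two.\<close>

lemma separating_functional:
  fixes K :: "'c :: ab_group_add set"
  assumes two: "\<And>u :: 'c. u + u = 0" and zero: "0 \<in> K"
    and add: "\<And>u v. u \<in> K \<Longrightarrow> v \<in> K \<Longrightarrow> u + v \<in> K" and d: "d \<notin> K"
  obtains \<theta> :: "'c \<Rightarrow> bit" where "\<And>u v. \<theta> (u + v) = \<theta> u + \<theta> v" "\<And>u. u \<in> K \<Longrightarrow> \<theta> u = 0" "\<theta> d = 1"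
proof -
  have cancel: "u + (u + v) = v" for u v :: 'c
    using two[of u] by (simp add: add.assoc[symmetric])
  define A where "A = {M. K \<subseteq> M \<and> d \<notin> M \<and> (\<forall>u\<in>M. \<forall>v\<in>M. u + v \<in> M)}"
  have "\<exists>M\<in>A. \<forall>X\<in>A. M \<subseteq> X \<longrightarrow> X = M"
  proof (rule subset_Zorn_nonempty)
    show "A \<noteq> {}" using add d by (auto simp: A_def)
    fix C assume C: "C \<noteq> {}" "subset.chain A C"
    have sum: "u + v \<in> \<Union>C" if uv: "u \<in> \<Union>C" "v \<in> \<Union>C" for u v
    proof -
      obtain X Y where XY: "X \<in> C" "u \<in> X" "Y \<in> C" "v \<in> Y" using uv by blast
      then have "X \<subseteq> Y \<or> Y \<subseteq> X" using C(2) by (auto simp: subset_chain_def)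
      moreover have "X \<in> A" "Y \<in> A" using XY C(2) by (auto simp: subset_chain_def)
      ultimately show ?thesis using XY unfolding A_def by blast
    qed
    have CA: "K \<subseteq> X \<and> d \<notin> X" if "X \<in> C" for X
      using C(2) that by (auto simp: subset_chain_def A_def)
    have "K \<subseteq> \<Union>C" using C(1) CA by (meson Union_upper ex_in_conv subset_trans)
    moreover have "d \<notin> \<Union>C" using CA by blast
    ultimately show "\<Union>C \<in> A" unfolding A_def using sum by (intro CollectI conjI ballI) auto
  qed
  then obtain M where "M \<in> A" and max: "\<And>X. X \<in> A \<Longrightarrow> M \<subseteq> X \<Longrightarrow> X = M" by blast
  then have M: "K \<subseteq> M" "d \<notin> M" "\<And>u v. u \<in> M \<Longrightarrow> v \<in> M \<Longrightarrow> u + v \<in> M"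
    by (auto simp: A_def)
  have M0: "0 \<in> M" using M(1) zero by blast
  have out: "u + d \<in> M" if u: "u \<notin> M" for u
  proof (rule ccontr)
    assume *: "u + d \<notin> M"
    let ?X = "M \<union> (\<lambda>m. u + m) ` M"
    have "d \<notin> ?X"
    proof
      assume "d \<in> ?X"
      then obtain m where "m \<in> M" "d = u + m" using M(2) by blast
      then show False using * cancel by simp
    qed
    moreover have "x + y \<in> ?X" if xy: "x \<in> ?X" "y \<in> ?X" for x y
    proof -
      have shift: "u + m \<in> ?X" if "m \<in> M" for m using that by blast
      consider "x \<in> M" "y \<in> M" | n where "x \<in> M" "n \<in> M" "y = u + n"
        | m where "m \<in> M" "x = u + m" "y \<in> M" | m n where "m \<in> M" "x = u + m" "n \<in> M" "y = u + n"
        using xy by blast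
      then show ?thesis
      proof cases
        case 1
        then show ?thesis using M(3) by blast
      next
        case 2
        have "x + y = u + (x + n)" unfolding 2(3) by (rule add.left_commute)
        then show ?thesis using shift[OF M(3)[OF 2(1,2)]] by (simp only:)
      next
        case 3
        have "x + y = u + (m + y)" unfolding 3(2) by (rule add.assoc)
        then show ?thesis using shift[OF M(3)[OF 3(1,3)]] by (simp only:)
      next
        case 4
        have "x + y = u + (u + (m + n))" unfolding 4(2,4) by (simp only: ac_simps)
        then have "x + y = m + n" by (simp only: cancel)
        then show ?thesis using M(3)[OF 4(1,3)] by simp
      qed
    qed
    ultimately have "?X \<in> A" using M(1) by (auto simp: A_def)
    then have "?X = M" using max by blast
    moreover have "u + 0 \<in> ?X" using M0 by blast
    ultimately show False using u by simp
  qed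
  define \<theta> :: "'c \<Rightarrow> bit" where "\<theta> u = (if u \<in> M then 0 else 1)" for u
  show thesis
  proof (rule that)
    fix u v
    have 1: "v \<in> M" if "u \<in> M" "u + v \<in> M" for u v
      using M(3)[OF that] cancel[of u v] by simp
    have 2: "u + v \<in> M" if "u \<notin> M" "v \<notin> M"
      using M(3)[OF out[OF that(1)] out[OF that(2)]] two[of d]
      by (simp add: ac_simps) (simp add: add.assoc[symmetric])
    have 3: "v + u \<notin> M" if "u \<notin> M" "v \<in> M" for u v
      using 1[of v u] that by blast
    show "\<theta> (u + v) = \<theta> u + \<theta> v"
    proof (cases "u \<in> M"; cases "v \<in> M")
      assume "u \<in> M" "v \<in> M" then show ?thesis using M(3) by (simp add: \<theta>_def)
    next
      assume "u \<in> M" "v \<notin> M" then show ?thesis using 3[of v u] by (simp add: \<theta>_def)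
    next
      assume "u \<notin> M" "v \<in> M" then show ?thesis using 3[of u v] by (simp add: \<theta>_def add.commute)
    next
      assume "u \<notin> M" "v \<notin> M" then show ?thesis using 2 by (simp add: \<theta>_def)
    qed
  qed (use M in \<open>auto simp: \<theta>_def\<close>)
qed

section \<open>Cuts that separate one translate of a line\<close>

text \<open>A function \<open>\<kappa>\<close> on the group is viewed as a two-colouring of the vertices of the Cayley tree.
  The first condition says that only finitely many edges join vertices of different colours,
  in a form that does not mention the basis; the second one that, among all lines
  \<open>g \<otimes> x\<^sup>n\<close>, only that through the identity changes colour, and it does so only once.\<close>

definition separating_cut :: "('a, 'm) monoid_scheme \<Rightarrow> 'a \<Rightarrow> ('a \<Rightarrow> bit) \<Rightarrow> bool" where
  "separating_cut G x \<kappa> \<longleftrightarrow>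
     (\<forall>h\<in>carrier G. finite {g \<in> carrier G. \<kappa> (g \<otimes>\<^bsub>G\<^esub> h) \<noteq> \<kappa> g}) \<and>
     (\<forall>g\<in>carrier G. \<kappa> (g \<otimes>\<^bsub>G\<^esub> x) \<noteq> \<kappa> g \<longleftrightarrow> g = \<one>\<^bsub>G\<^esub>)"

context free_group
begin

text \<open>The function \<open>l\<close>, regarded as a linear functional on the group algebra over the field with two
  elements, vanishes on the images of all Fox derivatives of \<open>w\<close> under inversion.\<close>

definition annihilates :: "('a \<times> bool) list \<Rightarrow> ('a \<Rightarrow> bit) \<Rightarrow> bool" where
  "annihilates w l \<longleftrightarrow> (\<forall>a. (\<Sum>(b, c)\<leftarrow>path_edges F \<one> w. if b = a then l c else 0) = 0)"

lemma annihilates_add: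
  assumes "annihilates w l" "annihilates w m"
  shows "annihilates w (\<lambda>h. l h + m h)"
proof -
  have sum: "(\<Sum>(b, c)\<leftarrow>L. if b = a then l c + m c else 0) =
      (\<Sum>(b, c)\<leftarrow>L. if b = a then l c else 0) + (\<Sum>(b, c)\<leftarrow>L. if b = a then m c else 0)"
    for L and a :: 'a
  proof (induction L)
    case (Cons p L)
    obtain b c where p: "p = (b, c)" by (cases p)
    have "(if b = a then l c + m c else 0) = (if b = a then l c else 0) + (if b = a then m c else 0)"
      by simp
    then show ?case unfolding p list.map sum_list.Cons case_prod_conv Cons by (simp only: ac_simps)
  qed simp
  show ?thesis using assms unfolding annihilates_def sum by (simp only: add_0 simp_thms)
qed

lemma annihilates_cong:
  assumes "\<And>c. c \<in> path_points F \<one> w \<Longrightarrow> l c = m c"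
  shows "annihilates w l \<longleftrightarrow> annihilates w m"
proof -
  have "(\<Sum>(b, c)\<leftarrow>path_edges F \<one> w. if b = a then l c else 0) =
      (\<Sum>(b, c)\<leftarrow>path_edges F \<one> w. if b = a then m c else 0)" for a
  proof (intro arg_cong[of _ _ sum_list] map_cong refl, clarify)
    fix b c assume "(b, c) \<in> set (path_edges F \<one> w)"
    then show "(if b = a then l c else 0) = (if b = a then m c else 0)"
      using assms[OF path_edges_points] by simp
  qed
  then show ?thesis by (simp add: annihilates_def)
qed

text \<open>Let \<open>K\<close> be the space of the functions \<open>g \<mapsto> \<kappa> (g \<otimes> x) + \<kappa> g\<close>, for the colourings \<open>\<kappa>\<close> with
  finitely many bicoloured edges. It contains the characteristic function of \<open>\<one>\<close> if and only if \<open>x\<close>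
  has a separating cut. Otherwise some functional vanishes on \<open>K\<close> and not on that function; since
  \<open>K\<close> contains the translates of the (inverted) Fox derivatives of \<open>w\<close>, as the colourings by half
  trees show, the functional annihilates these.\<close>

lemma separating_cut_or_functional:
  assumes w: "fst ` set w \<subseteq> B"
  shows "(\<exists>\<kappa>. separating_cut F (word_value F w) \<kappa>) \<or>
    (\<exists>l. (\<forall>g\<in>carrier F. annihilates w (\<lambda>h. l (g \<otimes> h))) \<and> l \<one> = 1)"
proof -
  let ?x = "word_value F w"
  have x: "?x \<in> carrier F" using w by simp
  define bd where "bd \<kappa> \<longleftrightarrow> (\<forall>h\<in>carrier F. finite {g \<in> carrier F. \<kappa> (g \<otimes> h) \<noteq> \<kappa> g})" for \<kappa> :: "'a \<Rightarrow> bit"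
  define K where "K = {u :: 'a \<Rightarrow> bit. \<exists>\<kappa>. bd \<kappa> \<and> (\<forall>g. u g = (if g \<in> carrier F then \<kappa> (g \<otimes> ?x) + \<kappa> g else 0))}"
  \<comment> \<open>the characteristic function of a point\<close>
  define dl where "dl g = (\<lambda>h. if h = g then 1 else 0 :: bit)" for g :: 'a
  show ?thesis
  proof (cases "dl \<one> \<in> K")
    case True
    then obtain \<kappa> where \<kappa>: "bd \<kappa>" "\<And>g. dl \<one> g = (if g \<in> carrier F then \<kappa> (g \<otimes> ?x) + \<kappa> g else 0)"
      by (auto simp: K_def)
    have "\<kappa> (g \<otimes> ?x) \<noteq> \<kappa> g \<longleftrightarrow> g = \<one>" if "g \<in> carrier F" for g
    proof -
      have "\<kappa> (g \<otimes> ?x) \<noteq> \<kappa> g \<longleftrightarrow> \<kappa> (g \<otimes> ?x) + \<kappa> g \<noteq> 0" by (simp only: bit_add_eq_0_iff)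
      also have "\<dots> \<longleftrightarrow> dl \<one> g \<noteq> 0" using \<kappa>(2)[of g] that by (simp only: if_True)
      also have "\<dots> \<longleftrightarrow> g = \<one>" by (simp add: dl_def)
      finally show ?thesis .
    qed
    then show ?thesis using \<kappa>(1) by (auto simp: separating_cut_def bd_def)
  next
    case False
    have two: "u + u = 0" for u :: "'a \<Rightarrow> bit" by (rule ext) (simp only: plus_fun_apply bit_add_self zero_fun_apply)
    have zero: "0 \<in> K" by (auto simp: K_def bd_def intro!: exI[of _ "\<lambda>_. 0"])
    have add: "u + v \<in> K" if "u \<in> K" "v \<in> K" for u v
    proof -
      obtain \<kappa> \<kappa>' where \<kappa>: "bd \<kappa>" "bd \<kappa>'"
        "\<And>g. u g = (if g \<in> carrier F then \<kappa> (g \<otimes> ?x) + \<kappa> g else 0)"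
        "\<And>g. v g = (if g \<in> carrier F then \<kappa>' (g \<otimes> ?x) + \<kappa>' g else 0)"
        using \<open>u \<in> K\<close> \<open>v \<in> K\<close> unfolding K_def by blast
      have "finite {g \<in> carrier F. \<kappa> (g \<otimes> h) + \<kappa>' (g \<otimes> h) \<noteq> \<kappa> g + \<kappa>' g}" if "h \<in> carrier F" for h
      proof (rule finite_subset)
        show "finite ({g \<in> carrier F. \<kappa> (g \<otimes> h) \<noteq> \<kappa> g} \<union> {g \<in> carrier F. \<kappa>' (g \<otimes> h) \<noteq> \<kappa>' g})"
          using \<kappa>(1,2) that by (simp add: bd_def)
      qed fastforce
      then have "bd (\<lambda>g. \<kappa> g + \<kappa>' g)" by (simp only: bd_def ball_simps) blast
      moreover have "(u + v) g = (if g \<in> carrier F then \<kappa> (g \<otimes> ?x) + \<kappa>' (g \<otimes> ?x) + (\<kappa> g + \<kappa>' g) else 0)" for g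
        by (simp only: plus_fun_apply \<kappa>(3,4) ac_simps if_True if_False split: if_split) simp
      ultimately show ?thesis unfolding K_def by (intro CollectI exI[of _ "\<lambda>g. \<kappa> g + \<kappa>' g"]) blast
    qed
    obtain \<theta> :: "('a \<Rightarrow> bit) \<Rightarrow> bit" where \<theta>: "\<And>u v. \<theta> (u + v) = \<theta> u + \<theta> v" "\<And>u. u \<in> K \<Longrightarrow> \<theta> u = 0" "\<theta> (dl \<one>) = 1"
      using separating_functional[OF two zero add False] by blast
    have \<theta>0: "\<theta> 0 = 0" using \<theta>(2) zero by blast
    have "annihilates w (\<lambda>h. \<theta> (dl (g \<otimes> h)))" if g: "g \<in> carrier F" for g
      unfolding annihilates_def
    proof
      fix a
      define Y where "Y = carrier F"
      \<comment> \<open>The derivation that is concentrated at the edge from \<open>g\<close> to \<open>g \<otimes> a\<close>; below, \<open>\<kappa> h\<close> is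
        the parity of the number of times that the path from \<open>\<one>\<close> to \<open>h\<close> crosses this edge.\<close>
      define f where "f b = ((\<lambda>y. if b = a \<and> y = g then 1 else 0 :: bit), (\<lambda>y. if y \<in> carrier F then y \<otimes> b else y))" for b
      have "f \<in> B \<rightarrow> carrier (wreath Y)"
      proof
        fix b assume b: "b \<in> B"
        then have b': "b \<in> carrier F" by (rule B_carrier)
        have "bij_betw (\<lambda>y. y \<otimes> b) (carrier F) (carrier F)"
          by (rule bij_betw_byWitness[where f' = "\<lambda>y. y \<otimes> inv b"]) (use b' in \<open>auto simp: m_assoc\<close>)
        then have "bij_betw (\<lambda>y. if y \<in> carrier F then y \<otimes> b else y) (carrier F) (carrier F)"
          by (subst bij_betw_cong[of _ _ "\<lambda>y. y \<otimes> b"]) auto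
        then have "(\<lambda>y. if y \<in> carrier F then y \<otimes> b else y) permutes carrier F"
          by (rule bij_imp_permutes) auto
        then show "f b \<in> carrier (wreath Y)" using g by (auto simp: carrier_wreath f_def Y_def)
      qed
      note f = this
      define \<Phi> where "\<Phi> = extend_hom (wreath Y) f"
      have \<Phi>: "\<Phi> \<in> hom F (wreath Y)" unfolding \<Phi>_def by (rule extend_hom[OF group_wreath f])
      interpret W: group "wreath Y" by (rule group_wreath)
      interpret \<Phi>: group_hom F "wreath Y" \<Phi> using \<Phi> by unfold_locales
      have \<Phi>B: "\<Phi> b = f b" if "b \<in> B" for b
        unfolding \<Phi>_def by (rule extend_hom_basis[OF group_wreath f that])
      have snd: "snd (\<Phi> k) y = y \<otimes> k" if k: "k \<in> carrier F" and y: "y \<in> carrier F" for k y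
      proof -
        have step: "snd (\<Phi> (word_value F v)) y = y \<otimes> word_value F v" if "fst ` set v \<subseteq> B" "y \<in> carrier F" for v y
          using that
        proof (induction v arbitrary: y)
          case (Cons m v)
          obtain b s where m: "m = (b, s)" by (cases m)
          have b: "b \<in> B" "b \<in> carrier F" using Cons.prems m B_carrier by auto
          have v: "word_value F v \<in> carrier F" using Cons.prems by auto
          have pos: "snd (\<Phi> b) z = z \<otimes> b" if "z \<in> carrier F" for z
            using that by (simp add: \<Phi>B b f_def)
          have neg: "snd (\<Phi> (inv b)) z = z \<otimes> inv b" if z: "z \<in> carrier F" for z
          proof -
            have "snd (\<Phi> b \<otimes>\<^bsub>wreath Y\<^esub> \<Phi> (inv b)) (z \<otimes> inv b) = z \<otimes> inv b"
              using b by (simp add: one_wreath)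
            then show ?thesis using b z pos[of "z \<otimes> inv b"]
              by (simp add: mult_wreath m_assoc del: \<Phi>.hom_inv)
          qed
          have "\<Phi> (word_value F (m # v)) = \<Phi> (if s then b else inv b) \<otimes>\<^bsub>wreath Y\<^esub> \<Phi> (word_value F v)"
            using b v m by (simp del: \<Phi>.hom_inv)
          then show ?case
            using Cons.IH Cons.prems b v m pos neg by (simp add: mult_wreath m_assoc del: \<Phi>.hom_inv)
        qed (simp add: one_wreath)
        show ?thesis using step[OF red_letters[OF k] y] k by simp
      qed
      have fst: "fst (\<Phi> (word_value F v)) y = (\<Sum>(b, c)\<leftarrow>path_edges F \<one> v. fst (f b) (y \<otimes> inv c))"
        if v: "fst ` set v \<subseteq> B" and y: "y \<in> carrier F" for v y
      proof -
        have "fst (\<Phi> (word_value F v)) (snd (\<Phi> (inv \<one>)) y) =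
            (\<Sum>(b, c)\<leftarrow>path_edges F \<one> v. fst (\<Phi> b) (snd (\<Phi> (inv c)) y))"
          by (rule fst_hom_wreath[OF \<Phi> v one_closed])
        also have "\<dots> = (\<Sum>(b, c)\<leftarrow>path_edges F \<one> v. fst (f b) (y \<otimes> inv c))"
        proof (intro arg_cong[of _ _ sum_list] map_cong refl, clarify)
          fix b c assume bc: "(b, c) \<in> set (path_edges F \<one> v)"
          have "b \<in> B" using path_edges_letters[OF bc] v by blast
          moreover have "c \<in> carrier F" using path_edges_points[OF bc] path_points_carrier[OF v one_closed] by blast
          ultimately show "fst (\<Phi> b) (snd (\<Phi> (inv c)) y) = fst (f b) (y \<otimes> inv c)"
            using snd[of "inv c" y] y by (simp add: \<Phi>B)
        qed
        finally show ?thesis using y by (simp add: one_wreath)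
      qed
      define \<kappa> where "\<kappa> h = fst (\<Phi> h) \<one>" for h
      have \<kappa>: "\<kappa> (h \<otimes> k) = \<kappa> h + fst (\<Phi> k) h" if "h \<in> carrier F" "k \<in> carrier F" for h k
        using that snd[of h \<one>] by (simp add: \<kappa>_def mult_wreath)
      have "bd \<kappa>"
        unfolding bd_def
      proof
        fix k assume k: "k \<in> carrier F"
        let ?L = "path_edges F \<one> (red k)"
        have "y \<in> (\<lambda>p. g \<otimes> snd p) ` set ?L" if y: "y \<in> carrier F" "fst (\<Phi> k) y \<noteq> 0" for y
        proof (rule ccontr)
          assume no: "y \<notin> (\<lambda>p. g \<otimes> snd p) ` set ?L"
          have "fst (f b) (y \<otimes> inv c) = 0" if bc: "(b, c) \<in> set ?L" for b c
          proof -
            have c: "c \<in> carrier F"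
              using path_edges_points[OF bc] path_points_carrier[OF red_letters[OF k] one_closed] by blast
            have "y \<noteq> g \<otimes> c" using no bc by force
            then have "y \<otimes> inv c \<noteq> g" using y(1) c g by (auto simp: m_assoc)
            then show ?thesis by (simp add: f_def)
          qed
          then have "(\<Sum>(b, c)\<leftarrow>?L. fst (f b) (y \<otimes> inv c)) = (\<Sum>(b, c)\<leftarrow>?L. 0)"
            by (intro arg_cong[of _ _ sum_list] map_cong) auto
          then show False using fst[OF red_letters[OF k] y(1)] y(2) k by (simp add: case_prod_unfold)
        qed
        moreover have "fst (\<Phi> k) y \<noteq> 0" if "y \<in> carrier F" "\<kappa> (y \<otimes> k) \<noteq> \<kappa> y" for y
          using \<kappa>[OF that(1) k] that(2) by (metis add_0_right)
        ultimately have "{y \<in> carrier F. \<kappa> (y \<otimes> k) \<noteq> \<kappa> y} \<subseteq> (\<lambda>p. g \<otimes> snd p) ` set ?L" by blast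
        then show "finite {y \<in> carrier F. \<kappa> (y \<otimes> k) \<noteq> \<kappa> y}" by (rule finite_subset) simp
      qed
      define u where "u = (\<Sum>(b, c)\<leftarrow>path_edges F \<one> w. if b = a then dl (g \<otimes> c) else 0)"
      have u: "u y = (if y \<in> carrier F then \<kappa> (y \<otimes> ?x) + \<kappa> y else 0)" for y
      proof -
        have app: "(\<Sum>(b, c)\<leftarrow>L. if b = a then dl (g \<otimes> c) else 0) y =
            (\<Sum>(b, c)\<leftarrow>L. if b = a \<and> y = g \<otimes> c then 1 else 0 :: bit)" for L :: "('a \<times> 'a) list"
        proof (induction L)
          case (Cons p L)
          then show ?case by (cases p) (simp only: list.map sum_list.Cons case_prod_conv plus_fun_apply, simp add: dl_def)
        qed simp
        have eq: "fst (f b) (y \<otimes> inv c) = (if b = a \<and> y = g \<otimes> c then 1 else 0)"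
          if "c \<in> carrier F" "y \<in> carrier F" for b c
        proof -
          have "y \<otimes> inv c = g \<longleftrightarrow> y = g \<otimes> c" using that g by (auto simp: m_assoc)
          then show ?thesis by (simp add: f_def)
        qed
        have c: "c \<in> carrier F" if "(b, c) \<in> set (path_edges F \<one> w)" for b c
          using path_edges_points[OF that] path_points_carrier[OF w one_closed] by blast
        show ?thesis
        proof (cases "y \<in> carrier F")
          case True
          have "u y = (\<Sum>(b, c)\<leftarrow>path_edges F \<one> w. fst (f b) (y \<otimes> inv c))"
            unfolding u_def app using eq[OF c True]
            by (intro arg_cong[of _ _ sum_list] map_cong refl) (auto simp only: split: prod.splits)
          also have "\<dots> = fst (\<Phi> ?x) y" using fst[OF w True] by simp
          also have "\<dots> = \<kappa> (y \<otimes> ?x) + \<kappa> y"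
            using \<kappa>[OF True x] by (simp only: add.commute[of "\<kappa> y"] add.assoc bit_add_self add_0_right)
          finally show ?thesis using True by simp
        next
          case False
          have "u y = (\<Sum>(b, c)\<leftarrow>path_edges F \<one> w. 0)"
            unfolding u_def app using c False g
            by (intro arg_cong[of _ _ sum_list] map_cong refl) auto
          then show ?thesis using False by (simp add: case_prod_unfold)
        qed
      qed
      then have "u \<in> K" using \<open>bd \<kappa>\<close> unfolding K_def by blast
      then have "\<theta> u = 0" by (rule \<theta>(2))
      moreover have "\<theta> (\<Sum>(b, c)\<leftarrow>L. if b = a then dl (g \<otimes> c) else 0) =
          (\<Sum>(b, c)\<leftarrow>L. if b = a then \<theta> (dl (g \<otimes> c)) else 0)" for L :: "('a \<times> 'a) list"
      proof (induction L)
        case (Cons p L)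
        then show ?case by (cases p) (simp only: list.map sum_list.Cons case_prod_conv \<theta>(1), simp add: \<theta>0)
      qed (simp only: list.map sum_list.Nil \<theta>0)
      ultimately show "(\<Sum>(b, c)\<leftarrow>path_edges F \<one> w. if b = a then \<theta> (dl (g \<otimes> c)) else 0) = 0"
        by (simp add: u_def)
    qed
    then show ?thesis using \<theta>(3) by (intro disjI2 exI[of _ "\<lambda>h. \<theta> (dl h)"]) simp
  qed
qed

text \<open>Let \<open>\<Lambda>\<close> be a translation invariant space of functions and \<open>Y\<close> the space of their restrictions
  to a finite set \<open>S\<close>. The translation by \<open>b\<close> does not act on \<open>Y\<close>, but the part of a translate that
  is determined by the restriction to \<open>S\<close> can be realised by a permutation of \<open>Y\<close>.\<close>

lemma finite_model:
  assumes S: "finite S" and ne: "\<Lambda> \<noteq> {}"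
    and add: "\<And>l m. l \<in> \<Lambda> \<Longrightarrow> m \<in> \<Lambda> \<Longrightarrow> (\<lambda>h. l h + m h) \<in> \<Lambda>"
    and trans: "\<And>l g. l \<in> \<Lambda> \<Longrightarrow> g \<in> carrier F \<Longrightarrow> (\<lambda>h. l (g \<otimes> h)) \<in> \<Lambda>"
    and SF: "S \<subseteq> carrier F" and b: "b \<in> carrier F"
  defines "Y \<equiv> (\<lambda>l h. if h \<in> S then l h else 0 :: bit) ` \<Lambda>"
  shows "\<exists>s. s permutes Y \<and> (\<forall>y\<in>Y. \<forall>h\<in>S. b \<otimes> h \<in> S \<longrightarrow> s y h = y (b \<otimes> h))" and "finite Y"
proof -
  define r where "r = (\<lambda>l h. if h \<in> S then l h else 0 :: bit)"
  have Y: "Y = r ` \<Lambda>" by (simp add: Y_def r_def)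
  have "finite {f :: 'a \<Rightarrow> bit. \<forall>h. (h \<in> S \<longrightarrow> f h \<in> UNIV) \<and> (h \<notin> S \<longrightarrow> f h = 0)}"
    using S by (intro finite_set_of_finite_funs finite_UNIV_bit)
  then show fin: "finite Y" by (rule rev_finite_subset) (auto simp: Y_def)
  define P where "P h \<longleftrightarrow> h \<in> S \<and> b \<otimes> h \<in> S" for h
  define src where "src y h = (if P h then y (b \<otimes> h) else 0 :: bit)" for y h
  define tgt where "tgt y h = (if P h then y h else 0 :: bit)" for y h
  have "\<exists>s. s permutes Y \<and> (\<forall>y\<in>Y. tgt (s y) = src y)"
  proof (rule fibre_matching[OF fin])
    show "Y \<noteq> {}" using ne by (simp add: Y)
    fix x y assume "x \<in> Y" "y \<in> Y"
    then obtain l m where lm: "l \<in> \<Lambda>" "x = r l" "m \<in> \<Lambda>" "y = r m" by (auto simp: Y)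
    have "x - y = r (\<lambda>h. l h + m h)"
      by (rule ext) (simp only: lm fun_diff_def minus_bit_def r_def add_0 split: if_split, blast)
    then show "x - y \<in> Y" unfolding Y using add[OF lm(1,3)] by blast
    show "src (x - y) = src x - src y" "tgt (x - y) = tgt x - tgt y"
      by (rule ext, simp only: src_def tgt_def fun_diff_def minus_bit_def add_0 split: if_split, blast)+
  next
    have src: "src (r l) = tgt (r (\<lambda>h. l (b \<otimes> h)))" for l
      by (rule ext) (simp add: src_def tgt_def r_def P_def)
    have tgt: "tgt (r l) = src (r (\<lambda>h. l (inv b \<otimes> h)))" for l
    proof
      fix h
      have "inv b \<otimes> (b \<otimes> h) = h" if "h \<in> S" using that SF b by (auto simp: m_assoc[symmetric])
      then show "tgt (r l) h = src (r (\<lambda>h. l (inv b \<otimes> h))) h"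
        by (simp add: src_def tgt_def r_def P_def)
    qed
    show "src ` Y = tgt ` Y"
    proof (intro equalityI subsetI)
      fix z assume "z \<in> src ` Y"
      then obtain l where "l \<in> \<Lambda>" "z = src (r l)" by (auto simp: Y)
      then show "z \<in> tgt ` Y" using src[of l] trans[OF _ b] by (auto simp: Y)
    next
      fix z assume "z \<in> tgt ` Y"
      then obtain l where "l \<in> \<Lambda>" "z = tgt (r l)" by (auto simp: Y)
      then show "z \<in> src ` Y" using tgt[of l] trans[of l "inv b"] b by (auto simp: Y)
    qed
  qed
  then obtain s where s: "s permutes Y" "\<And>y. y \<in> Y \<Longrightarrow> tgt (s y) = src y" by blast
  have "s y h = y (b \<otimes> h)" if "y \<in> Y" "h \<in> S" "b \<otimes> h \<in> S" for y h
    using fun_cong[OF s(2)[OF that(1)], of h] that by (simp add: tgt_def src_def P_def)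
  then show "\<exists>s. s permutes Y \<and> (\<forall>y\<in>Y. \<forall>h\<in>S. b \<otimes> h \<in> S \<longrightarrow> s y h = y (b \<otimes> h))"
    using s(1) by blast
qed

lemma sum_list_by_letter:
  fixes f l :: "'x \<Rightarrow> bit"
  assumes "finite A" "fst ` set L \<subseteq> A"
  shows "(\<Sum>(b, c)\<leftarrow>L. l c * f b) = (\<Sum>a\<in>A. f a * (\<Sum>(b, c)\<leftarrow>L. if b = a then l c else 0))"
  using assms(2)
proof (induction L)
  case (Cons p L)
  obtain b c where p: "p = (b, c)" by (cases p)
  have "(\<Sum>a\<in>A. f a * (if b = a then l c else 0)) = (\<Sum>a\<in>A. if b = a then l c * f b else 0)"
    by (intro sum.cong) (simp_all only: mult_zero_right ac_simps split: if_split, auto)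
  also have "\<dots> = l c * f b"
    using assms(1) Cons.prems p by (subst sum.delta'[OF assms(1)]) auto
  finally show ?case
    using Cons unfolding p list.map sum_list.Cons case_prod_conv distrib_left sum.distrib by simp
qed simp

lemma sum_sum_list_swap:
  "(\<Sum>y\<in>Y. \<Sum>p\<leftarrow>L. f y p) = (\<Sum>p\<leftarrow>L. \<Sum>y\<in>Y. f y p)" for f :: "'x \<Rightarrow> 'y \<Rightarrow> 'z :: comm_monoid_add"
  by (induction L) (simp_all add: sum.distrib)

text \<open>The functional \<open>f \<mapsto> (\<Sum>y\<in>Y. y \<one> * f y)\<close> vanishes on the first component of the image of \<open>w\<close>,
  for every choice of the first components of the images of the basis.\<close>

lemma weighted_sum_hom_wreath:
  assumes w: "fst ` set w \<subseteq> B" and fin: "finite Y" and \<Phi>: "\<Phi> \<in> hom F (wreath Y)"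
    and ann: "\<And>y. y \<in> Y \<Longrightarrow> annihilates w y"
    and s: "\<And>b y h. b \<in> B \<Longrightarrow> y \<in> Y \<Longrightarrow> h \<in> path_points F \<one> w \<Longrightarrow> b \<otimes> h \<in> path_points F \<one> w \<Longrightarrow>
      snd (\<Phi> b) y h = y (b \<otimes> h)"
  shows "(\<Sum>y\<in>Y. y \<one> * fst (\<Phi> (word_value F w)) y) = 0"
proof -
  interpret W: group "wreath Y" by (rule group_wreath)
  interpret \<Phi>: group_hom F "wreath Y" \<Phi> using \<Phi> by unfold_locales
  let ?S = "path_points F \<one> w" and ?L = "path_edges F \<one> w"
  have SF: "?S \<subseteq> carrier F" using path_points_carrier[OF w] by simp
  have perm: "snd (\<Phi> g) permutes Y" if "g \<in> carrier F" for g
    using \<Phi>.hom_closed[OF that] by (simp add: carrier_wreath)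
  have mult: "snd (\<Phi> (g \<otimes> h)) y = snd (\<Phi> h) (snd (\<Phi> g) y)" if "g \<in> carrier F" "h \<in> carrier F" for g h y
    using that by (simp add: mult_wreath)
  have one: "snd (\<Phi> \<one>) y = y" for y by (simp add: one_wreath)
  have pts: "snd (\<Phi> c) y \<one> = y c"
    if "fst ` set v \<subseteq> B" "h \<in> carrier F" "path_points F h v \<subseteq> ?S" "\<And>y. y \<in> Y \<Longrightarrow> snd (\<Phi> h) y \<one> = y h"
      "c \<in> path_points F h v" "y \<in> Y" for v h c y
    using that
  proof (induction v arbitrary: h)
    case (Cons m v)
    obtain b t where m: "m = (b, t)" by (cases m)
    have b: "b \<in> B" "b \<in> carrier F" using Cons.prems(1) m B_carrier by auto
    define h' where "h' = (if t then inv b \<otimes> h else b \<otimes> h)"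
    have h': "h' \<in> carrier F" using b Cons.prems(2) by (simp add: h'_def)
    have sub: "path_points F h' v \<subseteq> ?S" "h \<in> ?S" using Cons.prems(3) m by (auto simp: h'_def)
    then have h'S: "h' \<in> ?S" using start_path_points[of h' F v] by blast
    \<comment> \<open>the next point \<open>h'\<close> of the path, too, acts on \<open>Y\<close> in such a way that it brings the value
      at \<open>h'\<close> to \<open>\<one>\<close>\<close>
    have nxt: "snd (\<Phi> h') z \<one> = z h'" if z: "z \<in> Y" for z
    proof (cases t)
      case True
      let ?z = "snd (\<Phi> (inv b)) z"
      have z': "?z \<in> Y" using permutes_in_image[OF perm[of "inv b"]] b z by (simp del: \<Phi>.hom_inv)
      have "snd (\<Phi> b) ?z = z" using mult[of "inv b" b z] b by (simp add: one del: \<Phi>.hom_inv \<Phi>.hom_one)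
      moreover have "b \<otimes> h' = h" using True b Cons.prems(2) by (simp add: h'_def m_assoc[symmetric])
      ultimately have "z h' = ?z h" using s[OF b(1) z' h'S] sub(2) by simp
      moreover have "snd (\<Phi> h') z \<one> = ?z h"
        using mult[of "inv b" h z] True b Cons.prems(2,4) z' by (simp add: h'_def del: \<Phi>.hom_inv \<Phi>.hom_mult)
      ultimately show ?thesis by simp
    next
      case False
      have z': "snd (\<Phi> b) z \<in> Y" using permutes_in_image[OF perm] b z by simp
      have "snd (\<Phi> h') z \<one> = snd (\<Phi> b) z h"
        using mult[of b h z] False b Cons.prems(2,4) z' by (simp add: h'_def del: \<Phi>.hom_mult)
      then show ?thesis using s[OF b(1) z sub(2)] h'S False by (simp add: h'_def)
    qed
    show ?case
    proof (cases "c = h")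
      case True
      then show ?thesis using Cons.prems by simp
    next
      case False
      then have "c \<in> path_points F h' v" using Cons.prems(5) m by (auto simp: h'_def)
      then show ?thesis
        using Cons.IH[OF _ h' sub(1)] nxt Cons.prems by simp
    qed
  qed simp
  have pt: "snd (\<Phi> c) y \<one> = y c" if "c \<in> ?S" "y \<in> Y" for c y
    by (rule pts[OF w _ _ _ that]) (simp_all add: one del: \<Phi>.hom_one)
  have "(\<Sum>y\<in>Y. y \<one> * fst (\<Phi> (word_value F w)) y) =
      (\<Sum>y\<in>Y. \<Sum>p\<leftarrow>?L. y \<one> * fst (\<Phi> (fst p)) (snd (\<Phi> (inv (snd p))) y))"
  proof (rule sum.cong[OF refl])
    fix y
    have "fst (\<Phi> (word_value F w)) y = (\<Sum>p\<leftarrow>?L. fst (\<Phi> (fst p)) (snd (\<Phi> (inv (snd p))) y))"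
      using fst_hom_wreath[OF \<Phi> w one_closed]
      by (simp add: one case_prod_unfold del: \<Phi>.hom_inv \<Phi>.hom_one)
    then show "y \<one> * fst (\<Phi> (word_value F w)) y =
        (\<Sum>p\<leftarrow>?L. y \<one> * fst (\<Phi> (fst p)) (snd (\<Phi> (inv (snd p))) y))"
      by (simp only: sum_list_const_mult)
  qed
  also have "\<dots> = (\<Sum>p\<leftarrow>?L. \<Sum>y\<in>Y. y \<one> * fst (\<Phi> (fst p)) (snd (\<Phi> (inv (snd p))) y))"
    by (rule sum_sum_list_swap)
  also have "\<dots> = (\<Sum>p\<leftarrow>?L. \<Sum>y\<in>Y. y (snd p) * fst (\<Phi> (fst p)) y)"
  proof (intro arg_cong[of _ _ sum_list] map_cong refl)
    fix p assume p: "p \<in> set ?L"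
    obtain b c where bc: "p = (b, c)" by (cases p)
    have cS: "c \<in> ?S" using path_edges_points[of b c] p bc by simp
    then have c: "c \<in> carrier F" using SF by blast
    have "(\<Sum>y\<in>Y. y \<one> * fst (\<Phi> b) (snd (\<Phi> (inv c)) y)) =
        (\<Sum>y\<in>Y. snd (\<Phi> c) y \<one> * fst (\<Phi> b) (snd (\<Phi> (inv c)) (snd (\<Phi> c) y)))"
      by (subst sum.permute[OF perm[OF c]]) (simp add: o_def)
    also have "\<dots> = (\<Sum>y\<in>Y. y c * fst (\<Phi> b) y)"
      using mult[of c "inv c"] c pt[OF cS] by (intro sum.cong) (simp_all add: one del: \<Phi>.hom_inv \<Phi>.hom_one \<Phi>.hom_mult)
    finally show "(\<Sum>y\<in>Y. y \<one> * fst (\<Phi> (fst p)) (snd (\<Phi> (inv (snd p))) y)) =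
        (\<Sum>y\<in>Y. y (snd p) * fst (\<Phi> (fst p)) y)" by (simp only: bc fst_conv snd_conv)
  qed
  also have "\<dots> = (\<Sum>y\<in>Y. \<Sum>p\<leftarrow>?L. y (snd p) * fst (\<Phi> (fst p)) y)"
    by (rule sum_sum_list_swap[symmetric])
  also have "\<dots> = 0"
  proof (rule sum.neutral, rule ballI)
    fix y assume y: "y \<in> Y"
    have "(\<Sum>(b, c)\<leftarrow>?L. y c * fst (\<Phi> b) y) =
        (\<Sum>a\<in>fst ` set ?L. fst (\<Phi> a) y * (\<Sum>(b, c)\<leftarrow>?L. if b = a then y c else 0))"
      by (rule sum_list_by_letter) auto
    also have "\<dots> = 0" using ann[OF y] unfolding annihilates_def by simp
    finally show "(\<Sum>p\<leftarrow>?L. y (snd p) * fst (\<Phi> (fst p)) y) = 0" by (simp add: case_prod_unfold)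
  qed
  finally show ?thesis .
qed

text \<open>The permutations of \<open>finite_model\<close> define an action of \<open>F\<close> on a finite set \<open>Y\<close>, and thus of
  its completion. An element of a profinite basis can be sent to any element of \<open>wreath Y\<close> that has
  the prescribed second component, by a homomorphism that induces the same action. Since
  \<open>weighted_sum_hom_wreath\<close> restricts the image of \<open>w\<close>, there is no functional as in
  \<open>separating_cut_or_functional\<close>.\<close>

lemma profinite_primitive_no_functional:
  assumes rank: "free_group_of_rank F k" "1 \<le> k" and w: "fst ` set w \<subseteq> B"
    and prim: "completion_map F (word_value F w) \<in>
      profinite_primitive_elements (profinite_completion F) (completion_topology F)"
    and l: "\<And>g. g \<in> carrier F \<Longrightarrow> annihilates w (\<lambda>h. l (g \<otimes> h))" and l1: "l \<one> = 1"
  shows False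
proof -
  let ?H = "profinite_completion F" and ?T = "completion_topology F" and ?c = "completion_map F"
  let ?S = "path_points F \<one> w" and ?x = "word_value F w"
  have SF: "?S \<subseteq> carrier F" using path_points_carrier[OF w] by simp
  define \<Lambda> where "\<Lambda> = {l. \<forall>g\<in>carrier F. annihilates w (\<lambda>h. l (g \<otimes> h))}"
  define Y where "Y = (\<lambda>l h. if h \<in> ?S then l h else 0 :: bit) ` \<Lambda>"
  have lL: "l \<in> \<Lambda>" using l by (simp add: \<Lambda>_def)
  have add: "(\<lambda>h. l h + m h) \<in> \<Lambda>" if "l \<in> \<Lambda>" "m \<in> \<Lambda>" for l m
    using that annihilates_add unfolding \<Lambda>_def by blast
  have trans: "(\<lambda>h. l (g \<otimes> h)) \<in> \<Lambda>" if "l \<in> \<Lambda>" "g \<in> carrier F" for l g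
    unfolding \<Lambda>_def
  proof (intro CollectI ballI)
    fix k assume k: "k \<in> carrier F"
    have "annihilates w (\<lambda>h. l ((g \<otimes> k) \<otimes> h))" using that k by (simp add: \<Lambda>_def)
    then show "annihilates w (\<lambda>h. l (g \<otimes> (k \<otimes> h)))"
      by (subst annihilates_cong) (use SF that(2) k in \<open>auto simp: m_assoc\<close>)
  qed
  have ann: "annihilates w y" if y: "y \<in> Y" for y
  proof -
    obtain l where "l \<in> \<Lambda>" "y = (\<lambda>h. if h \<in> ?S then l h else 0)"
      using y unfolding Y_def by blast
    moreover have "annihilates w (\<lambda>h. l (\<one> \<otimes> h))" using \<open>l \<in> \<Lambda>\<close> unfolding \<Lambda>_def by blast
    ultimately show ?thesis by (subst annihilates_cong) (use SF in auto)
  qed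
  have finY: "finite Y" unfolding Y_def
    by (rule finite_model(2)[OF _ _ add trans SF one_closed]) (use lL in auto)
  have "\<exists>s. s permutes Y \<and> (\<forall>y\<in>Y. \<forall>h\<in>?S. b \<otimes> h \<in> ?S \<longrightarrow> s y h = y (b \<otimes> h))" if "b \<in> B" for b
    unfolding Y_def by (rule finite_model(1)[OF _ _ add trans SF B_carrier[OF that]]) (use lL in auto)
  then obtain s where s: "\<And>b. b \<in> B \<Longrightarrow> s b permutes Y"
    "\<And>b y h. b \<in> B \<Longrightarrow> y \<in> Y \<Longrightarrow> h \<in> ?S \<Longrightarrow> b \<otimes> h \<in> ?S \<Longrightarrow> s b y h = y (b \<otimes> h)" by metis
  let ?W = "wreath Y" and ?D = "discrete_topology (carrier (wreath Y))"
  interpret W: group ?W by (rule group_wreath)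
  have pW: "profinite_group ?W ?D"
    by (rule finite_discrete_profinite[OF group_wreath finite_wreath[OF finY]])
  have f0: "(\<lambda>b. (\<lambda>_. 0, s b)) \<in> B \<rightarrow> carrier ?W" using s(1) by (auto simp: carrier_wreath)
  obtain \<psi>0 where \<psi>0: "\<psi>0 \<in> hom ?H ?W" "continuous_map ?T ?D \<psi>0"
    "\<And>g. g \<in> carrier F \<Longrightarrow> \<psi>0 (?c g) = extend_hom ?W (\<lambda>b. (\<lambda>_. 0, s b)) g"
    using completion_extend_hom[OF is_group pW extend_hom[OF group_wreath f0]] by blast
  obtain S where S: "profinite_basis ?H ?T S" "?c ?x \<in> S"
    using prim by (auto simp: profinite_primitive_elements_def)
  have SH: "S \<subseteq> carrier ?H" using S(1) by (simp add: profinite_basis_def)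
  have cH: "?c \<in> hom F ?H" by (rule completion_map_hom)
  have xF: "?x \<in> carrier F" using w by simp
  define y0 where "y0 = (\<lambda>h. if h \<in> ?S then l h else 0)"
  have y0: "y0 \<in> Y" "y0 \<one> = 1" using lL l1 by (auto simp: Y_def y0_def)
  \<comment> \<open>over the action \<open>\<psi>0\<close>, the element \<open>x\<close> is sent to the characteristic function of \<open>y0\<close>\<close>
  define f where "f z = ((\<lambda>y. if z = ?c ?x \<and> y = y0 then 1 else 0 :: bit), snd (\<psi>0 z))" for z
  have \<psi>0W: "snd (\<psi>0 z) permutes Y" if "z \<in> carrier ?H" for z
    using \<psi>0(1) that by (auto simp: hom_def carrier_wreath Pi_iff)
  have f: "f \<in> S \<rightarrow> carrier ?W" using SH \<psi>0W y0(1) by (auto simp: f_def carrier_wreath)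
  obtain \<psi> where \<psi>: "\<psi> \<in> hom ?H ?W" "continuous_map ?T ?D \<psi>" "\<And>z. z \<in> S \<Longrightarrow> \<psi> z = f z"
    using profinite_basis_completion_universal[OF rank S(1) pW f] by blast
  let ?pr = "\<lambda>p. (\<lambda>_ :: 'a \<Rightarrow> bit. 0 :: bit, snd p)"
  have prH: "?pr \<in> hom ?W ?W" by (rule wreath_projection_hom)
  have prC: "continuous_map ?D ?D ?pr" using prH by (auto simp: hom_def)
  have pf: "(\<lambda>z. ?pr (f z)) \<in> S \<rightarrow> carrier ?W" using f prH by (auto simp: hom_def Pi_iff)
  let ?lift = "\<lambda>\<psi> :: ('a set \<Rightarrow> 'a set) \<Rightarrow> _. restrict (?pr \<circ> \<psi>) (carrier ?H)"
  have lift: "?lift \<psi> \<in> hom ?H ?W \<inter> extensional (carrier ?H) \<and> continuous_map ?T ?D (?lift \<psi>) \<and>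
      (\<forall>z\<in>S. ?lift \<psi> z = ?pr (f z))"
    if "\<psi> \<in> hom ?H ?W" "continuous_map ?T ?D \<psi>" "\<And>z. z \<in> S \<Longrightarrow> snd (\<psi> z) = snd (f z)" for \<psi>
  proof (intro conjI IntI ballI)
    interpret H: group ?H using is_group by (rule group_profinite_completion)
    have "?pr \<circ> \<psi> \<in> hom ?H ?W" using Group.hom_compose[OF that(1) prH] .
    then show "?lift \<psi> \<in> hom ?H ?W" unfolding hom_def by (simp add: Pi_iff)
    show "continuous_map ?T ?D (?lift \<psi>)"
      by (rule continuous_map_eq[OF continuous_map_compose[OF that(2) prC]])
        (simp add: topspace_completion[OF is_group])
    show "?lift \<psi> z = ?pr (f z)" if "z \<in> S" for z
      using that SH \<open>\<And>z. z \<in> S \<Longrightarrow> snd (\<psi> z) = snd (f z)\<close> by auto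
  qed simp
  have lift_eq: "?lift \<psi> = ?lift \<psi>0"
    using profinite_basis_completion_universal[OF rank S(1) pW pf] lift[OF \<psi>(1,2)] lift[OF \<psi>0(1,2)]
      \<psi>(3) by (auto simp: f_def)
  have snd_eq: "snd (\<psi> z) = snd (\<psi>0 z)" if "z \<in> carrier ?H" for z
    using arg_cong[OF fun_cong[OF lift_eq, of z], of snd] that by simp
  define \<Phi> where "\<Phi> = \<psi> \<circ> ?c"
  have \<Phi>: "\<Phi> \<in> hom F ?W" unfolding \<Phi>_def by (rule Group.hom_compose[OF cH \<psi>(1)])
  have "snd (\<Phi> b) = s b" if b: "b \<in> B" for b
    using snd_eq[of "?c b"] \<psi>0(3)[OF B_carrier[OF b]] extend_hom_basis[OF group_wreath f0 b] cH B_carrier[OF b]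
    by (auto simp: \<Phi>_def hom_def)
  then have "(\<Sum>y\<in>Y. y \<one> * fst (\<Phi> ?x) y) = 0"
    using s(2) by (intro weighted_sum_hom_wreath[OF w finY \<Phi> ann]) auto
  moreover have "fst (\<Phi> ?x) = (\<lambda>y. if y = y0 then 1 else 0)"
    using \<psi>(3)[OF S(2)] by (simp add: \<Phi>_def f_def)
  ultimately have "(\<Sum>y\<in>Y. y \<one> * (if y = y0 then 1 else 0)) = 0" by (simp only:)
  moreover have "(\<Sum>y\<in>Y. y \<one> * (if y = y0 then 1 else 0)) = (\<Sum>y\<in>Y. if y = y0 then y \<one> else 0)"
    by (intro sum.cong refl) (simp only: mult_1_right mult_zero_right split: if_split, blast)
  ultimately show False using y0 finY by (simp add: sum.delta)
qed

end

section \<open>Cyclically reduced words\<close>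

text \<open>All rotations of the non-empty word \<open>w\<close> are reduced.\<close>

definition cyclically_reduced :: "('a \<times> bool) list \<Rightarrow> bool" where
  "cyclically_reduced w \<longleftrightarrow> w \<noteq> [] \<and> reduced_word (last w # w)"

lemma cyclically_reduced_iff:
  "cyclically_reduced w \<longleftrightarrow> w \<noteq> [] \<and> reduced_word w \<and> hd w \<noteq> inv_letter (last w)"
  by (auto simp: cyclically_reduced_def reduced_word_Cons)

lemma cyclically_reduced_rotate:
  assumes "cyclically_reduced (p @ q)"
  shows "cyclically_reduced (q @ p)"
proof (cases "p = [] \<or> q = []")
  case False
  then show ?thesis using assms
    by (auto simp: cyclically_reduced_iff reduced_word_append)
qed (use assms in auto)

definition word_power :: "('a \<times> bool) list \<Rightarrow> nat \<Rightarrow> ('a \<times> bool) list" where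
  "word_power w n = concat (replicate n w)"

lemma word_power_0 [simp]: "word_power w 0 = []"
  and word_power_Suc: "word_power w (Suc n) = w @ word_power w n"
  by (simp_all add: word_power_def)

lemma word_power_eq_Nil_iff [simp]: "word_power w n = [] \<longleftrightarrow> w = [] \<or> n = 0"
  by (induction n) (auto simp: word_power_Suc)

lemma length_word_power [simp]: "length (word_power w n) = n * length w"
  by (induction n) (auto simp: word_power_Suc)

lemma set_word_power: "set (word_power w n) \<subseteq> set w"
  by (induction n) (auto simp: word_power_Suc)

lemma hd_word_power: "w \<noteq> [] \<Longrightarrow> 0 < n \<Longrightarrow> hd (word_power w n) = hd w"
  by (cases n) (auto simp: word_power_Suc)

lemma last_word_power: "w \<noteq> [] \<Longrightarrow> 0 < n \<Longrightarrow> last (word_power w n) = last w"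
proof (induction n)
  case (Suc n)
  then show ?case by (cases n) (auto simp: word_power_Suc)
qed simp

lemma reduced_word_power: "cyclically_reduced w \<Longrightarrow> reduced_word (word_power w n)"
proof (induction n)
  case (Suc n)
  then show ?case
    by (cases n) (auto simp: word_power_Suc reduced_word_append cyclically_reduced_iff)
qed simp

text \<open>The turns of a path: the pairs of directions, one backwards and one forwards, in which it
  leaves its successive points. The turns of the line that reads the cyclic word \<open>w\<close>, the edges of
  its Whitehead graph, are given by \<open>turns (last w) w\<close>.\<close>

fun turns :: "'a \<times> bool \<Rightarrow> ('a \<times> bool) list \<Rightarrow> (('a \<times> bool) \<times> ('a \<times> bool)) list" where
  "turns l [] = []"
| "turns l (m # w) = (inv_letter l, m) # turns m w"

lemma turns_split:
  "(a, b) \<in> set (turns l w) \<Longrightarrow>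
    \<exists>p q. w = p @ q \<and> q \<noteq> [] \<and> b = hd q \<and> a = inv_letter (if p = [] then l else last p)"
proof (induction l w rule: turns.induct)
  case (2 l m w)
  show ?case
  proof (cases "(a, b) = (inv_letter l, m)")
    case True
    then show ?thesis by (intro exI[of _ "[]"] exI[of _ "m # w"]) simp
  next
    case False
    then obtain p q where "w = p @ q" "q \<noteq> []" "b = hd q" "a = inv_letter (if p = [] then m else last p)"
      using 2 by auto
    then show ?thesis by (intro exI[of _ "m # p"] exI[of _ q]) auto
  qed
qed simp

lemma turns_letters:
  "(a, b) \<in> set (turns l w) \<Longrightarrow> fst a \<in> insert (fst l) (fst ` set w) \<and> fst b \<in> fst ` set w"
  by (induction l w rule: turns.induct) auto

text \<open>Every occurrence of a letter or of its inverse contributes one turn at that letter.\<close>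

lemma length_filter_turns:
  assumes "reduced_word (l # w)"
  shows "length (filter (\<lambda>(a, b). a = e \<or> b = e) (turns l w)) + of_bool (inv_letter (last (l # w)) = e) =
    of_bool (inv_letter l = e) + length (filter (\<lambda>m. fst m = fst e) w)"
  using assms
proof (induction w arbitrary: l)
  case (Cons m w)
  let ?P = "\<lambda>(a, b). a = e \<or> b = e"
  have m: "m \<noteq> inv_letter l" "reduced_word (m # w)" using Cons.prems by (auto simp: reduced_word_Cons)
  have "fst m = fst e \<longleftrightarrow> m = e \<or> inv_letter m = e"
    using fst_eq_iff_letter[of m e] by (metis inv_letter_inv_letter)
  then have "of_bool (fst m = fst e) = (of_bool (m = e) + of_bool (inv_letter m = e) :: nat)"
    by (cases "m = e") simp_all
  then have "length (filter (\<lambda>m. fst m = fst e) (m # w)) =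
      of_bool (m = e) + of_bool (inv_letter m = e) + length (filter (\<lambda>m. fst m = fst e) w)"
    by (cases "fst m = fst e") simp_all
  moreover have "of_bool (inv_letter l = e \<or> m = e) = (of_bool (inv_letter l = e) + of_bool (m = e) :: nat)"
    using m(1) by (cases "m = e") simp_all
  then have "length (filter ?P (turns l (m # w))) =
      of_bool (inv_letter l = e) + of_bool (m = e) + length (filter ?P (turns m w))"
    by (cases "inv_letter l = e \<or> m = e") simp_all
  ultimately show ?case using Cons.IH[OF m(2)] by simp
qed simp

section \<open>Automorphisms of free groups\<close>

context free_group
begin

lemma primitive_iso:
  assumes "\<phi> \<in> iso F F" "x \<in> carrier F" "\<phi> x \<in> primitive_elements F"
  shows "x \<in> primitive_elements F"
proof -
  obtain C where C: "free_basis F C" "\<phi> x \<in> C"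
    using assms(3) by (auto simp: primitive_elements_def)
  interpret C: free_group F C using C(1) by unfold_locales
  have "free_basis F (inv_into (carrier F) \<phi> ` C)"
    by (rule C.free_basis_iso[OF iso_set_sym[OF assms(1)]])
  moreover have "inv_into (carrier F) \<phi> (\<phi> x) = x"
    using assms(1,2) by (simp add: iso_def bij_betw_def)
  ultimately show ?thesis using C(2) unfolding primitive_elements_def by force
qed

lemma separating_cut_iso:
  assumes \<phi>: "\<phi> \<in> iso F F" and x: "x \<in> carrier F" and \<kappa>: "separating_cut F x \<kappa>"
  shows "separating_cut F (\<phi> x) (\<kappa> \<circ> inv_into (carrier F) \<phi>)"
proof -
  let ?\<psi> = "inv_into (carrier F) \<phi>"
  have \<psi>: "?\<psi> \<in> iso F F" by (rule iso_set_sym[OF \<phi>])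
  then have hom: "?\<psi> \<in> hom F F" and bij: "bij_betw ?\<psi> (carrier F) (carrier F)"
    by (auto simp: iso_def)
  interpret \<psi>: group_hom F F ?\<psi> using hom by unfold_locales
  have "?\<psi> (\<phi> x) = x" and \<phi>x: "\<phi> x \<in> carrier F"
    using \<phi> x by (auto simp: iso_def bij_betw_def hom_def)
  moreover have "?\<psi> g = \<one> \<longleftrightarrow> g = \<one>" if "g \<in> carrier F" for g
    using bij that \<psi>.hom_one by (metis bij_betw_def inj_onD one_closed)
  ultimately have "(\<kappa> \<circ> ?\<psi>) (g \<otimes> \<phi> x) \<noteq> (\<kappa> \<circ> ?\<psi>) g \<longleftrightarrow> g = \<one>" if "g \<in> carrier F" for g
    using \<kappa> that \<psi>.hom_closed[OF that] by (simp add: separating_cut_def)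
  moreover have "finite {g \<in> carrier F. (\<kappa> \<circ> ?\<psi>) (g \<otimes> h) \<noteq> (\<kappa> \<circ> ?\<psi>) g}" if h: "h \<in> carrier F" for h
  proof -
    have "finite {g \<in> carrier F. \<kappa> (g \<otimes> ?\<psi> h) \<noteq> \<kappa> g}"
      using \<kappa> \<psi>.hom_closed[OF h] by (simp add: separating_cut_def)
    moreover have "inj_on ?\<psi> {g \<in> carrier F. (\<kappa> \<circ> ?\<psi>) (g \<otimes> h) \<noteq> (\<kappa> \<circ> ?\<psi>) g}"
      using bij by (auto simp: bij_betw_def intro: inj_on_subset)
    moreover have "?\<psi> ` {g \<in> carrier F. (\<kappa> \<circ> ?\<psi>) (g \<otimes> h) \<noteq> (\<kappa> \<circ> ?\<psi>) g} \<subseteq> {g \<in> carrier F. \<kappa> (g \<otimes> ?\<psi> h) \<noteq> \<kappa> g}"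
      using h by auto
    ultimately show ?thesis by (blast intro: finite_imageD dest: finite_subset)
  qed
  ultimately show ?thesis by (auto simp: separating_cut_def)
qed

lemma conjugation_iso:
  assumes "h \<in> carrier F"
  shows "(\<lambda>g. h \<otimes> g \<otimes> inv h) \<in> iso F F"
proof -
  have "(\<lambda>g. h \<otimes> g \<otimes> inv h) \<in> hom F F"
    using assms by (intro homI) (auto simp: m_assoc, simp add: m_assoc[symmetric])
  moreover have "bij_betw (\<lambda>g. h \<otimes> g \<otimes> inv h) (carrier F) (carrier F)"
    by (rule bij_betw_byWitness[where f' = "\<lambda>g. inv h \<otimes> g \<otimes> h"])
      (use assms in \<open>auto simp: m_assoc\<close>, auto simp: m_assoc[symmetric])
  ultimately show ?thesis by (simp add: iso_def)
qed

lemma extend_hom_iso: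
  assumes f: "f \<in> B \<rightarrow> carrier F" and f': "f' \<in> B \<rightarrow> carrier F"
    and "\<And>b. b \<in> B \<Longrightarrow> extend_hom F f' (f b) = b" "\<And>b. b \<in> B \<Longrightarrow> extend_hom F f (f' b) = b"
  shows "extend_hom F f \<in> iso F F"
proof -
  let ?\<phi> = "extend_hom F f" and ?\<psi> = "extend_hom F f'"
  have \<phi>: "?\<phi> \<in> hom F F" and \<psi>: "?\<psi> \<in> hom F F" using f f' extend_hom[OF is_group] by auto
  have id: "(\<lambda>g. g) \<in> hom F F" by (rule homI) auto
  have "(?\<psi> \<circ> ?\<phi>) g = g" if "g \<in> carrier F" for g
    by (rule hom_eq_on_basis[OF is_group Group.hom_compose[OF \<phi> \<psi>] id _ that])
      (use assms extend_hom_basis[OF is_group f] in auto)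
  moreover have "(?\<phi> \<circ> ?\<psi>) g = g" if "g \<in> carrier F" for g
    by (rule hom_eq_on_basis[OF is_group Group.hom_compose[OF \<psi> \<phi>] id _ that])
      (use assms extend_hom_basis[OF is_group f'] in auto)
  ultimately have "bij_betw ?\<phi> (carrier F) (carrier F)"
    using \<phi> \<psi> by (intro bij_betw_byWitness[where f' = ?\<psi>]) (auto simp: hom_def)
  with \<phi> show ?thesis by (simp add: iso_def)
qed

lemma extend_hom_fixes_word:
  assumes "f \<in> B \<rightarrow> carrier F" "fst ` set w \<subseteq> B" "\<And>b. b \<in> fst ` set w \<Longrightarrow> f b = b"
  shows "extend_hom F f (word_value F w) = word_value F w"
  using extend_hom_word[OF is_group assms(1,2)] word_eval_cong[of w f "\<lambda>x. x" F] assms(3)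
  by (simp add: word_value_eq_word_eval)

lemma primitive_if_letter_once:
  assumes w: "fst ` set u \<subseteq> B" "fst ` set v \<subseteq> B" "fst l \<in> B"
    and l: "fst l \<notin> fst ` set u" "fst l \<notin> fst ` set v"
  shows "word_value F (u @ l # v) \<in> primitive_elements F"
proof -
  obtain c s where c: "l = (c, s)" by (cases l)
  have cB: "c \<in> B" "c \<in> carrier F" using w(3) c B_carrier by auto
  let ?u = "word_value F u" and ?v = "word_value F v"
  have uv: "?u \<in> carrier F" "?v \<in> carrier F" using w by auto
  define x where "x = word_value F (u @ l # v)"
  have x: "x = ?u \<otimes> ((if s then c else inv c) \<otimes> ?v)"
    unfolding x_def using w c by (subst word_value_append) auto
  have xF: "x \<in> carrier F" using uv cB by (simp add: x)
  define y where "y = (if s then inv ?u \<otimes> c \<otimes> inv ?v else ?v \<otimes> inv c \<otimes> ?u)"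
  have yF: "y \<in> carrier F" using uv cB by (simp add: y_def)
  define f where "f b = (if b = c then x else b)" for b
  define f' where "f' b = (if b = c then y else b)" for b
  have f: "f \<in> B \<rightarrow> carrier F" and f': "f' \<in> B \<rightarrow> carrier F"
    using xF yF B_carrier by (auto simp: f_def f'_def)
  interpret \<phi>: group_hom F F "extend_hom F f" using extend_hom[OF is_group f] by unfold_locales
  interpret \<psi>: group_hom F F "extend_hom F f'" using extend_hom[OF is_group f'] by unfold_locales
  have fw: "extend_hom F f ?u = ?u" "extend_hom F f ?v = ?v" "extend_hom F f' ?u = ?u" "extend_hom F f' ?v = ?v"
    by (rule extend_hom_fixes_word; use f f' w l c in \<open>auto simp: f_def f'_def\<close>)+
  have c': "extend_hom F f c = x" "extend_hom F f' c = y"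
    using extend_hom_basis[OF is_group f cB(1)] extend_hom_basis[OF is_group f' cB(1)] by (auto simp: f_def f'_def)
  have "extend_hom F f' x = c"
    using uv cB by (simp add: x fw c') (auto simp: y_def inv_mult_group m_assoc, auto simp: m_assoc[symmetric])
  moreover have "extend_hom F f y = c"
    using uv cB by (simp add: y_def fw c') (auto simp: x inv_mult_group m_assoc, auto simp: m_assoc[symmetric])
  ultimately have "extend_hom F f \<in> iso F F"
    using extend_hom_basis[OF is_group f] extend_hom_basis[OF is_group f']
    by (intro extend_hom_iso[OF f f']) (auto simp: f_def f'_def)
  then have "free_basis F (extend_hom F f ` B)" by (rule free_basis_iso)
  moreover have "x \<in> extend_hom F f ` B" using c' cB by force
  ultimately show ?thesis unfolding primitive_elements_def x_def by blast
qed

end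

section \<open>Whitehead automorphisms\<close>

text \<open>For a set \<open>Z\<close> of letters that contains \<open>e\<close> but not its inverse, the Whitehead automorphism
  fixes \<open>e\<close> and multiplies any other letter by \<open>e\<close> on the left if \<open>Z\<close> contains the letter, and by
  the inverse of \<open>e\<close> on the right if \<open>Z\<close> contains the inverse of the letter. It acts on cyclic
  words by the deletion of all \<open>e\<close> and inverses of \<open>e\<close>, followed by the insertion of \<open>e\<close> or its
  inverse in all turns with just one direction in \<open>Z\<close>. The following function performs this on the
  word \<open>w\<close>; the letter \<open>l\<close> is the one before \<open>w\<close>.\<close>

fun whitehead_word :: "('a \<times> bool) set \<Rightarrow> 'a \<times> bool \<Rightarrow> 'a \<times> bool \<Rightarrow> ('a \<times> bool) list \<Rightarrow> ('a \<times> bool) list" where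
  "whitehead_word Z e l [] = []"
| "whitehead_word Z e l (m # w) =
     (if (inv_letter l \<in> Z) = (m \<in> Z) then [] else if m \<in> Z then [e] else [inv_letter e]) @
     (if fst m = fst e then [] else [m]) @ whitehead_word Z e m w"

lemma length_whitehead_word:
  "length (whitehead_word Z e l w) = length (filter (\<lambda>(a, b). (a \<in> Z) \<noteq> (b \<in> Z)) (turns l w)) +
    length (filter (\<lambda>m. fst m \<noteq> fst e) w)"
  by (induction l w rule: turns.induct) auto

lemma letters_whitehead_word: "fst ` set (whitehead_word Z e l w) \<subseteq> insert (fst e) (fst ` set w)"
  by (induction l w rule: turns.induct) auto

lemma length_whitehead_word_less:
  assumes less: "length (filter (\<lambda>(a, b). (a \<in> Z) \<noteq> (b \<in> Z)) (turns (last w) w)) <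
      length (filter (\<lambda>m. fst m = fst e) w)"
  shows "length (whitehead_word Z e (last w) w) < length w"
  using less sum_length_filter_compl[of "\<lambda>m. fst m = fst e" w] by (simp add: length_whitehead_word)

context free_group
begin

lemma whitehead_automorphism:
  assumes e: "e \<in> Z" "inv_letter e \<notin> Z" "fst e \<in> B"
  obtains \<phi> where "\<phi> \<in> iso F F"
    "\<And>l w. fst ` set w \<subseteq> B \<Longrightarrow> w \<noteq> [] \<Longrightarrow>
       \<exists>h\<in>carrier F. word_value F (whitehead_word Z e (last w) w) = h \<otimes> \<phi> (word_value F w) \<otimes> inv h"
proof -
  define a where "a = word_value F [e]"
  have aF: "a \<in> carrier F" using e by (simp add: a_def)
  have ae: "a = (if snd e then fst e else inv (fst e))" using e B_carrier by (cases e) (simp add: a_def)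
  \<comment> \<open>The image of a letter \<open>m\<close> is \<open>E m \<otimes> m \<otimes> inv (E (inv_letter m))\<close>, where \<open>m\<close> in the middle is
    omitted if it is \<open>e\<close> or its inverse. In the image of a word the factors \<open>E\<close> cancel in all turns
    that do not cross \<open>Z\<close>.\<close>
  define E where "E l = (if l \<in> Z then a else \<one>)" for l
  have EF: "E l \<in> carrier F" for l using aF by (simp add: E_def)
  define f where "f b = (if b = fst e then b else E (b, True) \<otimes> b \<otimes> inv (E (b, False)))" for b
  define f' where "f' b = (if b = fst e then b else inv (E (b, True)) \<otimes> b \<otimes> E (b, False))" for b
  have f: "f \<in> B \<rightarrow> carrier F" and f': "f' \<in> B \<rightarrow> carrier F"
    using EF B_carrier by (auto simp: f_def f'_def)
  let ?\<phi> = "extend_hom F f"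
  interpret \<phi>: group_hom F F ?\<phi> using extend_hom[OF is_group f] by unfold_locales
  interpret \<psi>: group_hom F F "extend_hom F f'" using extend_hom[OF is_group f'] by unfold_locales
  have fixa: "?\<phi> a = a" "extend_hom F f' a = a"
    unfolding a_def using f f' e by (auto intro!: extend_hom_fixes_word simp: f_def f'_def)
  have fixE: "?\<phi> (E l) = E l" "extend_hom F f' (E l) = E l" for l
    by (simp_all add: E_def fixa)
  have inv1: "extend_hom F f' (f b) = b" "?\<phi> (f' b) = b" if b: "b \<in> B" for b
  proof -
    have "b \<in> carrier F" "f b \<in> carrier F" "f' b \<in> carrier F" using b B_carrier f f' by auto
    then show "extend_hom F f' (f b) = b" "?\<phi> (f' b) = b"
      using extend_hom_basis[OF is_group f b] extend_hom_basis[OF is_group f' b] EF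
      by (auto simp: f_def f'_def fixE m_assoc, auto simp: m_assoc[symmetric] f_def f'_def)
  qed
  have iso: "?\<phi> \<in> iso F F" using inv1 by (intro extend_hom_iso[OF f f']) auto
  have letter: "?\<phi> (word_value F [m]) =
      E m \<otimes> word_value F (if fst m = fst e then [] else [m]) \<otimes> inv (E (inv_letter m))"
    if m: "fst m \<in> B" for m
  proof (cases "fst m = fst e")
    case True
    then consider "m = e" | "m = inv_letter e" using fst_eq_iff_letter by metis
    then show ?thesis
    proof cases
      case 1
      then show ?thesis using e aF fixa(1) by (simp add: E_def a_def[symmetric])
    next
      case 2
      have "word_value F [inv_letter e] = inv a"
        using word_value_inv_word[of "[e]"] e by (simp add: inv_word_def a_def)
      then show ?thesis using 2 e aF fixa(1) by (simp add: E_def)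
    qed
  next
    case False
    obtain b s where bs: "m = (b, s)" by (cases m)
    have b: "b \<in> B" "b \<in> carrier F" using m bs B_carrier by auto
    have "?\<phi> b = E (b, True) \<otimes> b \<otimes> inv (E (b, False))"
      using extend_hom_basis[OF is_group f b(1)] False bs by (simp add: f_def)
    then show ?thesis using bs b EF False by (cases s) (simp_all add: inv_mult_group m_assoc)
  qed
  have word: "word_value F (whitehead_word Z e l w) =
      inv (E (inv_letter l)) \<otimes> ?\<phi> (word_value F w) \<otimes> E (inv_letter (last (l # w)))"
    if "fst ` set w \<subseteq> B" for l w
    using that
  proof (induction w arbitrary: l)
    case Nil
    then show ?case using EF by simp
  next
    case (Cons m w)
    let ?t = "if (inv_letter l \<in> Z) = (m \<in> Z) then [] else if m \<in> Z then [e] else [inv_letter e]"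
    let ?m = "if fst m = fst e then [] else [m]"
    have m: "fst m \<in> B" and w: "fst ` set w \<subseteq> B" using Cons.prems by auto
    have t: "word_value F ?t = inv (E (inv_letter l)) \<otimes> E m"
      using aF e word_value_inv_word[of "[e]"] by (auto simp: E_def inv_word_def a_def)
    have F: "word_value F ?m \<in> carrier F" "?\<phi> (word_value F w) \<in> carrier F" using m w by auto
    have wh: "fst ` set (whitehead_word Z e m w) \<subseteq> B"
      by (rule order_trans[OF letters_whitehead_word]) (use w e(3) in simp)
    have "word_value F (whitehead_word Z e l (m # w)) =
        word_value F ?t \<otimes> (word_value F ?m \<otimes> word_value F (whitehead_word Z e m w))"
      using m w e wh
      by (simp only: whitehead_word.simps) (subst word_value_append; (subst word_value_append)?; auto)
    also have "\<dots> = inv (E (inv_letter l)) \<otimes> (E m \<otimes> word_value F ?m \<otimes> inv (E (inv_letter m)) \<otimes>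
        ?\<phi> (word_value F w)) \<otimes> E (inv_letter (last (m # w)))"
      unfolding t Cons.IH[OF w] using EF F by (simp add: m_assoc)
    also have "E m \<otimes> word_value F ?m \<otimes> inv (E (inv_letter m)) \<otimes> ?\<phi> (word_value F w) =
        ?\<phi> (word_value F [m] \<otimes> word_value F w)"
      using letter[OF m] m w by simp
    also have "word_value F [m] \<otimes> word_value F w = word_value F (m # w)"
      using word_value_append[of "[m]" w] m w by simp
    finally show ?case by simp
  qed
  show thesis
  proof (rule that[OF iso])
    fix w :: "('a \<times> bool) list"
    assume w: "fst ` set w \<subseteq> B" "w \<noteq> []"
    then show "\<exists>h\<in>carrier F. word_value F (whitehead_word Z e (last w) w) = h \<otimes> ?\<phi> (word_value F w) \<otimes> inv h"
      using word[OF w(1), of "last w"] EF by (intro bexI[of _ "inv (E (inv_letter (last w)))"]) auto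
  qed
qed

end

section \<open>Whitehead graphs of elements with a separating cut\<close>

context free_group
begin

lemma word_value_word_power:
  "fst ` set w \<subseteq> B \<Longrightarrow> word_value F (word_power w n) = word_value F w [^] n"
proof (induction n)
  case (Suc n)
  have "fst ` set (word_power w n) \<subseteq> B" using set_word_power[of w n] Suc.prems by blast
  then have "word_value F (word_power w (Suc n)) = word_value F w \<otimes> word_value F w [^] n"
    using Suc by (simp add: word_power_Suc word_value_append)
  then show ?case using nat_pow_Suc2[OF word_value_closed[OF Suc.prems], of n] by simp
qed simp

lemma power_eq_one_cyclically_reduced:
  assumes "cyclically_reduced w" "fst ` set w \<subseteq> B" "word_value F w [^] (n :: nat) = \<one>"
  shows "n = 0"
proof -
  have "fst ` set (word_power w n) \<subseteq> B" using set_word_power[of w n] assms(2) by blast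
  then have "word_power w n = []"
    using word_value_inject[of "word_power w n" "[]"] reduced_word_power[OF assms(1)] assms
    by (simp add: word_value_word_power)
  then show ?thesis using assms(1) by (simp add: cyclically_reduced_iff)
qed

end

text \<open>The element \<open>x\<close> is the value of a cyclically reduced word \<open>w\<close> and has a separating cut. All
  reduced words below use only the generators that occur in \<open>w\<close>. Beyond the \<open>n\<close>-th level of the
  tree the colour does not change any more along an edge, nor under right translation by the
  inverse of a prefix of \<open>w\<close>.\<close>

locale cut_word = free_group F B for F (structure) and B +
  fixes w \<kappa> n
  assumes cyc: "cyclically_reduced w" and letters: "fst ` set w \<subseteq> B"
    and cut: "separating_cut F (word_value F w) \<kappa>"
    and stable: "\<And>u h. fst ` set u \<subseteq> fst ` set w \<Longrightarrow> reduced_word u \<Longrightarrow> n \<le> length u \<Longrightarrow>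
      h \<in> (\<lambda>l. word_value F [l]) ` (fst ` set w \<times> UNIV) \<union> (\<lambda>i. inv (word_value F (take i w))) ` {..length w} \<Longrightarrow>
      \<kappa> (word_value F u \<otimes> h) = \<kappa> (word_value F u)"
begin

text \<open>The vertices of the tree of reduced words in the generators that occur in \<open>w\<close>.\<close>

definition vertex :: "('a \<times> bool) list \<Rightarrow> bool" where
  "vertex u \<longleftrightarrow> fst ` set u \<subseteq> fst ` set w \<and> reduced_word u"

text \<open>All vertices from the \<open>n\<close>-th level on in the branch of the tree beyond \<open>u\<close> have colour \<open>c\<close>.\<close>

definition mono :: "('a \<times> bool) list \<Rightarrow> bit \<Rightarrow> bool" where
  "mono u c \<longleftrightarrow> (\<forall>t. vertex (u @ t) \<longrightarrow> n \<le> length (u @ t) \<longrightarrow> \<kappa> (word_value F (u @ t)) = c)"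

lemma mono_vertex:
  assumes "mono (u @ [l]) c" "vertex (u @ t)" "t \<noteq> []" "hd t = l" "n \<le> length (u @ t)"
  shows "\<kappa> (word_value F (u @ t)) = c"
proof -
  have "u @ t = (u @ [l]) @ tl t" using assms(3,4) by (cases t) auto
  then show ?thesis using assms unfolding mono_def by metis
qed

abbreviation x :: 'a where "x \<equiv> word_value F w"

lemma xF [simp]: "x \<in> carrier F" using letters by simp

lemma w_ne: "w \<noteq> []" using cyc by (simp add: cyclically_reduced_iff)

lemma vertex_letters: "vertex u \<Longrightarrow> fst ` set u \<subseteq> B"
  using letters unfolding vertex_def by (meson order_trans)

lemma flip: "g \<in> carrier F \<Longrightarrow> \<kappa> (g \<otimes> x) \<noteq> \<kappa> g \<longleftrightarrow> g = \<one>"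
  using cut by (simp add: separating_cut_def)

lemma power_Suc_neq_one: "x [^] Suc i \<noteq> \<one>"
  using power_eq_one_cyclically_reduced[OF cyc letters, of "Suc i"] by blast

text \<open>The line of \<open>x\<close> itself has different colours at its two ends.\<close>

lemma not_mono_Nil: "\<not> mono [] c"
proof
  assume m: "mono [] c"
  have w1: "1 \<le> length w" using w_ne by (cases w) auto
  have len: "n \<le> Suc n * length w"
    using mult_le_mono2[OF w1, of "Suc n"] by simp
  have br: "vertex (word_power w (Suc n))" "vertex (inv_word (word_power w (Suc n)))"
    using set_word_power[of w "Suc n"] reduced_word_power[OF cyc] by (auto simp: vertex_def)
  have "\<kappa> (x [^] Suc n) = c" "\<kappa> (inv (x [^] Suc n)) = c"
    using m[unfolded mono_def, rule_format, of "word_power w (Suc n)"]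
      m[unfolded mono_def, rule_format, of "inv_word (word_power w (Suc n))"] br len
      word_value_word_power[OF letters, of "Suc n"] word_value_inv_word[OF vertex_letters[OF br(1)]]
    by (simp_all del: nat_pow_Suc)
  moreover have "\<kappa> (x [^] Suc i) = \<kappa> x" for i
  proof (induction i)
    case (Suc i)
    then show ?case using flip[of "x [^] Suc i"] power_Suc_neq_one[of i] by simp
  qed simp
  moreover have "\<kappa> (inv (x [^] i)) = \<kappa> \<one>" for i :: nat
  proof (induction i)
    case (Suc i)
    have "inv (x [^] Suc i) \<otimes> x = inv (x [^] i)"
      by (simp only: nat_pow_Suc2[OF xF]) (simp add: inv_mult_group m_assoc)
    moreover have "inv (x [^] Suc i) \<noteq> \<one>"
      using power_Suc_neq_one[of i] by (metis inv_inv inv_one nat_pow_closed xF)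
    ultimately show ?case using flip[of "inv (x [^] Suc i)"] Suc by simp
  qed simp
  moreover have "\<kappa> x \<noteq> \<kappa> \<one>" using flip[of \<one>] by simp
  ultimately show False by metis
qed

lemma mono_long:
  assumes "vertex u" "n \<le> length u"
  shows "mono u (\<kappa> (word_value F u))"
  unfolding mono_def
proof (intro allI impI)
  fix t assume "vertex (u @ t)"
  then show "\<kappa> (word_value F (u @ t)) = \<kappa> (word_value F u)"
  proof (induction t rule: rev_induct)
    case (snoc l t)
    have br: "vertex (u @ t)" using snoc.prems by (auto simp: vertex_def reduced_word_append)
    have l: "fst l \<in> fst ` set w" using snoc.prems by (auto simp: vertex_def)
    have "word_value F ((u @ t) @ [l]) = word_value F (u @ t) \<otimes> word_value F [l]"
      using vertex_letters[OF br] l letters by (intro word_value_append) auto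
    moreover have "\<kappa> (word_value F (u @ t) \<otimes> word_value F [l]) = \<kappa> (word_value F (u @ t))"
    proof (rule stable)
      show "word_value F [l] \<in> (\<lambda>l. word_value F [l]) ` (fst ` set w \<times> UNIV) \<union>
          (\<lambda>i. inv (word_value F (take i w))) ` {..length w}"
        by (rule UnI1, rule image_eqI[of _ _ l]) (use l in \<open>simp_all add: mem_Times_iff\<close>)
    qed (use br assms(2) in \<open>auto simp: vertex_def\<close>)
    ultimately show ?case using snoc.IH[OF br] by simp
  qed simp
qed

text \<open>If a translate of the line of \<open>x\<close> goes through a vertex \<open>u\<close> and leaves it in branches of
  different colours, then it is the line of \<open>x\<close> itself, so that \<open>u\<close> is a power of \<open>x\<close> followed by a
  prefix of \<open>w\<close>. Unless \<open>u\<close> is the root, the line then leaves \<open>u\<close> towards the root, but that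
  direction is excluded.\<close>

lemma bicoloured_turn:
  assumes w: "w = p @ q" "q \<noteq> []" and u: "vertex u"
    and y: "vertex (u @ [hd q])" "mono (u @ [hd q]) c"
    and y': "vertex (u @ [inv_letter (last (q @ p))])" "mono (u @ [inv_letter (last (q @ p))]) d"
    and cd: "c \<noteq> d"
  shows "u = [] \<and> p = []"
proof -
  define r where "r = q @ p"
  define N where "N = Suc n"
  have r: "cyclically_reduced r" "r \<noteq> []" "hd r = hd q"
    using cyc cyclically_reduced_rotate[of p q] w by (auto simp: r_def)
  have set_r: "set r = set w" by (auto simp: r_def w)
  have rB: "fst ` set r \<subseteq> B" using letters set_r by simp
  have pq: "fst ` set p \<subseteq> B" "fst ` set q \<subseteq> B" using letters w by auto
  have uB: "fst ` set u \<subseteq> B" by (rule vertex_letters[OF u])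
  define P Q U where "P = word_value F p" and "Q = word_value F q" and "U = word_value F u"
  have [simp]: "P \<in> carrier F" "Q \<in> carrier F" "U \<in> carrier F" using pq uB by (simp_all add: P_def Q_def U_def)
  have xPQ: "x = P \<otimes> Q" and rQP: "word_value F r = Q \<otimes> P"
    using pq by (simp_all add: w r_def P_def Q_def word_value_append)
  have conj: "(Q \<otimes> P) [^] i \<otimes> inv P = inv P \<otimes> x [^] i" for i :: nat
  proof (induction i)
    case (Suc i)
    have "(Q \<otimes> P) [^] Suc i \<otimes> inv P = (Q \<otimes> P) \<otimes> ((Q \<otimes> P) [^] i \<otimes> inv P)"
      by (simp only: nat_pow_Suc2[OF m_closed[OF \<open>Q \<in> carrier F\<close> \<open>P \<in> carrier F\<close>]]) (simp add: m_assoc)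
    also have "\<dots> = Q \<otimes> x [^] i" unfolding Suc.IH by (simp add: m_assoc) (simp add: m_assoc[symmetric])
    also have "\<dots> = inv P \<otimes> (x \<otimes> x [^] i)" by (simp add: xPQ m_assoc[symmetric])
    finally show ?case by (simp only: nat_pow_Suc2[OF xF])
  qed simp
  have len: "n \<le> N * length r" using r(2) by (cases r) (auto simp: N_def)
  have prefix: "inv P \<in> (\<lambda>i. inv (word_value F (take i w))) ` {..length w}"
    by (rule image_eqI[of _ _ "length p"]) (auto simp: w P_def)
  define g where "g = U \<otimes> inv P"
  have [simp]: "g \<in> carrier F" by (simp add: g_def)
  have ends: "\<kappa> (g \<otimes> x [^] N) = c \<and> \<kappa> (g \<otimes> inv (x [^] N)) = d"
  proof
    let ?v = "word_power r N"
    have N: "0 < N" by (simp add: N_def)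
    have v: "fst ` set ?v \<subseteq> fst ` set w" "reduced_word ?v" "?v \<noteq> []" "hd ?v = hd q" "last ?v = last r"
      using image_mono[OF set_word_power[of r N], of fst] set_r reduced_word_power[OF r(1), of N]
        hd_word_power[OF r(2) N] last_word_power[OF r(2) N] r(2,3) N
      by simp_all
    have vB: "fst ` set ?v \<subseteq> B" using v(1) letters by blast
    have vval: "word_value F ?v = (Q \<otimes> P) [^] N" using word_value_word_power[OF rB] rQP by simp
    have br: "vertex (u @ ?v)"
      using y(1) u v by (auto simp: vertex_def reduced_word_append)
    have "\<kappa> (word_value F (u @ ?v)) = c"
      by (rule mono_vertex[OF y(2) br v(3,4)]) (use len in simp)
    moreover have "\<kappa> (word_value F (u @ ?v) \<otimes> inv P) = \<kappa> (word_value F (u @ ?v))"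
      using br len prefix by (intro stable) (auto simp: vertex_def)
    moreover have "word_value F (u @ ?v) \<otimes> inv P = g \<otimes> x [^] N"
      using conj[of N] by (simp add: word_value_append[OF uB vB] vval g_def U_def[symmetric] m_assoc)
    ultimately show "\<kappa> (g \<otimes> x [^] N) = c" by simp
    let ?v' = "inv_word ?v"
    have v': "fst ` set ?v' \<subseteq> fst ` set w" "reduced_word ?v'" "?v' \<noteq> []" "hd ?v' = inv_letter (last r)"
      using v hd_inv_word[of ?v] by auto
    have v'B: "fst ` set ?v' \<subseteq> B" using v'(1) letters by blast
    have br': "vertex (u @ ?v')"
    proof -
      have "u \<noteq> [] \<longrightarrow> inv_letter (last r) \<noteq> inv_letter (last u)"
        using y'(1) by (auto simp: vertex_def reduced_word_append r_def)
      then show ?thesis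
        using u v' unfolding vertex_def reduced_word_append set_append image_Un by simp
    qed
    have "\<kappa> (word_value F (u @ ?v')) = d"
      by (rule mono_vertex[OF y'(2) br' v'(3)]) (use len v'(4) in \<open>simp_all add: r_def\<close>)
    moreover have "\<kappa> (word_value F (u @ ?v') \<otimes> inv P) = \<kappa> (word_value F (u @ ?v'))"
      using br' len prefix by (intro stable) (auto simp: vertex_def)
    moreover have "inv ((Q \<otimes> P) [^] N) \<otimes> inv P = inv P \<otimes> inv (x [^] N)"
    proof -
      have "P \<otimes> (Q \<otimes> P) [^] N = x [^] N \<otimes> P"
      proof -
        have "P \<otimes> ((Q \<otimes> P) [^] N \<otimes> inv P) \<otimes> P = P \<otimes> (inv P \<otimes> x [^] N) \<otimes> P" by (simp only: conj)
        then show ?thesis by (simp add: m_assoc) (simp add: m_assoc[symmetric])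
      qed
      then have "inv (P \<otimes> (Q \<otimes> P) [^] N) = inv (x [^] N \<otimes> P)" by simp
      then show ?thesis by (simp add: inv_mult_group)
    qed
    then have "word_value F (u @ ?v') \<otimes> inv P = g \<otimes> inv (x [^] N)"
      by (simp add: word_value_append[OF uB v'B] word_value_inv_word[OF vB] vval g_def U_def[symmetric] m_assoc)
    ultimately show "\<kappa> (g \<otimes> inv (x [^] N)) = d" by simp
  qed
  \<comment> \<open>Along the line through \<open>g\<close>, from its \<open>d\<close>-coloured end to its \<open>c\<close>-coloured end, the colour
    changes somewhere; hence the line goes through \<open>\<one>\<close>.\<close>
  define f where "f i = \<kappa> (g \<otimes> inv (x [^] N) \<otimes> x [^] i)" for i :: nat
  have f0: "f 0 = d" using ends by (simp add: f_def)
  have "x [^] (N + N) = x [^] N \<otimes> x [^] N" by (simp add: nat_pow_mult)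
  then have fN: "f (N + N) = c" using ends by (simp add: f_def m_assoc) (simp add: m_assoc[symmetric])
  have "\<exists>i. f (Suc i) \<noteq> f i"
  proof (rule ccontr)
    assume "\<nexists>i. f (Suc i) \<noteq> f i"
    then have "f i = f 0" for i by (induction i) auto
    then show False using f0 fN cd by metis
  qed
  then obtain i where "f (Suc i) \<noteq> f i" by blast
  then have "\<kappa> (g \<otimes> inv (x [^] N) \<otimes> x [^] i \<otimes> x) \<noteq> \<kappa> (g \<otimes> inv (x [^] N) \<otimes> x [^] i)"
    by (simp add: f_def m_assoc)
  then have "g \<otimes> inv (x [^] N) \<otimes> x [^] i = \<one>" using flip by simp
  then have "g \<otimes> inv (x [^] N) = inv (x [^] i)" by (intro inv_equality[symmetric]) auto
  then have "g \<otimes> inv (x [^] N) \<otimes> x [^] N = inv (x [^] i) \<otimes> x [^] N" by simp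
  then have g: "g = inv (x [^] i) \<otimes> x [^] N" by (simp add: m_assoc)
  have "g \<otimes> P = U" by (simp add: g_def m_assoc)
  show ?thesis
  proof (cases "i \<le> N")
    case True
    define a where "a = N - i"
    have "x [^] N = x [^] i \<otimes> x [^] a" using True by (simp add: nat_pow_mult a_def)
    then have "U = x [^] a \<otimes> P" using \<open>g \<otimes> P = U\<close> by (simp add: g) (simp add: m_assoc[symmetric])
    have br: "reduced_word (word_power w a @ p)"
    proof -
      have "word_power w (Suc a) = word_power w a @ w"
        by (induction a) (simp_all add: word_power_Suc)
      then have "reduced_word ((word_power w a @ p) @ q)"
        using reduced_word_power[OF cyc, of "Suc a"] w(1) by simp
      then show ?thesis unfolding reduced_word_append[of _ q] by blast
    qed
    have lB: "fst ` set (word_power w a) \<subseteq> B" using set_word_power[of w a] letters by blast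
    have "U = word_value F (word_power w a @ p)"
      using \<open>U = x [^] a \<otimes> P\<close> pq lB by (simp add: word_value_append word_value_word_power[OF letters] P_def)
    then have ua: "u = word_power w a @ p"
      using word_value_inject[OF uB _ _ br] u lB pq by (auto simp: U_def vertex_def)
    show ?thesis
    proof (cases "u = []")
      case False
      have "last u = last (q @ p)"
      proof (cases "p = []")
        case True
        then have "0 < a" using ua False by (cases a) auto
        then show ?thesis using ua True w last_word_power[OF w_ne] by simp
      qed (simp add: ua)
      then show ?thesis using y'(1) False by (auto simp: vertex_def reduced_word_append)
    qed (use ua in simp)
  next
    case False
    define a where "a = i - N - 1"
    have "x [^] i = x [^] N \<otimes> x [^] Suc a" using False by (simp only: nat_pow_mult[OF xF]) (simp add: a_def)
    then have "g = inv (x [^] Suc a)" by (simp add: g inv_mult_group m_assoc del: nat_pow_Suc)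
    have br: "reduced_word (q @ word_power w a)"
      using reduced_word_power[OF cyc, of "Suc a"] by (simp add: word_power_Suc) (simp add: w reduced_word_append)
    have lB: "fst ` set (word_power w a) \<subseteq> B" using set_word_power[of w a] letters by blast
    have "U = inv (x [^] Suc a) \<otimes> P" using \<open>g \<otimes> P = U\<close> \<open>g = inv (x [^] Suc a)\<close> by simp
    also have "\<dots> = inv (x [^] a) \<otimes> inv Q"
      by (simp only: nat_pow_Suc2[OF xF]) (simp add: xPQ inv_mult_group m_assoc)
    also have "\<dots> = word_value F (inv_word (q @ word_power w a))"
      using pq lB by (simp add: inv_word_append word_value_append word_value_inv_word word_value_word_power[OF letters] Q_def)
    finally have "word_value F u = word_value F (inv_word (q @ word_power w a))" by (simp add: U_def)
    then have "u = inv_word (q @ word_power w a)"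
      using u br lB pq by (intro word_value_inject[OF uB]) (simp_all add: vertex_def image_Un)
    then have "u \<noteq> []" "last u = inv_letter (hd q)"
      using w(2) last_inv_word[of "q @ word_power w a"] by auto
    then show ?thesis using y(1) by (auto simp: vertex_def reduced_word_append)
  qed
qed

text \<open>At a deepest vertex \<open>u\<close> whose branch is not of one colour, the colours divide the directions
  away from the root.\<close>

lemma coloured_directions:
  obtains u C D where "vertex u" "C \<noteq> {}" "D \<noteq> {}" "C \<inter> D = {}"
    "C \<union> D = {l. fst l \<in> fst ` set w \<and> (u = [] \<or> l \<noteq> inv_letter (last u))}"
    "\<And>p q. w = p @ q \<Longrightarrow> q \<noteq> [] \<Longrightarrow> u \<noteq> [] \<or> p \<noteq> [] \<Longrightarrow>
       \<not> (inv_letter (last (q @ p)) \<in> C \<and> hd q \<in> D) \<and> \<not> (inv_letter (last (q @ p)) \<in> D \<and> hd q \<in> C)"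
proof -
  let ?P = "\<lambda>u. vertex u \<and> (\<forall>c. \<not> mono u c)"
  have "vertex []" by (simp add: vertex_def)
  then have "?P []" using not_mono_Nil by blast
  moreover have "\<forall>u. ?P u \<longrightarrow> length u < n" using mono_long by (meson not_le)
  ultimately obtain u where u: "?P u" and max: "\<And>v. ?P v \<Longrightarrow> length v \<le> length u"
    using ex_has_greatest_nat[of ?P "[]" length n] by blast
  let ?L = "{l. vertex (u @ [l])}"
  define C where "C = {l \<in> ?L. mono (u @ [l]) 1}"
  define D where "D = {l \<in> ?L. \<not> mono (u @ [l]) 1}"
  have D: "mono (u @ [l]) 0" if "l \<in> D" for l
  proof -
    have "\<not> ?P (u @ [l])" using max[of "u @ [l]"] by auto
    moreover have "vertex (u @ [l])" using that by (simp add: D_def)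
    ultimately obtain c where "mono (u @ [l]) c" by blast
    then show ?thesis using that by (cases c) (auto simp: D_def)
  qed
  have all: "mono u c" if "\<And>l. l \<in> ?L \<Longrightarrow> mono (u @ [l]) c" for c
    unfolding mono_def
  proof (intro allI impI)
    fix t assume t: "vertex (u @ t)" "n \<le> length (u @ t)"
    show "\<kappa> (word_value F (u @ t)) = c"
    proof (cases t)
      case Nil
      then show ?thesis using t(2) u mono_long[of u] by auto
    next
      case (Cons l s)
      then have "u @ t = (u @ [l]) @ s" by simp
      moreover have "vertex (u @ [l])" using t(1) Cons by (auto simp: vertex_def reduced_word_append)
      ultimately show ?thesis using that[of l] t unfolding mono_def by (metis mem_Collect_eq)
    qed
  qed
  have L: "?L = {l. fst l \<in> fst ` set w \<and> (u = [] \<or> l \<noteq> inv_letter (last u))}"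
    using u by (auto simp: vertex_def reduced_word_append reduced_word_Cons)
  show thesis
  proof (rule that[of u C D])
    show "vertex u" using u by blast
    show "C \<noteq> {}" using all[of 0] u D by (auto simp: C_def D_def)
    show "D \<noteq> {}" using all[of 1] u by (auto simp: D_def)
    show "C \<inter> D = {}" by (auto simp: C_def D_def)
    show "C \<union> D = {l. fst l \<in> fst ` set w \<and> (u = [] \<or> l \<noteq> inv_letter (last u))}"
      using L by (auto simp: C_def D_def)
    fix p q assume w: "w = p @ q" "q \<noteq> []" "u \<noteq> [] \<or> p \<noteq> []"
    let ?a = "inv_letter (last (q @ p))" and ?b = "hd q"
    note turn = bicoloured_turn[OF w(1,2) conjunct1[OF u]]
    show "\<not> (?a \<in> C \<and> ?b \<in> D) \<and> \<not> (?a \<in> D \<and> ?b \<in> C)"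
    proof (intro conjI notI; elim conjE)
      assume "?a \<in> C" "?b \<in> D"
      then show False using turn[of 0 1] D[of ?b] w(3) by (simp add: C_def D_def)
    next
      assume "?a \<in> D" "?b \<in> C"
      then show False using turn[of 1 0] D[of ?a] w(3) by (simp add: C_def D_def)
    qed
  qed
qed

end

section \<open>Reduction of the length of a word\<close>

lemma length_filter_strict_mono:
  assumes "\<And>t. t \<in> set ts \<Longrightarrow> P t \<Longrightarrow> Q t" "t \<in> set ts" "Q t" "\<not> P t"
  shows "length (filter P ts) < length (filter Q ts)"
proof -
  have le: "length (filter P us) \<le> length (filter Q us)" if "\<And>t. t \<in> set us \<Longrightarrow> P t \<Longrightarrow> Q t" for us
    using that by (induction us) (auto intro: le_SucI)
  obtain us vs where ts: "ts = us @ t # vs" using split_list[OF assms(2)] by blast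
  have "length (filter P us) \<le> length (filter Q us)" "length (filter P vs) \<le> length (filter Q vs)"
    using assms(1) ts by (auto intro!: le)
  then show ?thesis using ts assms(3,4) by simp
qed

lemma turns_same_side:
  assumes "\<And>a b. (a, b) \<in> set (turns l w) \<Longrightarrow> a \<in> C \<longleftrightarrow> b \<in> C" "\<And>c. inv_letter c \<in> C \<longleftrightarrow> c \<in> C" "m \<in> set w"
  shows "m \<in> C \<longleftrightarrow> l \<in> C"
  using assms(1,3)
proof (induction l w rule: turns.induct)
  case (2 l k w)
  have "k \<in> C \<longleftrightarrow> l \<in> C" using 2(2)[of "inv_letter l" k] assms(2) by simp
  then show ?case using 2 by auto
qed simp

context cut_word
begin

text \<open>The directions at a vertex.\<close>

abbreviation L :: "('a \<times> bool) set" where "L \<equiv> {l. fst l \<in> fst ` set w}"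

text \<open>Some Whitehead automorphism shortens the cyclic word \<open>w\<close>.\<close>

abbreviation reducible :: bool where
  "reducible \<equiv> \<exists>Z e. e \<in> Z \<and> inv_letter e \<notin> Z \<and> fst e \<in> B \<and>
     length (filter (\<lambda>(a, b). (a \<in> Z) \<noteq> (b \<in> Z)) (turns (last w) w)) < length (filter (\<lambda>m. fst m = fst e) w)"

lemma turns_w: "turns (last w) w = (inv_letter (last w), hd w) # turns (hd w) (tl w)"
  using w_ne by (cases w) auto

text \<open>A set \<open>C\<close> of directions that is crossed by at most one turn of the line, the first one. If
  \<open>C\<close> were closed under inversion, then all letters of \<open>w\<close> would be on the same side of \<open>C\<close>, but all
  generators considered occur in \<open>w\<close>. Hence
  there is \<open>c\<close> in \<open>C\<close> with inverse outside of \<open>C\<close>: either \<open>c\<close> occurs just once in \<open>w\<close>, or the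
  Whitehead automorphism of \<open>C\<close> and \<open>c\<close> shortens \<open>w\<close>.\<close>

lemma one_crossing:
  assumes C: "C \<subseteq> L" "C \<noteq> {}" "C \<noteq> L"
    and cross: "\<And>a b. (a, b) \<in> set (turns (hd w) (tl w)) \<Longrightarrow> a \<in> C \<longleftrightarrow> b \<in> C"
  shows "x \<in> primitive_elements F \<or> reducible"
proof (cases "\<forall>c\<in>C. inv_letter c \<in> C")
  case True
  then have inv: "inv_letter c \<in> C \<longleftrightarrow> c \<in> C" for c by (metis inv_letter_inv_letter)
  have side: "m \<in> C \<longleftrightarrow> hd w \<in> C" if "m \<in> set w" for m
  proof (cases "m = hd w")
    case False
    then have m: "m \<in> set (tl w)" using that w_ne by (cases w) auto
    show ?thesis by (rule turns_same_side[of "hd w" "tl w" C m]) (use cross inv m in auto)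
  qed simp
  have "l \<in> C \<longleftrightarrow> hd w \<in> C" if l: "l \<in> L" for l
  proof -
    have "fst l \<in> fst ` set w" using l by simp
    then obtain m where "m \<in> set w" "fst m = fst l" by (metis imageE)
    then show ?thesis using side[of m] inv[of l] fst_eq_iff_letter[of m l] by metis
  qed
  then have False using C by blast
  then show ?thesis ..
next
  case False
  then obtain c where c: "c \<in> C" "inv_letter c \<notin> C" by blast
  have cL: "fst c \<in> fst ` set w" using c(1) C(1) by auto
  have "filter (\<lambda>(a, b). (a \<in> C) \<noteq> (b \<in> C)) (turns (hd w) (tl w)) = []"
    using cross by (auto simp: filter_empty_conv)
  then have one: "length (filter (\<lambda>(a, b). (a \<in> C) \<noteq> (b \<in> C)) (turns (last w) w)) \<le> 1"
    by (simp add: turns_w)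
  obtain m where m: "m \<in> set w" "fst m = fst c" using cL by force
  then have "filter (\<lambda>m. fst m = fst c) w \<noteq> []" by (auto simp: filter_empty_conv)
  then obtain l ls where ls: "filter (\<lambda>m. fst m = fst c) w = l # ls" by (meson neq_Nil_conv)
  show ?thesis
  proof (cases ls)
    case Nil
    obtain u v where uv: "w = u @ l # v" "\<forall>m\<in>set u. fst m \<noteq> fst c" "fst l = fst c"
        "[] = filter (\<lambda>m. fst m = fst c) v"
      using ls Nil by (auto simp: filter_eq_Cons_iff)
    then have "fst l \<notin> fst ` set u" "fst l \<notin> fst ` set v"
      by (auto simp: filter_empty_conv eq_commute[of "[]"])
    then have "x \<in> primitive_elements F"
      using primitive_if_letter_once[of u v l] letters unfolding uv(1) by (simp add: image_Un)
    then show ?thesis ..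
  next
    case (Cons k ks)
    have "fst c \<in> B" using cL letters by blast
    moreover have "1 < length (filter (\<lambda>m. fst m = fst c) w)" using ls Cons by simp
    ultimately show ?thesis using one c by (intro disjI2 exI[of _ C] exI[of _ c] conjI) auto
  qed
qed

text \<open>Let \<open>u\<close> be the vertex of \<open>coloured_directions\<close>. If \<open>u\<close> is the root, then \<open>one_crossing\<close> applies
  to \<open>C\<close>. If not, then \<open>e\<close>, the direction from \<open>u\<close> to the root, is a
  cut vertex of the Whitehead graph: no turn joins \<open>C\<close> and \<open>D\<close>. With \<open>C'\<close> that one of \<open>C\<close> and \<open>D\<close>
  that does not contain the inverse of \<open>e\<close>, the Whitehead automorphism of \<open>insert e C'\<close> and \<open>e\<close>
  saves all turns between \<open>e\<close> and \<open>C'\<close>; if there are none, no turn at all crosses \<open>C'\<close>.\<close>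

lemma primitive_or_reducible: "x \<in> primitive_elements F \<or> reducible"
proof -
  obtain u C D where u: "vertex u" and ne: "C \<noteq> {}" "D \<noteq> {}" and disj: "C \<inter> D = {}"
    and CD: "C \<union> D = {l. fst l \<in> fst ` set w \<and> (u = [] \<or> l \<noteq> inv_letter (last u))}"
    and turn: "\<And>p q. w = p @ q \<Longrightarrow> q \<noteq> [] \<Longrightarrow> u \<noteq> [] \<or> p \<noteq> [] \<Longrightarrow>
       \<not> (inv_letter (last (q @ p)) \<in> C \<and> hd q \<in> D) \<and> \<not> (inv_letter (last (q @ p)) \<in> D \<and> hd q \<in> C)"
    using coloured_directions by blast
  have L: "a \<in> L \<and> b \<in> L" if "(a, b) \<in> set (turns (last w) w)" for a b
    using turns_letters[OF that] w_ne by auto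
  show ?thesis
  proof (cases "u = []")
    case True
    show ?thesis
    proof (rule one_crossing[of C])
      show "C \<subseteq> L" "C \<noteq> L" using CD ne disj True by auto
      fix a b assume ab: "(a, b) \<in> set (turns (hd w) (tl w))"
      then obtain p q where pq: "tl w = p @ q" "q \<noteq> []" "b = hd q"
          "a = inv_letter (if p = [] then hd w else last p)"
        using turns_split by blast
      have "w = (hd w # p) @ q" using pq(1) w_ne by (metis append_Cons list.collapse)
      moreover have "a = inv_letter (last (q @ hd w # p))" using pq(4) by simp
      ultimately have "\<not> (a \<in> C \<and> b \<in> D) \<and> \<not> (a \<in> D \<and> b \<in> C)"
        using turn[of "hd w # p" q] pq by simp
      moreover have "a \<in> C \<union> D" "b \<in> C \<union> D" using L[of a b] ab CD True by (auto simp: turns_w)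
      ultimately show "a \<in> C \<longleftrightarrow> b \<in> C" using disj by blast
    qed (fact ne)
  next
    case False
    define e where "e = inv_letter (last u)"
    have eL: "e \<in> L" using u False by (auto simp: vertex_def e_def)
    have CDe: "C \<union> D = L - {e}" using CD False by (auto simp: e_def)
    have noturn: "\<not> (a \<in> C \<and> b \<in> D) \<and> \<not> (a \<in> D \<and> b \<in> C)" if ab: "(a, b) \<in> set (turns (last w) w)" for a b
    proof -
      obtain p q where "w = p @ q" "q \<noteq> []" "b = hd q" "a = inv_letter (if p = [] then last w else last p)"
        using turns_split[OF ab] by blast
      then show ?thesis using turn[of p q] False by (cases "p = []") auto
    qed
    obtain C' where C': "C' = C \<or> C' = D" "inv_letter e \<notin> C'" using disj by blast
    have C'L: "C' \<noteq> {}" "C' \<subseteq> L - {e}" using C' ne CDe by auto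
    have sep: "a \<in> C' \<longleftrightarrow> b \<in> C'" if "(a, b) \<in> set (turns (last w) w)" "a \<noteq> e" "b \<noteq> e" for a b
      using noturn[OF that(1)] L[OF that(1)] that(2,3) C' CDe disj by blast
    show ?thesis
    proof (cases "\<exists>(a, b)\<in>set (turns (last w) w). a = e \<and> b \<in> C' \<or> b = e \<and> a \<in> C'")
      case True
      then obtain a b where ab: "(a, b) \<in> set (turns (last w) w)" "a = e \<and> b \<in> C' \<or> b = e \<and> a \<in> C'" by blast
      let ?Z = "insert e C'"
      have "length (filter (\<lambda>(a, b). (a \<in> ?Z) \<noteq> (b \<in> ?Z)) (turns (last w) w)) <
          length (filter (\<lambda>(a, b). a = e \<or> b = e) (turns (last w) w))"
        by (rule length_filter_strict_mono[OF _ ab(1)]) (use sep ab(2) in auto)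
      also have "\<dots> = length (filter (\<lambda>m. fst m = fst e) w)"
        using length_filter_turns[of "last w" w e] cyc w_ne by (simp add: cyclically_reduced_def)
      finally have "length (filter (\<lambda>(a, b). (a \<in> ?Z) \<noteq> (b \<in> ?Z)) (turns (last w) w)) <
          length (filter (\<lambda>m. fst m = fst e) w)" .
      moreover have "fst e \<in> B" using eL letters by auto
      ultimately show ?thesis using C'(2) by (intro disjI2 exI[of _ ?Z] exI[of _ e] conjI) auto
    next
      case no: False
      show ?thesis
      proof (rule one_crossing)
        show "C' \<subseteq> L" "C' \<noteq> {}" "C' \<noteq> L" using C'L eL by auto
        fix a b assume "(a, b) \<in> set (turns (hd w) (tl w))"
        then have ab: "(a, b) \<in> set (turns (last w) w)" by (simp add: turns_w)
        then show "a \<in> C' \<longleftrightarrow> b \<in> C'" using sep[OF ab] no C'L(2) by blast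
      qed
    qed
  qed
qed

end

context free_group
begin

lemma cut_word_exI:
  assumes "cyclically_reduced w" "fst ` set w \<subseteq> B" "separating_cut F (word_value F w) \<kappa>"
  shows "\<exists>n. cut_word F B w \<kappa> n"
proof -
  define H where "H = (\<lambda>l. word_value F [l]) ` (fst ` set w \<times> UNIV) \<union> (\<lambda>i. inv (word_value F (take i w))) ` {..length w}"
  define bad where "bad = (\<Union>h\<in>H. {g \<in> carrier F. \<kappa> (g \<otimes> h) \<noteq> \<kappa> g})"
  have "word_value F [l] \<in> carrier F" if "l \<in> fst ` set w \<times> UNIV" for l
    using that assms(2) by (intro word_value_closed) auto
  moreover have "word_value F (take i w) \<in> carrier F" for i
    using assms(2) set_take_subset[of i w] by (intro word_value_closed) blast
  ultimately have "H \<subseteq> carrier F" by (auto simp: H_def)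
  then have "finite bad"
    using assms(3) unfolding bad_def by (intro finite_UN_I) (auto simp: H_def separating_cut_def)
  define n where "n = Suc (Max (insert 0 ((\<lambda>g. length (red g)) ` bad)))"
  have "\<kappa> (word_value F u \<otimes> h) = \<kappa> (word_value F u)"
    if u: "fst ` set u \<subseteq> fst ` set w" "reduced_word u" "n \<le> length u" and h: "h \<in> H" for u h
  proof (rule ccontr)
    assume "\<kappa> (word_value F u \<otimes> h) \<noteq> \<kappa> (word_value F u)"
    moreover have uB: "fst ` set u \<subseteq> B" using u(1) assms(2) by (rule order_trans)
    ultimately have "word_value F u \<in> bad" using h by (auto simp: bad_def)
    then have "length (red (word_value F u)) \<le> Max (insert 0 ((\<lambda>g. length (red g)) ` bad))"
      using \<open>finite bad\<close> by (intro Max_ge) auto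
    then show False using u(3) red_unique[OF uB u(2)] by (simp add: n_def)
  qed
  then have "cut_word F B w \<kappa> n" using assms by unfold_locales (auto simp: H_def)
  then show ?thesis by blast
qed

text \<open>Separating cuts are carried along by automorphisms, so a shortest word in the orbit of the
  element can be considered.\<close>

theorem primitive_if_separating_cut:
  assumes "fst ` set w \<subseteq> B" "separating_cut F (word_value F w) \<kappa>"
  shows "word_value F w \<in> primitive_elements F"
  using assms
proof (induction w arbitrary: \<kappa> rule: length_induct)
  case (1 w)
  let ?x = "word_value F w"
  have xF: "?x \<in> carrier F" using "1.prems" by simp
  have shorter: "?x \<in> primitive_elements F"
    if v: "length v < length w" "fst ` set v \<subseteq> B" and \<phi>: "\<phi> \<in> iso F F" "word_value F v = \<phi> ?x" for v \<phi>
    using "1.IH" v separating_cut_iso[OF \<phi>(1) xF "1.prems"(2)] primitive_iso[OF \<phi>(1) xF] \<phi>(2) by metis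
  consider "\<not> reduced_word w" | "w = []" | "reduced_word w" "w \<noteq> []" "hd w = inv_letter (last w)"
    | "cyclically_reduced w" by (auto simp: cyclically_reduced_iff)
  then show ?case
  proof cases
    case 1
    \<comment> \<open>the identity, written as a conjugation\<close>
    have "(\<lambda>g. \<one> \<otimes> g \<otimes> inv \<one>) \<in> iso F F" by (rule conjugation_iso) simp
    then show ?thesis
      using length_reduce_less[OF 1] fst_set_reduce[of w] "1.prems"(1) word_value_reduce[of w] xF
      by (intro shorter[of "reduce w" "\<lambda>g. \<one> \<otimes> g \<otimes> inv \<one>"]) auto
  next
    case 2
    then show ?thesis using "1.prems"(2) by (auto simp: separating_cut_def)
  next
    case 3
    obtain l v where lv: "w = l # v" using 3(2) by (cases w) auto
    then have "v \<noteq> []" using 3(3) by auto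
    then obtain m where m: "w = l # m @ [inv_letter l]"
      using lv 3(3) by (metis append_butlast_last_id inv_letter_inv_letter last_ConsR list.sel(1))
    have B: "fst l \<in> B" "fst ` set m \<subseteq> B" using "1.prems"(1) m by auto
    define a where "a = word_value F [l]"
    have aF: "a \<in> carrier F" using B by (simp add: a_def)
    have "word_value F [inv_letter l] = inv a"
      using word_value_inv_word[of "[l]"] B by (simp add: inv_word_def a_def)
    then have "?x = a \<otimes> (word_value F m \<otimes> inv a)"
      using word_value_append[of "[l]" "m @ [inv_letter l]"] word_value_append[of m "[inv_letter l]"] B m
      by (simp add: a_def)
    then have "word_value F m = inv a \<otimes> ?x \<otimes> inv (inv a)"
      using aF B by (simp add: m_assoc) (simp add: m_assoc[symmetric])
    then show ?thesis
      using m B conjugation_iso[of "inv a"] aF by (intro shorter[of m]) auto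
  next
    case 4
    then obtain n where "cut_word F B w \<kappa> n" using cut_word_exI "1.prems" by blast
    then interpret cut_word F B w \<kappa> n .
    show ?thesis
      using primitive_or_reducible
    proof
      assume reducible
      then obtain Z e where Z: "e \<in> Z" "inv_letter e \<notin> Z" "fst e \<in> B"
        and less: "length (filter (\<lambda>(a, b). (a \<in> Z) \<noteq> (b \<in> Z)) (turns (last w) w)) <
          length (filter (\<lambda>m. fst m = fst e) w)" by blast
      obtain \<phi> where \<phi>: "\<phi> \<in> iso F F" and "\<And>w. fst ` set w \<subseteq> B \<Longrightarrow> w \<noteq> [] \<Longrightarrow>
          \<exists>h\<in>carrier F. word_value F (whitehead_word Z e (last w) w) = h \<otimes> \<phi> (word_value F w) \<otimes> inv h"
        using whitehead_automorphism[OF Z] by metis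
      then obtain h where h: "h \<in> carrier F"
          "word_value F (whitehead_word Z e (last w) w) = h \<otimes> \<phi> ?x \<otimes> inv h"
        using letters w_ne by blast
      show ?thesis
      proof (rule shorter)
        show "length (whitehead_word Z e (last w) w) < length w"
          by (rule length_whitehead_word_less[OF less])
        show "fst ` set (whitehead_word Z e (last w) w) \<subseteq> B"
          by (rule order_trans[OF letters_whitehead_word]) (use letters Z(3) in simp)
        show "(\<lambda>g. h \<otimes> g \<otimes> inv h) \<circ> \<phi> \<in> iso F F"
          by (rule iso_set_trans[OF \<phi> conjugation_iso[OF h(1)]])
        show "word_value F (whitehead_word Z e (last w) w) = ((\<lambda>g. h \<otimes> g \<otimes> inv h) \<circ> \<phi>) ?x"
          using h(2) by simp
      qed
    qed
  qed
qed

end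

section \<open>Primitive elements and the profinite completion\<close>

theorem corollary8p1:
  fixes F :: "('a, 'm) monoid_scheme" and k :: nat
  assumes "1 \<le> k" and "free_group_of_rank F k"
  shows "primitive_elements F =
    {x \<in> carrier F. completion_map F x \<in>
       profinite_primitive_elements (profinite_completion F) (completion_topology F)}"
proof (intro equalityI subsetI)
  fix x assume "x \<in> primitive_elements F"
  then obtain C where C: "free_basis F C" "x \<in> C" by (auto simp: primitive_elements_def)
  interpret group F using assms(2) by (simp add: free_group_of_rank_def)
  interpret free_group F C using C(1) by unfold_locales
  show "x \<in> {x \<in> carrier F. completion_map F x \<in>
      profinite_primitive_elements (profinite_completion F) (completion_topology F)}"
    using profinite_basis_completion_map C(2) B_carrier by (auto simp: profinite_primitive_elements_def)
next
  fix x assume x: "x \<in> {x \<in> carrier F. completion_map F x \<in>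
      profinite_primitive_elements (profinite_completion F) (completion_topology F)}"
  obtain B where B: "free_basis F B" using assms(2) by (auto simp: free_group_of_rank_def)
  interpret group F using assms(2) by (simp add: free_group_of_rank_def)
  interpret free_group F B using B by unfold_locales
  have w: "fst ` set (red x) \<subseteq> B" and xw: "word_value F (red x) = x"
    using x red_letters word_value_red by auto
  have "\<not> (\<exists>l. (\<forall>g\<in>carrier F. annihilates (red x) (\<lambda>h. l (g \<otimes>\<^bsub>F\<^esub> h))) \<and> l \<one>\<^bsub>F\<^esub> = 1)"
    using profinite_primitive_no_functional[OF assms(2,1) w] x unfolding xw by blast
  then obtain \<kappa> where "separating_cut F x \<kappa>"
    using separating_cut_or_functional[OF w] xw by auto
  then show "x \<in> primitive_elements F"
    using primitive_if_separating_cut[OF w] xw by simp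
qed

end
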